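(* Let $s\ge0$ and $$\mathcal A_s:=\bigcup_{j\ge0}\big\{(1+\mu_j)^{-s/2}u:\ u\in E_j,\ \|u\|_{L^2(M)}=1\big\}.$$ Then the closed unit ball of $\mathcal V^{\mathrm{spec}}_s(M)$ is $$\{f:\|f\|_{\mathcal V^{\mathrm{spec}}_s(M)}\le1\}=\overline{\operatorname{aconv}(\mathcal A_s)}^{\,L^2(M)},$$ where $\operatorname{aconv}$ denotes the absolutely convex hull. Let $\mathfrak E(L)$ denote the collection of eigenbases $\mathcal B=\{\phi_{j,\ell}:j\ge0,\ 1\le\ell\le d_j\}$ obtained by choosing an orthonormal basis separately in each eigenspace, and define $$\|f\|_{\mathrm{SB},s;\mathcal B}:=\sum_{j\ge0}(1+\mu_j)^{s/2}\sum_{\ell=1}^{d_j}|\langle f,\phi_{j,\ell}\rangle_{L^2(M)}|.$$ Then, with extended values, for every $f\in L^2(M)$, $$\|f\|_{\mathcal V^{\mathrm{spec}}_s(M)}=\min_{\mathcal B\in\mathfrak E(L)}\|f\|_{\mathrm{SB},s;\mathcal B}.$$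
   Context: $(M,g)$ is a compact connected smooth Riemannian manifold without boundary, $\nu$ is Riemannian volume normalized so that $\nu(M)=1$, $L^2(M)=L^2(M,\nu)$ (real-valued). $L=-\Delta_M$ is the nonnegative Laplace–Beltrami operator with distinct eigenvalues $0=\mu_0<\mu_1<\cdots$; $E_j=\ker(L-\mu_jI)$, $d_j=\dim E_j$, and $P_j:L^2(M)\to E_j$ is the orthogonal projector. For $s\ge0$ and $f\in L^2(M)$, $\|f\|_{\mathcal V^{\mathrm{spec}}_s(M)}=\sum_{j\ge0}(1+\mu_j)^{s/2}\|P_jf\|_{L^2(M)}\in[0,\infty]$ and $\mathcal V^{\mathrm{spec}}_s(M)=\{f\in L^2(M):\|f\|_{\mathcal V^{\mathrm{spec}}_s(M)}<\infty\}$. The absolutely convex hull of a set consists of finite sums $\sum_rc_ra_r$ with $a_r$ in the set, $c_r\in\mathbb R$ and $\sum_r|c_r|\le1$. *)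

theory Defs
  imports "HOL-Analysis.Analysis"
begin

section \<open>Smooth functions on open subsets of Euclidean space\<close>

primrec Ck_on :: "nat \<Rightarrow> 'a::real_normed_vector set \<Rightarrow> ('a \<Rightarrow> 'b::real_normed_vector) \<Rightarrow> bool" where
  "Ck_on 0 S f \<longleftrightarrow> continuous_on S f"
| "Ck_on (Suc k) S f \<longleftrightarrow>
     (\<forall>x\<in>S. f differentiable (at x)) \<and> (\<forall>v. Ck_on k S (\<lambda>x. frechet_derivative f (at x) v))"

definition smooth_on :: "'a::real_normed_vector set \<Rightarrow> ('a \<Rightarrow> 'b::real_normed_vector) \<Rightarrow> bool" where
  "smooth_on S f \<longleftrightarrow> (\<forall>k. Ck_on k S f)"

definition partial_deriv :: "'n::finite \<Rightarrow> (real^'n \<Rightarrow> real) \<Rightarrow> real^'n \<Rightarrow> real" where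
  "partial_deriv i f x = frechet_derivative f (at x) (axis i 1)"


section \<open>Closed Riemannian manifolds\<close>

text \<open>The manifold is the whole Hausdorff type \<open>'m\<close>; its dimension is \<open>CARD('n)\<close>. A chart is a
  coordinate domain together with its coordinate map. An atlas need not be maximal, since all the
  structures below are determined by their expressions in the charts of any one atlas.\<close>

type_synonym ('m, 'n) chart = "'m set \<times> ('m \<Rightarrow> real^'n)"

definition chart_inv :: "('m, 'n::finite) chart \<Rightarrow> real^'n \<Rightarrow> 'm" where
  "chart_inv c = inv_into (fst c) (snd c)"

definition is_chart :: "('m::topological_space, 'n::finite) chart \<Rightarrow> bool" where
  "is_chart c \<longleftrightarrow> open (fst c) \<and> open (snd c ` fst c) \<and>
     homeomorphism (fst c) (snd c ` fst c) (snd c) (chart_inv c)"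

definition smooth_atlas :: "('m::topological_space, 'n::finite) chart set \<Rightarrow> bool" where
  "smooth_atlas A \<longleftrightarrow> (\<forall>c\<in>A. is_chart c) \<and> (\<Union>c\<in>A. fst c) = UNIV \<and>
     (\<forall>c\<in>A. \<forall>d\<in>A. smooth_on (snd c ` (fst c \<inter> fst d)) (snd d \<circ> chart_inv c))"

definition smooth_functions :: "('m, 'n::finite) chart set \<Rightarrow> ('m \<Rightarrow> real) set" where
  "smooth_functions A = {u. \<forall>c\<in>A. smooth_on (snd c ` fst c) (u \<circ> chart_inv c)}"

text \<open>\<open>g c p\<close> is the Gram matrix of the metric at the point \<open>p\<close> with respect to the coordinate
  frame of the chart \<open>c\<close>; the last clause is the transformation law of a covariant 2-tensor.\<close>

definition riemannian_metric ::
    "('m, 'n::finite) chart set \<Rightarrow> (('m, 'n) chart \<Rightarrow> 'm \<Rightarrow> real^'n^'n) \<Rightarrow> bool" where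
  "riemannian_metric A g \<longleftrightarrow>
     (\<forall>c\<in>A. smooth_on (snd c ` fst c) (g c \<circ> chart_inv c)) \<and>
     (\<forall>c\<in>A. \<forall>p\<in>fst c. transpose (g c p) = g c p \<and> (\<forall>v. v \<noteq> 0 \<longrightarrow> v \<bullet> (g c p *v v) > 0)) \<and>
     (\<forall>c\<in>A. \<forall>d\<in>A. \<forall>p\<in>fst c \<inter> fst d.
        let J = matrix (frechet_derivative (snd d \<circ> chart_inv c) (at (snd c p)))
        in g c p = transpose J ** g d p ** J)"

definition closed_riemannian_manifold ::
    "('m::t2_space, 'n::finite) chart set \<Rightarrow> (('m, 'n) chart \<Rightarrow> 'm \<Rightarrow> real^'n^'n) \<Rightarrow> bool" where
  "closed_riemannian_manifold A g \<longleftrightarrow>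
     compact (UNIV :: 'm set) \<and> connected (UNIV :: 'm set) \<and> smooth_atlas A \<and> riemannian_metric A g"

text \<open>The Riemannian volume is the unique Borel measure with density \<open>sqrt (det g)\<close> in every chart.\<close>

definition riemannian_volume ::
    "('m::topological_space, 'n::finite) chart set \<Rightarrow> (('m, 'n) chart \<Rightarrow> 'm \<Rightarrow> real^'n^'n) \<Rightarrow>
     'm measure \<Rightarrow> bool" where
  "riemannian_volume A g V \<longleftrightarrow> sets V = sets borel \<and>
     (\<forall>c\<in>A. \<forall>B\<in>sets borel. B \<subseteq> fst c \<longrightarrow>
        emeasure V B = (\<integral>\<^sup>+x\<in>snd c ` B. ennreal (sqrt (det (g c (chart_inv c x)))) \<partial>lborel))"

definition normalized_measure :: "'m measure \<Rightarrow> 'm measure" where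
  "normalized_measure V = scale_measure (1 / emeasure V (space V)) V"

text \<open>The divergence of the gradient in coordinates,
  \<open>(1 / sqrt (det G)) \<Sum>\<^sub>i \<partial>\<^sub>i (sqrt (det G) \<Sum>\<^sub>j (G\<^sup>-\<^sup>1)\<^sub>i\<^sub>j \<partial>\<^sub>j u)\<close>.
  For smooth \<open>u\<close> the value at a point does not depend on the chart around it.\<close>

definition chart_laplacian ::
    "(('m, 'n::finite) chart \<Rightarrow> 'm \<Rightarrow> real^'n^'n) \<Rightarrow> ('m, 'n) chart \<Rightarrow> ('m \<Rightarrow> real) \<Rightarrow> 'm \<Rightarrow> real" where
  "chart_laplacian g c u p =
     (let G = (\<lambda>y. g c (chart_inv c y));
          \<rho> = (\<lambda>y. sqrt (det (G y)));
          x = snd c p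
      in 1 / \<rho> x * (\<Sum>i\<in>UNIV. partial_deriv i
            (\<lambda>y. \<rho> y * (\<Sum>j\<in>UNIV. matrix_inv (G y) $ i $ j * partial_deriv j (u \<circ> chart_inv c) y)) x))"

definition laplacian ::
    "('m, 'n::finite) chart set \<Rightarrow> (('m, 'n) chart \<Rightarrow> 'm \<Rightarrow> real^'n^'n) \<Rightarrow> ('m \<Rightarrow> real) \<Rightarrow> 'm \<Rightarrow> real" where
  "laplacian A g u p = chart_laplacian g (SOME c. c \<in> A \<and> p \<in> fst c) u p"


section \<open>Real \<open>L\<^sup>2\<close> spaces\<close>

text \<open>Elements of \<open>L\<^sup>2\<close> are represented by square-integrable functions. Every notion below is
  insensitive to changes on null sets; identities between elements are almost-everywhere ones.\<close>

definition l2_space :: "'m measure \<Rightarrow> ('m \<Rightarrow> real) set" where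
  "l2_space M = {f \<in> borel_measurable M. integrable M (\<lambda>x. (f x)\<^sup>2)}"

definition l2_inner :: "'m measure \<Rightarrow> ('m \<Rightarrow> real) \<Rightarrow> ('m \<Rightarrow> real) \<Rightarrow> real" where
  "l2_inner M f h = (LINT x|M. f x * h x)"

definition l2_norm :: "'m measure \<Rightarrow> ('m \<Rightarrow> real) \<Rightarrow> real" where
  "l2_norm M f = sqrt (l2_inner M f f)"

definition l2_closure :: "'m measure \<Rightarrow> ('m \<Rightarrow> real) set \<Rightarrow> ('m \<Rightarrow> real) set" where
  "l2_closure M S = {f \<in> l2_space M. \<forall>\<epsilon>>0. \<exists>h\<in>S. l2_norm M (\<lambda>x. f x - h x) < \<epsilon>}"

definition l2_basis :: "'m measure \<Rightarrow> ('m \<Rightarrow> real) set \<Rightarrow> nat \<Rightarrow> (nat \<Rightarrow> 'm \<Rightarrow> real) \<Rightarrow> bool" where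
  "l2_basis M V n b \<longleftrightarrow>
     (\<forall>l\<in>{1..n}. b l \<in> V) \<and>
     (\<forall>a::nat \<Rightarrow> real. (AE x in M. (\<Sum>l=1..n. a l * b l x) = 0) \<longrightarrow> (\<forall>l\<in>{1..n}. a l = 0)) \<and>
     (\<forall>u\<in>V. \<exists>a::nat \<Rightarrow> real. AE x in M. u x = (\<Sum>l=1..n. a l * b l x))"

definition l2_dim :: "'m measure \<Rightarrow> ('m \<Rightarrow> real) set \<Rightarrow> nat" where
  "l2_dim M V = (THE n. \<exists>b. l2_basis M V n b)"

definition l2_orthonormal_basis ::
    "'m measure \<Rightarrow> ('m \<Rightarrow> real) set \<Rightarrow> nat \<Rightarrow> (nat \<Rightarrow> 'm \<Rightarrow> real) \<Rightarrow> bool" where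
  "l2_orthonormal_basis M V n b \<longleftrightarrow> l2_basis M V n b \<and>
     (\<forall>k\<in>{1..n}. \<forall>l\<in>{1..n}. l2_inner M (b k) (b l) = (if k = l then 1 else 0))"

text \<open>For a closed subspace \<open>V\<close> the projection is determined up to a null set.\<close>

definition l2_proj :: "'m measure \<Rightarrow> ('m \<Rightarrow> real) set \<Rightarrow> ('m \<Rightarrow> real) \<Rightarrow> 'm \<Rightarrow> real" where
  "l2_proj M V f = (SOME h. h \<in> V \<and> (\<forall>u\<in>V. l2_inner M (\<lambda>x. f x - h x) u = 0))"

definition absolutely_convex_hull :: "('m \<Rightarrow> real) set \<Rightarrow> ('m \<Rightarrow> real) set" where
  "absolutely_convex_hull S =
     {(\<lambda>x. \<Sum>r<n. c r * a r x) | (n::nat) (c::nat \<Rightarrow> real) a.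
        (\<forall>r<n. a r \<in> S) \<and> (\<Sum>r<n. \<bar>c r\<bar>) \<le> 1}"


section \<open>The Laplace--Beltrami operator on \<open>L\<^sup>2\<close>\<close>

text \<open>Graph of the Friedrichs extension of a nonnegative symmetric operator \<open>T\<close> with domain \<open>D\<close>:
  the restriction of the adjoint of \<open>T\<close> to the \<open>L\<^sup>2\<close> functions that are limits of sequences in
  \<open>D\<close> which are Cauchy for the quadratic form of \<open>T\<close>.\<close>

definition friedrichs_extension ::
    "'m measure \<Rightarrow> ('m \<Rightarrow> real) set \<Rightarrow> (('m \<Rightarrow> real) \<Rightarrow> 'm \<Rightarrow> real) \<Rightarrow>
     ('m \<Rightarrow> real) \<Rightarrow> ('m \<Rightarrow> real) \<Rightarrow> bool" where
  "friedrichs_extension M D T u f \<longleftrightarrow>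
     u \<in> l2_space M \<and> f \<in> l2_space M \<and>
     (\<exists>w::nat \<Rightarrow> 'm \<Rightarrow> real. (\<forall>n. w n \<in> D) \<and>
        (\<lambda>n. l2_norm M (\<lambda>x. w n x - u x)) \<longlonglongrightarrow> 0 \<and>
        (\<forall>\<epsilon>>0. \<exists>N. \<forall>m\<ge>N. \<forall>n\<ge>N.
           l2_inner M (T (\<lambda>x. w m x - w n x)) (\<lambda>x. w m x - w n x) < \<epsilon>)) \<and>
     (\<forall>\<phi>\<in>D. l2_inner M u (T \<phi>) = l2_inner M f \<phi>)"

text \<open>On a closed manifold \<open>-\<Delta>\<close> is essentially self-adjoint on the smooth functions, so its
  Friedrichs extension is its only self-adjoint extension.\<close>

definition laplace_beltrami ::
    "('m, 'n::finite) chart set \<Rightarrow> (('m, 'n) chart \<Rightarrow> 'm \<Rightarrow> real^'n^'n) \<Rightarrow> 'm measure \<Rightarrow>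
     ('m \<Rightarrow> real) \<Rightarrow> ('m \<Rightarrow> real) \<Rightarrow> bool" where
  "laplace_beltrami A g M =
     friedrichs_extension M (smooth_functions A) (\<lambda>u x. - laplacian A g u x)"

definition eigenspace ::
    "('m, 'n::finite) chart set \<Rightarrow> (('m, 'n) chart \<Rightarrow> 'm \<Rightarrow> real^'n^'n) \<Rightarrow> 'm measure \<Rightarrow>
     real \<Rightarrow> ('m \<Rightarrow> real) set" where
  "eigenspace A g M \<kappa> = {u. laplace_beltrami A g M u (\<lambda>x. \<kappa> * u x)}"

definition eigenvalues ::
    "('m, 'n::finite) chart set \<Rightarrow> (('m, 'n) chart \<Rightarrow> 'm \<Rightarrow> real^'n^'n) \<Rightarrow> 'm measure \<Rightarrow> real set" where
  "eigenvalues A g M = {\<kappa>. \<exists>u\<in>eigenspace A g M \<kappa>. \<not> (AE x in M. u x = 0)}"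


section \<open>Spectral variation spaces\<close>

text \<open>Below \<open>\<mu> j\<close> are the eigenvalues and \<open>E j\<close> the corresponding eigenspaces.\<close>

definition spec_norm ::
    "'m measure \<Rightarrow> (nat \<Rightarrow> real) \<Rightarrow> (nat \<Rightarrow> ('m \<Rightarrow> real) set) \<Rightarrow> real \<Rightarrow> ('m \<Rightarrow> real) \<Rightarrow> ennreal" where
  "spec_norm M \<mu> E s f = (\<Sum>j. ennreal ((1 + \<mu> j) powr (s / 2) * l2_norm M (l2_proj M (E j) f)))"

definition spec_space ::
    "'m measure \<Rightarrow> (nat \<Rightarrow> real) \<Rightarrow> (nat \<Rightarrow> ('m \<Rightarrow> real) set) \<Rightarrow> real \<Rightarrow> ('m \<Rightarrow> real) set" where
  "spec_space M \<mu> E s = {f \<in> l2_space M. spec_norm M \<mu> E s f < \<infinity>}"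

definition spec_atoms ::
    "'m measure \<Rightarrow> (nat \<Rightarrow> real) \<Rightarrow> (nat \<Rightarrow> ('m \<Rightarrow> real) set) \<Rightarrow> real \<Rightarrow> ('m \<Rightarrow> real) set" where
  "spec_atoms M \<mu> E s =
     (\<Union>j. {(\<lambda>x. (1 + \<mu> j) powr (- s / 2) * u x) | u. u \<in> E j \<and> l2_norm M u = 1})"

text \<open>Only the values \<open>B j l\<close> with \<open>1 \<le> l \<le> dim (E j)\<close> are relevant.\<close>

definition eigenbases ::
    "'m measure \<Rightarrow> (nat \<Rightarrow> ('m \<Rightarrow> real) set) \<Rightarrow> (nat \<Rightarrow> nat \<Rightarrow> 'm \<Rightarrow> real) set" where
  "eigenbases M E = {B. \<forall>j. l2_orthonormal_basis M (E j) (l2_dim M (E j)) (B j)}"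

definition sb_norm ::
    "'m measure \<Rightarrow> (nat \<Rightarrow> real) \<Rightarrow> (nat \<Rightarrow> ('m \<Rightarrow> real) set) \<Rightarrow> real \<Rightarrow>
     (nat \<Rightarrow> nat \<Rightarrow> 'm \<Rightarrow> real) \<Rightarrow> ('m \<Rightarrow> real) \<Rightarrow> ennreal" where
  "sb_norm M \<mu> E s B f =
     (\<Sum>j. ennreal ((1 + \<mu> j) powr (s / 2) * (\<Sum>l=1..l2_dim M (E j). \<bar>l2_inner M f (B j l)\<bar>)))"

end

theory Submission
  imports Defs "HOL-Complex_Analysis.Great_Picard" "HOL-Computational_Algebra.Polynomial"
begin

text \<open>
  Everything rests on the spectral theorem for the Laplacian of a closed manifold: the eigenspaces are
  finite-dimensional, mutually orthogonal, and together span \<open>L\<^sup>2\<close>. Granted this, both assertions are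
  short.

  If \<open>f\<close> lies in the unit ball, then each projection \<open>P j f\<close> is its weighted norm times an atom, and the
  weighted norms sum to at most 1. So the partial sums of \<open>f\<close> belong to the absolutely convex hull of the
  atoms, and by completeness they converge to \<open>f\<close>. Conversely, a weighted sum of finitely many norms
  \<open>\<parallel>P j f\<parallel>\<close> is a continuous seminorm that is at most 1 on atoms, hence on their closed hull; letting the
  number of terms grow gives the norm bound (\<open>unit_ball_eq_closure\<close>). For the second assertion,
  \<open>\<parallel>P j f\<parallel>\<close> is the Euclidean norm of the coefficients of \<open>f\<close> in any orthonormal basis of the \<open>j\<close>-th
  eigenspace, so it is at most their \<open>\<ell>\<^sup>1\<close> norm, and equality holds for a basis that contains a multiple
  of \<open>P j f\<close> (\<open>l2_norm_proj_eq_adapted_basis\<close>). Choosing such a basis in each eigenspace attains the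
  minimum.

  The spectral theorem is proved for an abstract operator (locale \<open>compact_form\<close>): nonnegative,
  symmetric, densely defined, and satisfying a Rellich inequality, which bounds the \<open>L\<^sup>2\<close> norm by a small
  multiple of the form norm plus finitely many functionals. The Friedrichs extension then has a
  resolvent, obtained by minimising a quadratic functional (\<open>resolvent_exists\<close>), and the Rellich
  inequality makes this resolvent compact (\<open>R_compact\<close>) and the eigenspaces finite-dimensional
  (\<open>eig_finite_dim\<close>). Were the orthogonal complement of all eigenspaces nonzero, the maximum of the
  quadratic form of the resolvent on its unit sphere would be attained at an eigenvector inside that
  complement (\<open>eigenfunctions_complete\<close>).

  For the Laplacian on smooth functions the hypotheses are verified through charts and a partition of
  unity made of smooth bumps. Integration by parts in charts gives Green's formula (\<open>green\<close>), hence
  symmetry and nonnegativity, and, tested against bumps, the chart independence of the Laplacian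
  (\<open>lap_chart_independent\<close>). Indicators of open sets are limits of smooth functions, whence density
  (\<open>D_dense\<close>). The Rellich inequality is first proved for compactly supported functions on Euclidean
  space, by averaging over small balls (\<open>rellich_inequality\<close>), and then transported to the manifold
  (\<open>rellich_manifold\<close>).
\<close>

section \<open>Square-integrable functions\<close>

lemma l2_space_measurable [measurable_dest]: "f \<in> l2_space M \<Longrightarrow> f \<in> borel_measurable M"
  by (simp add: l2_space_def)

lemma l2_space_integrable_square: "f \<in> l2_space M \<Longrightarrow> integrable M (\<lambda>x. (f x)\<^sup>2)"
  by (simp add: l2_space_def)

lemma l2_space_integrable_mult:
  assumes f: "f \<in> l2_space M" and g: "g \<in> l2_space M"
  shows "integrable M (\<lambda>x. f x * g x)"
proof (rule Bochner_Integration.integrable_bound[where f="\<lambda>x. (f x)\<^sup>2 + (g x)\<^sup>2"])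
  show "integrable M (\<lambda>x. (f x)\<^sup>2 + (g x)\<^sup>2)"
    using f g by (intro Bochner_Integration.integrable_add l2_space_integrable_square)
  show "(\<lambda>x. f x * g x) \<in> borel_measurable M" using f g by measurable
  have "\<bar>a * b\<bar> \<le> a\<^sup>2 + b\<^sup>2" for a b :: real
  proof -
    have "0 \<le> (\<bar>a\<bar> - \<bar>b\<bar>)\<^sup>2" by simp
    hence "2 * \<bar>a * b\<bar> \<le> a\<^sup>2 + b\<^sup>2" by (simp add: power2_diff abs_mult)
    thus ?thesis by linarith
  qed
  thus "AE x in M. norm (f x * g x) \<le> norm ((f x)\<^sup>2 + (g x)\<^sup>2)" by simp
qed

lemma l2_space_zero [simp]: "(\<lambda>_. 0) \<in> l2_space M"
  by (simp add: l2_space_def)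

lemma l2_space_add [simp]:
  assumes "f \<in> l2_space M" "g \<in> l2_space M" shows "(\<lambda>x. f x + g x) \<in> l2_space M"
proof -
  have "(\<lambda>x. (f x + g x)\<^sup>2) = (\<lambda>x. ((f x)\<^sup>2 + (g x)\<^sup>2) + 2 * (f x * g x))"
    by (auto simp: power2_sum)
  thus ?thesis using assms l2_space_integrable_mult[OF assms] by (auto simp add: l2_space_def)
qed

lemma l2_space_scale [simp]:
  assumes "f \<in> l2_space M" shows "(\<lambda>x. c * f x) \<in> l2_space M"
  using assms by (auto simp add: l2_space_def power_mult_distrib)

lemma l2_space_diff [simp]:
  assumes "f \<in> l2_space M" "g \<in> l2_space M" shows "(\<lambda>x. f x - g x) \<in> l2_space M"
  using l2_space_add[OF assms(1) l2_space_scale[OF assms(2), of "-1"]] by simp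

lemma l2_space_sum [simp]:
  assumes "\<And>i. i \<in> I \<Longrightarrow> f i \<in> l2_space M" shows "(\<lambda>x. \<Sum>i\<in>I. f i x) \<in> l2_space M"
  using assms by (induction I rule: infinite_finite_induct) auto

lemma l2_inner_commute: "l2_inner M f g = l2_inner M g f"
  by (simp add: l2_inner_def mult.commute)

lemma l2_inner_AE_cong:
  assumes "f \<in> borel_measurable M" "f' \<in> borel_measurable M" "g \<in> borel_measurable M"
    "AE x in M. f x = f' x"
  shows "l2_inner M f g = l2_inner M f' g"
  unfolding l2_inner_def by (rule integral_cong_AE) (use assms in auto)

lemma l2_inner_zero [simp]: "l2_inner M (\<lambda>_. 0) g = 0" "l2_inner M g (\<lambda>_. 0) = 0"
  by (auto simp: l2_inner_def)

lemma l2_inner_scale_left [simp]: "l2_inner M (\<lambda>x. c * f x) g = c * l2_inner M f g"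
  by (simp add: l2_inner_def mult.assoc)

lemma l2_inner_scale_right [simp]: "l2_inner M g (\<lambda>x. c * f x) = c * l2_inner M g f"
  by (simp add: l2_inner_def mult.left_commute)

lemma l2_inner_add_left [simp]:
  assumes "f \<in> l2_space M" "h \<in> l2_space M" "g \<in> l2_space M"
  shows "l2_inner M (\<lambda>x. f x + h x) g = l2_inner M f g + l2_inner M h g"
  using assms by (simp add: l2_inner_def distrib_right l2_space_integrable_mult)

lemma l2_inner_add_right [simp]:
  assumes "f \<in> l2_space M" "h \<in> l2_space M" "g \<in> l2_space M"
  shows "l2_inner M g (\<lambda>x. f x + h x) = l2_inner M g f + l2_inner M g h"
  using assms by (simp add: l2_inner_def distrib_left l2_space_integrable_mult)

lemma l2_inner_diff_left [simp]:
  assumes "f \<in> l2_space M" "h \<in> l2_space M" "g \<in> l2_space M"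
  shows "l2_inner M (\<lambda>x. f x - h x) g = l2_inner M f g - l2_inner M h g"
  using assms by (simp add: l2_inner_def left_diff_distrib l2_space_integrable_mult)

lemma l2_inner_diff_right [simp]:
  assumes "f \<in> l2_space M" "h \<in> l2_space M" "g \<in> l2_space M"
  shows "l2_inner M g (\<lambda>x. f x - h x) = l2_inner M g f - l2_inner M g h"
  using assms by (simp add: l2_inner_def right_diff_distrib l2_space_integrable_mult)

lemma l2_inner_sum_left:
  assumes "\<And>i. i \<in> I \<Longrightarrow> f i \<in> l2_space M" "g \<in> l2_space M"
  shows "l2_inner M (\<lambda>x. \<Sum>i\<in>I. f i x) g = (\<Sum>i\<in>I. l2_inner M (f i) g)"
  using assms by (induction I rule: infinite_finite_induct) auto

lemma l2_inner_sum_right: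
  assumes "\<And>i. i \<in> I \<Longrightarrow> f i \<in> l2_space M" "g \<in> l2_space M"
  shows "l2_inner M g (\<lambda>x. \<Sum>i\<in>I. f i x) = (\<Sum>i\<in>I. l2_inner M g (f i))"
  using l2_inner_sum_left[OF assms] by (simp add: l2_inner_commute[of M g])

lemma l2_inner_self_nonneg: "0 \<le> l2_inner M f f"
  by (simp add: l2_inner_def)

lemma l2_norm_nonneg [simp]: "0 \<le> l2_norm M f"
  by (simp add: l2_norm_def l2_inner_self_nonneg)

lemma l2_norm_square: "(l2_norm M f)\<^sup>2 = l2_inner M f f"
  by (simp add: l2_norm_def l2_inner_self_nonneg)

lemma l2_norm_zero [simp]: "l2_norm M (\<lambda>_. 0) = 0"
  by (simp add: l2_norm_def)

lemma l2_norm_scale [simp]: "l2_norm M (\<lambda>x. c * f x) = \<bar>c\<bar> * l2_norm M f"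
  by (simp add: l2_norm_def real_sqrt_mult mult.assoc[symmetric])

lemma l2_norm_minus_commute: "l2_norm M (\<lambda>x. f x - g x) = l2_norm M (\<lambda>x. g x - f x)"
  using l2_norm_scale[of M "-1" "\<lambda>x. g x - f x"] by simp

lemma l2_norm_eq_0_iff:
  assumes "f \<in> l2_space M" shows "l2_norm M f = 0 \<longleftrightarrow> (AE x in M. f x = 0)"
proof -
  have "l2_norm M f = 0 \<longleftrightarrow> (LINT x|M. (f x)\<^sup>2) = 0"
    by (simp add: l2_norm_def l2_inner_def power2_eq_square)
  also have "\<dots> \<longleftrightarrow> (AE x in M. (f x)\<^sup>2 = 0)"
    by (rule integral_nonneg_eq_0_iff_AE) (use assms in \<open>auto simp: l2_space_integrable_square\<close>)
  finally show ?thesis by simp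
qed

text \<open>The algebra behind all Cauchy--Schwarz inequalities below: the one of \<open>L\<^sup>2\<close>, and those of the
  semidefinite forms of an operator, of its resolvent, and of a matrix.\<close>

lemma nonneg_quadratic_discriminant:
  fixes p q r :: real
  assumes "\<And>t. 0 \<le> p - 2 * t * q + t\<^sup>2 * r" and "r \<ge> 0"
  shows "q\<^sup>2 \<le> p * r"
proof (cases "r = 0")
  case True
  have "q = 0"
  proof (rule ccontr)
    assume "q \<noteq> 0"
    thus False using assms(1)[of "(p+1)/(2*q)"] True by (simp add: field_simps)
  qed
  thus ?thesis using True by simp
next
  case False
  hence "r > 0" using \<open>r \<ge> 0\<close> by simp
  thus ?thesis using assms(1)[of "q / r"] by (simp add: field_simps power2_eq_square)
qed

lemma l2_norm_diff_square:
  assumes "f \<in> l2_space M" "g \<in> l2_space M"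
  shows "(l2_norm M (\<lambda>x. f x - g x))\<^sup>2 = (l2_norm M f)\<^sup>2 - 2 * l2_inner M f g + (l2_norm M g)\<^sup>2"
  using assms by (simp add: l2_norm_square l2_inner_commute[of M g f])

lemma l2_cauchy_schwarz:
  assumes "f \<in> l2_space M" "g \<in> l2_space M"
  shows "\<bar>l2_inner M f g\<bar> \<le> l2_norm M f * l2_norm M g"
proof -
  have "(l2_inner M f g)\<^sup>2 \<le> (l2_norm M f)\<^sup>2 * (l2_norm M g)\<^sup>2"
  proof (rule nonneg_quadratic_discriminant)
    fix t
    have "0 \<le> (l2_norm M (\<lambda>x. f x - t * g x))\<^sup>2" by simp
    also have "\<dots> = (l2_norm M f)\<^sup>2 - 2 * t * l2_inner M f g + t\<^sup>2 * (l2_norm M g)\<^sup>2"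
      using assms by (subst l2_norm_diff_square) (auto simp: power_mult_distrib)
    finally show "0 \<le> (l2_norm M f)\<^sup>2 - 2 * t * l2_inner M f g + t\<^sup>2 * (l2_norm M g)\<^sup>2" .
  qed simp
  hence "\<bar>l2_inner M f g\<bar>\<^sup>2 \<le> (l2_norm M f * l2_norm M g)\<^sup>2" by (simp add: power_mult_distrib)
  thus ?thesis by (rule power2_le_imp_le) simp
qed

lemma l2_norm_triangle:
  assumes "f \<in> l2_space M" "g \<in> l2_space M"
  shows "l2_norm M (\<lambda>x. f x + g x) \<le> l2_norm M f + l2_norm M g"
proof (rule power2_le_imp_le)
  have "(l2_norm M (\<lambda>x. f x + g x))\<^sup>2 = (l2_norm M f)\<^sup>2 + 2 * l2_inner M f g + (l2_norm M g)\<^sup>2"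
    using assms by (simp add: l2_norm_square l2_inner_commute[of M g f])
  also have "\<dots> \<le> (l2_norm M f + l2_norm M g)\<^sup>2"
    using l2_cauchy_schwarz[OF assms] by (simp add: power2_sum)
  finally show "(l2_norm M (\<lambda>x. f x + g x))\<^sup>2 \<le> (l2_norm M f + l2_norm M g)\<^sup>2" .
qed simp

lemma l2_norm_triangle_diff:
  assumes "f \<in> l2_space M" "g \<in> l2_space M" "h \<in> l2_space M"
  shows "l2_norm M (\<lambda>x. f x - h x) \<le> l2_norm M (\<lambda>x. f x - g x) + l2_norm M (\<lambda>x. g x - h x)"
  using l2_norm_triangle[of "\<lambda>x. f x - g x" M "\<lambda>x. g x - h x"] assms by simp

lemma l2_norm_le_add_diff:
  assumes "f \<in> l2_space M" "g \<in> l2_space M"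
  shows "l2_norm M f \<le> l2_norm M g + l2_norm M (\<lambda>x. f x - g x)"
  using l2_norm_triangle[of g M "\<lambda>x. f x - g x"] assms by simp

lemma l2_norm_sum_le:
  assumes "\<And>i. i \<in> I \<Longrightarrow> f i \<in> l2_space M"
  shows "l2_norm M (\<lambda>x. \<Sum>i\<in>I. f i x) \<le> (\<Sum>i\<in>I. l2_norm M (f i))"
  using assms
proof (induction I rule: infinite_finite_induct)
  case (insert i I)
  have "l2_norm M (\<lambda>x. \<Sum>i\<in>insert i I. f i x) \<le> l2_norm M (f i) + l2_norm M (\<lambda>x. \<Sum>i\<in>I. f i x)"
    using insert.hyps insert.prems by (simp add: l2_norm_triangle)
  also have "l2_norm M (\<lambda>x. \<Sum>i\<in>I. f i x) \<le> (\<Sum>i\<in>I. l2_norm M (f i))"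
    using insert.prems by (intro insert.IH) auto
  finally show ?case using insert.hyps by simp
qed auto

lemma l2_inner_tendsto:
  assumes "\<And>n. w n \<in> l2_space M" "u \<in> l2_space M" "g \<in> l2_space M"
    and "(\<lambda>n. l2_norm M (\<lambda>x. w n x - u x)) \<longlonglongrightarrow> 0"
  shows "(\<lambda>n. l2_inner M (w n) g) \<longlonglongrightarrow> l2_inner M u g"
proof -
  have "(\<lambda>n. l2_norm M (\<lambda>x. w n x - u x) * l2_norm M g) \<longlonglongrightarrow> 0"
    using tendsto_mult_right[OF assms(4), of "l2_norm M g"] by simp
  moreover have "\<bar>l2_inner M (w n) g - l2_inner M u g\<bar> \<le> l2_norm M (\<lambda>x. w n x - u x) * l2_norm M g" for n
    using l2_cauchy_schwarz[of "\<lambda>x. w n x - u x" M g] assms(1-3) by simp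
  ultimately have "(\<lambda>n. l2_inner M (w n) g - l2_inner M u g) \<longlonglongrightarrow> 0"
    by (metis (no_types, lifting) Lim_null_comparison always_eventually real_norm_def)
  thus ?thesis by (rule LIM_zero_cancel)
qed

lemma l2_inner_tendsto_both:
  assumes "\<And>n. w n \<in> l2_space M" "u \<in> l2_space M" "\<And>n. v n \<in> l2_space M" "z \<in> l2_space M"
    and w: "(\<lambda>n. l2_norm M (\<lambda>x. w n x - u x)) \<longlonglongrightarrow> 0"
    and v: "(\<lambda>n. l2_norm M (\<lambda>x. v n x - z x)) \<longlonglongrightarrow> 0"
  shows "(\<lambda>n. l2_inner M (w n) (v n)) \<longlonglongrightarrow> l2_inner M u z"
proof -
  have 1: "(\<lambda>n. l2_inner M (w n) z) \<longlonglongrightarrow> l2_inner M u z"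
    by (rule l2_inner_tendsto) (use assms in auto)
  have 2: "(\<lambda>n. l2_inner M (v n) u) \<longlonglongrightarrow> l2_inner M z u"
    by (rule l2_inner_tendsto) (use assms in auto)
  have eq: "l2_inner M (w n) (v n) = l2_inner M (\<lambda>x. w n x - u x) (\<lambda>x. v n x - z x)
     + (l2_inner M (w n) z + l2_inner M (v n) u - l2_inner M z u)" for n
    using assms(1-4) by (simp add: l2_inner_commute[of M "v n" u] l2_inner_commute[of M z u])
  have "(\<lambda>n. l2_inner M (\<lambda>x. w n x - u x) (\<lambda>x. v n x - z x)) \<longlonglongrightarrow> 0"
  proof (rule Lim_null_comparison)
    show "\<forall>\<^sub>F n in sequentially. norm (l2_inner M (\<lambda>x. w n x - u x) (\<lambda>x. v n x - z x))
        \<le> l2_norm M (\<lambda>x. w n x - u x) * l2_norm M (\<lambda>x. v n x - z x)"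
      unfolding real_norm_def by (intro always_eventually allI l2_cauchy_schwarz l2_space_diff assms(1-4))
    show "(\<lambda>n. l2_norm M (\<lambda>x. w n x - u x) * l2_norm M (\<lambda>x. v n x - z x)) \<longlonglongrightarrow> 0"
      using tendsto_mult[OF w v] by simp
  qed
  from tendsto_add[OF this tendsto_diff[OF tendsto_add[OF 1 2] tendsto_const[of "l2_inner M z u"]]]
  have "(\<lambda>n. l2_inner M (w n) (v n)) \<longlonglongrightarrow> 0 + (l2_inner M u z + l2_inner M z u - l2_inner M z u)"
    by (simp only: eq)
  thus ?thesis by simp
qed

lemma l2_norm_tendsto:
  assumes "\<And>n. w n \<in> l2_space M" "u \<in> l2_space M"
    and w: "(\<lambda>n. l2_norm M (\<lambda>x. w n x - u x)) \<longlonglongrightarrow> 0"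
  shows "(\<lambda>n. l2_norm M (w n)) \<longlonglongrightarrow> l2_norm M u"
  using tendsto_real_sqrt[OF l2_inner_tendsto_both[OF assms(1,2) assms(1,2) w w]]
  by (simp only: l2_norm_def)

lemma l2_nn_integral_square:
  assumes "h \<in> l2_space M"
  shows "(\<integral>\<^sup>+x. ennreal ((h x)\<^sup>2) \<partial>M) = ennreal ((l2_norm M h)\<^sup>2)"
  using assms by (subst nn_integral_eq_integral)
    (auto simp: l2_space_integrable_square l2_norm_square, simp add: l2_inner_def power2_eq_square)

lemma l2_space_nn_integral_bound:
  assumes h: "h \<in> borel_measurable M" and le: "(\<integral>\<^sup>+x. ennreal ((h x)\<^sup>2) \<partial>M) \<le> ennreal (e\<^sup>2)" and "e \<ge> 0"
  shows "h \<in> l2_space M" "l2_norm M h \<le> e"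
proof -
  show *: "h \<in> l2_space M" unfolding l2_space_def
  proof (safe intro!: integrableI_nonneg)
    show "(\<integral>\<^sup>+x. ennreal ((h x)\<^sup>2) \<partial>M) < \<infinity>"
      using le by (rule le_less_trans) simp
  qed (use h in auto)
  have "(l2_norm M h)\<^sup>2 \<le> e\<^sup>2"
    using le unfolding l2_nn_integral_square[OF *] by simp
  thus "l2_norm M h \<le> e" using \<open>e \<ge> 0\<close> by (rule power2_le_imp_le)
qed

text \<open>Riesz--Fischer. A subsequence with geometrically decreasing steps converges almost everywhere, and
  Fatou's lemma turns its pointwise limit into an \<open>L\<^sup>2\<close> limit of the whole sequence.\<close>

theorem l2_complete:
  assumes f: "\<And>n. f n \<in> l2_space M"
    and cauchy: "\<And>\<epsilon>. \<epsilon> > 0 \<Longrightarrow> \<exists>N. \<forall>m\<ge>N. \<forall>n\<ge>N. l2_norm M (\<lambda>x. f m x - f n x) < \<epsilon>"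
  obtains u where "u \<in> l2_space M" "(\<lambda>n. l2_norm M (\<lambda>x. f n x - u x)) \<longlonglongrightarrow> 0"
proof -
  have fm [measurable]: "f n \<in> borel_measurable M" for n using f by measurable
  have "\<forall>k. \<exists>N. \<forall>m\<ge>N. \<forall>n\<ge>N. l2_norm M (\<lambda>x. f m x - f n x) < (1/4::real)^k"
    by (intro allI cauchy) simp
  then obtain N where N: "\<And>k m n. m \<ge> N k \<Longrightarrow> n \<ge> N k \<Longrightarrow> l2_norm M (\<lambda>x. f m x - f n x) < (1/4::real)^k"
    by metis
  define r where "r k = (\<Sum>i\<le>k. N i) + k" for k
  have rN: "N k \<le> r k" for k
    unfolding r_def by (intro trans_le_add1 member_le_sum) auto
  have r_mono: "r k \<le> r (Suc k)" for k by (simp add: r_def)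
  have r_ge: "k \<le> r k" for k by (simp add: r_def)
  define d where "d k x = f (r (Suc k)) x - f (r k) x" for k x
  have d: "d k \<in> l2_space M" for k unfolding d_def by (intro l2_space_diff f)
  have dm [measurable]: "d k \<in> borel_measurable M" for k using d by measurable
  have d_le: "l2_norm M (d k) \<le> (1/4)^k" for k
    using N[of k "r (Suc k)" "r k"] rN[of k] r_mono[of k] unfolding d_def by force
  \<comment> \<open>The squared norms of the steps are at most \<open>16\<^sup>-\<^sup>k\<close>, which leaves room for the weight \<open>4\<^sup>k\<close>; a finite weighted
    sum of squares bounds the pointwise steps by a multiple of \<open>2\<^sup>-\<^sup>k\<close>.\<close>
  have "(\<integral>\<^sup>+x. (\<Sum>k. ennreal (4^k * (d k x)\<^sup>2)) \<partial>M) = (\<Sum>k. \<integral>\<^sup>+x. ennreal (4^k * (d k x)\<^sup>2) \<partial>M)"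
    by (intro nn_integral_suminf) measurable
  also have "\<dots> = (\<Sum>k. ennreal (4^k * (l2_norm M (d k))\<^sup>2))"
    by (simp add: ennreal_mult' nn_integral_cmult l2_nn_integral_square[OF d])
  also have "\<dots> \<le> (\<Sum>k. ennreal ((1/4)^k))"
  proof (intro suminf_le ennreal_leI)
    fix k
    have "4^k * (l2_norm M (d k))\<^sup>2 \<le> 4^k * ((1/4)^k)\<^sup>2"
      by (intro mult_left_mono power_mono d_le) auto
    also have "\<dots> = (1/4)^k" by (simp add: power2_eq_square power_mult_distrib[symmetric])
    finally show "4^k * (l2_norm M (d k))\<^sup>2 \<le> (1/4)^k" .
  qed auto
  also have "\<dots> < \<infinity>"
    by (subst suminf_ennreal2) (auto intro!: summable_geometric)
  finally have fin: "(\<integral>\<^sup>+x. (\<Sum>k. ennreal (4^k * (d k x)\<^sup>2)) \<partial>M) \<noteq> \<infinity>"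
    by (rule less_imp_neq)
  have "AE x in M. (\<Sum>k. ennreal (4^k * (d k x)\<^sup>2)) \<noteq> \<infinity>"
    by (rule nn_integral_noteq_infinite[OF borel_measurable_suminf_order fin]) auto
  hence conv: "AE x in M. convergent (\<lambda>k. f (r k) x)"
  proof eventually_elim
    case (elim x)
    define S where "S = (\<Sum>k. ennreal (4^k * (d k x)\<^sup>2))"
    from elim have "S \<noteq> \<infinity>" unfolding S_def .
    then obtain C where C: "C \<ge> 0" "S = ennreal C"
      by (cases S) auto
    have dk: "\<bar>d k x\<bar> \<le> sqrt C * (1/2)^k" for k
    proof -
      have "sum (\<lambda>k. ennreal (4^k * (d k x)\<^sup>2)) {k} \<le> S"
        unfolding S_def by (rule sum_le_suminf) auto
      hence "ennreal (4^k * (d k x)\<^sup>2) \<le> ennreal C" by (simp only: C(2) sum.insert finite.emptyI empty_iff sum.empty add_0_right) simp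
      hence "4^k * (d k x)\<^sup>2 \<le> C" using C(1) by (simp only: ennreal_le_iff)
      hence "sqrt (4^k * (d k x)\<^sup>2) \<le> sqrt C" by simp
      moreover have "sqrt (4^k * (d k x)\<^sup>2) = 2^k * \<bar>d k x\<bar>"
      proof -
        have "4^k * (d k x)\<^sup>2 = (2^k * \<bar>d k x\<bar>)\<^sup>2"
          by (simp add: power_mult_distrib flip: power_mult) (simp add: mult.commute[of k] power_mult)
        thus ?thesis by simp
      qed
      ultimately show ?thesis by (simp add: field_simps)
    qed
    have "summable (\<lambda>k. sqrt C * (1/2)^k)" by (intro summable_mult summable_geometric) simp
    hence "summable (\<lambda>k. d k x)"
      by (rule summable_comparison_test'[where N=0]) (simp add: dk)
    hence "convergent (\<lambda>n. \<Sum>k<n. d k x)" by (simp add: summable_iff_convergent)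
    hence "convergent (\<lambda>n. f (r 0) x + (\<Sum>k<n. d k x))" by (simp add: convergent_const convergent_add)
    moreover have "f (r 0) x + (\<Sum>k<n. d k x) = f (r n) x" for n
      unfolding d_def by (subst sum_lessThan_telescope) simp
    ultimately show ?case by simp
  qed
  define u where "u x = lim (\<lambda>k. f (r k) x)" for x
  have um [measurable]: "u \<in> borel_measurable M"
    unfolding u_def by measurable
  have close: "(\<lambda>x. f n x - u x) \<in> l2_space M \<and> l2_norm M (\<lambda>x. f n x - u x) \<le> e"
    if e: "e > 0" and n: "\<And>m. m \<ge> n \<Longrightarrow> l2_norm M (\<lambda>x. f m x - f n x) \<le> e" for e n
  proof -
    have "(\<integral>\<^sup>+x. ennreal ((f n x - u x)\<^sup>2) \<partial>M) = (\<integral>\<^sup>+x. liminf (\<lambda>j. ennreal ((f (r j) x - f n x)\<^sup>2)) \<partial>M)"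
    proof (intro nn_integral_cong_AE, use conv in eventually_elim)
      case (elim x)
      hence "(\<lambda>j. f (r j) x) \<longlonglongrightarrow> u x" unfolding u_def by (rule convergent_LIMSEQ_iff[THEN iffD1])
      hence "(\<lambda>j. ennreal ((f (r j) x - f n x)\<^sup>2)) \<longlonglongrightarrow> ennreal ((u x - f n x)\<^sup>2)"
        by (intro tendsto_intros)
      from lim_imp_Liminf[OF _ this] show ?case by (simp add: power2_commute)
    qed
    also have "\<dots> \<le> liminf (\<lambda>j. \<integral>\<^sup>+x. ennreal ((f (r j) x - f n x)\<^sup>2) \<partial>M)"
      by (rule nn_integral_liminf) measurable
    also have "\<dots> \<le> liminf (\<lambda>j. ennreal (e\<^sup>2))"
    proof (rule Liminf_mono)
      show "\<forall>\<^sub>F j in sequentially. (\<integral>\<^sup>+x. ennreal ((f (r j) x - f n x)\<^sup>2) \<partial>M) \<le> ennreal (e\<^sup>2)"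
      proof (rule eventually_sequentiallyI[of n])
        fix j assume "n \<le> j"
        hence "l2_norm M (\<lambda>x. f (r j) x - f n x) \<le> e" using r_ge[of j] by (intro n) simp
        thus "(\<integral>\<^sup>+x. ennreal ((f (r j) x - f n x)\<^sup>2) \<partial>M) \<le> ennreal (e\<^sup>2)"
          by (subst l2_nn_integral_square) (auto simp: f intro!: ennreal_leI power_mono)
      qed
    qed
    also have "\<dots> = ennreal (e\<^sup>2)" by (rule Liminf_const) simp
    finally show ?thesis using l2_space_nn_integral_bound[of "\<lambda>x. f n x - u x" M e] e by auto
  qed
  have ev: "\<exists>N. \<forall>n\<ge>N. (\<lambda>x. f n x - u x) \<in> l2_space M \<and> l2_norm M (\<lambda>x. f n x - u x) \<le> e" if "e > 0" for e
    using cauchy[OF that] close[OF that] by (meson less_imp_le order_trans)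
  obtain n0 where "(\<lambda>x. f n0 x - u x) \<in> l2_space M" using ev[of 1] by auto
  from l2_space_diff[OF f this, of n0] have u: "u \<in> l2_space M" by simp
  have "(\<lambda>n. l2_norm M (\<lambda>x. f n x - u x)) \<longlonglongrightarrow> 0"
  proof (rule LIMSEQ_I)
    fix e :: real assume "e > 0"
    with ev[of "e/2"] obtain N where "\<forall>n\<ge>N. l2_norm M (\<lambda>x. f n x - u x) \<le> e/2" by auto
    thus "\<exists>N. \<forall>n\<ge>N. norm (l2_norm M (\<lambda>x. f n x - u x) - 0) < e" using \<open>e > 0\<close>
      by (intro exI[of _ N]) force
  qed
  with u show ?thesis by (rule that)
qed

section \<open>Finite-dimensional subspaces\<close>

text \<open>Elimination of one unknown and one equation at a time. The lemma gives the invariance of dimension,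
  and it produces vectors of a large space that finitely many linear functionals annihilate.\<close>

lemma homogeneous_system_nontrivial:
  fixes a :: "'j \<Rightarrow> 'i \<Rightarrow> real"
  assumes "finite I" "finite J" "card I < card J"
  shows "\<exists>c. (\<exists>j\<in>J. c j \<noteq> 0) \<and> (\<forall>i\<in>I. (\<Sum>j\<in>J. c j * a j i) = 0)"
  using assms
proof (induction I arbitrary: J a rule: finite_induct)
  case empty
  then obtain j where "j \<in> J" by fastforce
  thus ?case by (intro exI[of _ "\<lambda>_. 1"]) auto
next
  case (insert i I)
  show ?case
  proof (cases "\<forall>j\<in>J. a j i = 0")
    case True
    have "card I < card J" using insert by simp
    then obtain c where c: "\<exists>j\<in>J. c j \<noteq> 0" "\<forall>k\<in>I. (\<Sum>j\<in>J. c j * a j k) = 0"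
      using insert.IH[OF \<open>finite J\<close>, of a] by blast
    have "(\<Sum>j\<in>J. c j * a j i) = 0" using True by simp
    with c show ?thesis by blast
  next
    case False
    then obtain j0 where j0: "j0 \<in> J" "a j0 i \<noteq> 0" by blast
    define J' where "J' = J - {j0}"
    have J': "finite J'" "card I < card J'" "J = insert j0 J'" "j0 \<notin> J'"
      using insert j0 by (auto simp: J'_def)
    obtain c where c: "\<exists>j\<in>J'. c j \<noteq> 0"
        "\<forall>k\<in>I. (\<Sum>j\<in>J'. c j * (a j k - a j i / a j0 i * a j0 k)) = 0"
      using insert.IH[OF J'(1,2), of "\<lambda>j k. a j k - a j i / a j0 i * a j0 k"] by blast
    define t where "t = - (\<Sum>j\<in>J'. c j * a j i) / a j0 i"
    have sum: "(\<Sum>j\<in>J. (c(j0 := t)) j * a j k) = t * a j0 k + (\<Sum>j\<in>J'. c j * a j k)" for k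
    proof -
      have "(\<Sum>j\<in>J. (c(j0 := t)) j * a j k) = t * a j0 k + (\<Sum>j\<in>J'. (c(j0 := t)) j * a j k)"
        using J' by simp
      also have "(\<Sum>j\<in>J'. (c(j0 := t)) j * a j k) = (\<Sum>j\<in>J'. c j * a j k)"
        using J'(4) by (intro sum.cong) auto
      finally show ?thesis .
    qed
    have "(\<Sum>j\<in>J. (c(j0 := t)) j * a j k) = 0" if "k \<in> insert i I" for k
    proof (cases "k = i")
      case True
      thus ?thesis unfolding sum using j0 by (simp add: t_def)
    next
      case False
      hence "(\<Sum>j\<in>J'. c j * (a j k - a j i / a j0 i * a j0 k)) = 0" using c(2) that by blast
      also have "(\<Sum>j\<in>J'. c j * (a j k - a j i / a j0 i * a j0 k))
          = (\<Sum>j\<in>J'. c j * a j k) - (\<Sum>j\<in>J'. c j * a j i * (a j0 k / a j0 i))"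
        by (simp add: right_diff_distrib sum_subtractf mult.commute mult.left_commute)
      also have "(\<Sum>j\<in>J'. c j * a j i * (a j0 k / a j0 i)) = - t * a j0 k"
        unfolding sum_distrib_right[symmetric] by (simp add: t_def)
      finally show ?thesis unfolding sum by simp
    qed
    moreover have "\<exists>j\<in>J. (c(j0 := t)) j \<noteq> 0" using c(1) J' by auto
    ultimately show ?thesis by blast
  qed
qed

definition l2_subspace :: "'m measure \<Rightarrow> ('m \<Rightarrow> real) set \<Rightarrow> bool" where
  "l2_subspace M V \<longleftrightarrow> V \<subseteq> l2_space M \<and> (\<lambda>_. 0) \<in> V \<and>
     (\<forall>f\<in>V. \<forall>h\<in>V. \<forall>a b. (\<lambda>x. a * f x + b * h x) \<in> V)"

lemma l2_subspaceD:
  assumes "l2_subspace M V"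
  shows "f \<in> V \<Longrightarrow> f \<in> l2_space M" "(\<lambda>_. 0) \<in> V"
    "f \<in> V \<Longrightarrow> h \<in> V \<Longrightarrow> (\<lambda>x. a * f x + b * h x) \<in> V"
    "f \<in> V \<Longrightarrow> h \<in> V \<Longrightarrow> (\<lambda>x. f x + h x) \<in> V"
    "f \<in> V \<Longrightarrow> h \<in> V \<Longrightarrow> (\<lambda>x. f x - h x) \<in> V"
    "f \<in> V \<Longrightarrow> (\<lambda>x. a * f x) \<in> V"
proof -
  show *: "f \<in> V \<Longrightarrow> h \<in> V \<Longrightarrow> (\<lambda>x. a * f x + b * h x) \<in> V" for f h a b
    using assms by (simp add: l2_subspace_def)
  show "f \<in> V \<Longrightarrow> f \<in> l2_space M" "(\<lambda>_. 0) \<in> V" using assms by (auto simp: l2_subspace_def)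
  show "f \<in> V \<Longrightarrow> h \<in> V \<Longrightarrow> (\<lambda>x. f x + h x) \<in> V" using *[of f h 1 1] by simp
  show "f \<in> V \<Longrightarrow> h \<in> V \<Longrightarrow> (\<lambda>x. f x - h x) \<in> V" using *[of f h 1 "-1"] by simp
  show "f \<in> V \<Longrightarrow> (\<lambda>x. a * f x) \<in> V" using *[of f f a 0] by simp
qed

lemma l2_subspace_sum:
  assumes V: "l2_subspace M V" and "\<And>i. i \<in> I \<Longrightarrow> f i \<in> V"
  shows "(\<lambda>x. \<Sum>i\<in>I. f i x) \<in> V"
  using assms(2)
proof (induction I rule: infinite_finite_induct)
  case (insert i I)
  thus ?case using l2_subspaceD(4)[OF V] by simp
qed (use l2_subspaceD(2)[OF V] in auto)

definition l2_orthonormal_in :: "'m measure \<Rightarrow> ('m \<Rightarrow> real) set \<Rightarrow> nat \<Rightarrow> (nat \<Rightarrow> 'm \<Rightarrow> real) \<Rightarrow> bool" where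
  "l2_orthonormal_in M V n e \<longleftrightarrow> (\<forall>l\<in>{1..n}. e l \<in> V) \<and>
     (\<forall>k\<in>{1..n}. \<forall>l\<in>{1..n}. l2_inner M (e k) (e l) = (if k = l then 1 else 0))"

lemma l2_orthonormal_inner:
  assumes V: "l2_subspace M V" and e: "l2_orthonormal_in M V n e" and k: "k \<in> {1..n}"
  shows "l2_inner M (\<lambda>x. \<Sum>l=1..n. a l * e l x) (e k) = a k"
proof -
  have el: "e l \<in> l2_space M" if "l \<in> {1..n}" for l
    using l2_subspaceD(1)[OF V] e that by (auto simp: l2_orthonormal_in_def)
  have "l2_inner M (\<lambda>x. \<Sum>l=1..n. a l * e l x) (e k) = (\<Sum>l=1..n. a l * l2_inner M (e l) (e k))"
    using el k by (subst l2_inner_sum_left) auto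
  also have "\<dots> = (\<Sum>l=1..n. if l = k then a l else 0)"
    using e k by (intro sum.cong) (auto simp: l2_orthonormal_in_def)
  finally show ?thesis using k by simp
qed

lemma l2_orthonormal_norm:
  assumes V: "l2_subspace M V" and e: "l2_orthonormal_in M V n e"
  shows "(l2_norm M (\<lambda>x. \<Sum>l=1..n. a l * e l x))\<^sup>2 = (\<Sum>l=1..n. (a l)\<^sup>2)"
proof -
  have el: "e l \<in> l2_space M" if "l \<in> {1..n}" for l
    using l2_subspaceD(1)[OF V] e that by (auto simp: l2_orthonormal_in_def)
  have "(l2_norm M (\<lambda>x. \<Sum>l=1..n. a l * e l x))\<^sup>2
      = (\<Sum>k=1..n. l2_inner M (\<lambda>x. \<Sum>l=1..n. a l * e l x) (\<lambda>x. a k * e k x))"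
    unfolding l2_norm_square using el by (intro l2_inner_sum_right l2_space_sum l2_space_scale) auto
  also have "\<dots> = (\<Sum>k=1..n. a k * a k)"
    by (intro sum.cong) (simp_all add: l2_orthonormal_inner[OF V e] del: One_nat_def)
  finally show ?thesis by (simp add: power2_eq_square)
qed

lemma l2_orthonormal_independent:
  assumes V: "l2_subspace M V" and e: "l2_orthonormal_in M V n e"
    and "AE x in M. (\<Sum>l=1..n. a l * e l x) = 0" and k: "k \<in> {1..n}"
  shows "a k = 0"
proof -
  have "(\<lambda>x. \<Sum>l=1..n. a l * e l x) \<in> l2_space M"
    using l2_subspaceD(1)[OF V] e by (intro l2_space_sum l2_space_scale) (auto simp: l2_orthonormal_in_def)
  hence "l2_norm M (\<lambda>x. \<Sum>l=1..n. a l * e l x) = 0"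
    using assms(3) by (simp add: l2_norm_eq_0_iff)
  hence "(\<Sum>l=1..n. (a l)\<^sup>2) = 0" using l2_orthonormal_norm[OF V e, of a] by simp
  thus ?thesis using k by (subst (asm) sum_nonneg_eq_0_iff) auto
qed

lemma l2_inner_normalized:
  assumes "l2_norm M r \<noteq> 0"
  shows "l2_inner M (\<lambda>x. inverse (l2_norm M r) * r x) (\<lambda>x. inverse (l2_norm M r) * r x) = 1"
proof -
  have "inverse n * (inverse n * n\<^sup>2) = 1" if "n \<noteq> 0" for n :: real
    using that by (simp add: field_simps power2_eq_square)
  thus ?thesis using assms by (simp flip: l2_norm_square)
qed

text \<open>A Gram--Schmidt step: an orthonormal system is independent, so if it is no basis, then some element
  of \<open>V\<close> has a nonzero remainder after subtraction of its expansion.\<close>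

lemma l2_orthonormal_extend:
  assumes V: "l2_subspace M V" and e: "l2_orthonormal_in M V n e"
    and nb: "\<not> l2_basis M V n e"
  obtains z where "l2_orthonormal_in M V (Suc n) (e(Suc n := z))"
proof -
  have eV: "e l \<in> V" if "l \<in> {1..n}" for l using e that by (auto simp: l2_orthonormal_in_def)
  have VL: "f \<in> V \<Longrightarrow> f \<in> l2_space M" for f using l2_subspaceD(1)[OF V] .
  obtain u where u: "u \<in> V" "\<And>a. \<not> (AE x in M. u x = (\<Sum>l=1..n. a l * e l x))"
    using nb eV l2_orthonormal_independent[OF V e] unfolding l2_basis_def by blast
  define p where "p x = (\<Sum>l=1..n. l2_inner M u (e l) * e l x)" for x
  have p: "p \<in> V" unfolding p_def by (intro l2_subspace_sum[OF V] l2_subspaceD(6)[OF V] eV)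
  define r where "r x = u x - p x" for x
  have r: "r \<in> V" unfolding r_def by (intro l2_subspaceD(5)[OF V] u p)
  have orth: "l2_inner M r (e k) = 0" if "k \<in> {1..n}" for k
  proof -
    have "l2_inner M p (e k) = l2_inner M u (e k)"
      unfolding p_def by (rule l2_orthonormal_inner[OF V e that])
    thus ?thesis using u p eV[OF that] VL unfolding r_def by simp
  qed
  have "l2_norm M r \<noteq> 0"
    using u(2)[of "\<lambda>l. l2_inner M u (e l)"] l2_norm_eq_0_iff[OF VL[OF r]]
    by (auto simp: r_def p_def)
  define z where "z = (\<lambda>x. inverse (l2_norm M r) * r x)"
  have z: "z \<in> V" unfolding z_def by (intro l2_subspaceD(6)[OF V] r)
  have "l2_inner M z z = 1"
    unfolding z_def using \<open>l2_norm M r \<noteq> 0\<close> by (rule l2_inner_normalized)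
  moreover have zo: "l2_inner M z (e k) = 0" if "k \<in> {1..n}" for k
    unfolding z_def using orth[OF that] by simp
  moreover have zo': "l2_inner M (e k) z = 0" if "k \<in> {1..n}" for k
    using zo[OF that] by (simp add: l2_inner_commute[of M "e k"])
  ultimately have "l2_orthonormal_in M V (Suc n) (e(Suc n := z))"
    using e z zo zo' unfolding l2_orthonormal_in_def by (auto simp: le_Suc_eq)
  thus ?thesis by (rule that)
qed

text \<open>Finite dimension is expressed by a bound on the length of orthonormal systems, since this is what
  compactness gives for an eigenspace; bases are then obtained from maximal systems.\<close>

definition l2_finite_dim :: "'m measure \<Rightarrow> ('m \<Rightarrow> real) set \<Rightarrow> bool" where
  "l2_finite_dim M V \<longleftrightarrow> l2_subspace M V \<and> (\<exists>K. \<forall>n e. l2_orthonormal_in M V n e \<longrightarrow> n \<le> K)"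

lemma l2_basis_card_le:
  assumes b: "l2_basis M V n b" and b': "l2_basis M V n' b'"
  shows "n' \<le> n"
proof (rule ccontr)
  assume "\<not> n' \<le> n"
  have "\<forall>j\<in>{1..n'}. \<exists>a. AE x in M. b' j x = (\<Sum>l=1..n. a l * b l x)"
    using b b' unfolding l2_basis_def by blast
  then obtain A where A: "\<And>j. j \<in> {1..n'} \<Longrightarrow> AE x in M. b' j x = (\<Sum>l=1..n. A j l * b l x)"
    by metis
  obtain c where c: "\<exists>j\<in>{1..n'}. c j \<noteq> 0" "\<forall>l\<in>{1..n}. (\<Sum>j=1..n'. c j * A j l) = 0"
    using homogeneous_system_nontrivial[of "{1..n}" "{1..n'}" A] \<open>\<not> n' \<le> n\<close> by auto
  have "AE x in M. \<forall>j\<in>{1..n'}. b' j x = (\<Sum>l=1..n. A j l * b l x)"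
    using A by (intro AE_finite_allI) auto
  hence "AE x in M. (\<Sum>j=1..n'. c j * b' j x) = 0"
  proof eventually_elim
    case (elim x)
    hence "(\<Sum>j=1..n'. c j * b' j x) = (\<Sum>j=1..n'. \<Sum>l=1..n. c j * A j l * b l x)"
      by (intro sum.cong) (auto simp: sum_distrib_left mult.assoc)
    also have "\<dots> = (\<Sum>l=1..n. (\<Sum>j=1..n'. c j * A j l) * b l x)"
      by (subst sum.swap) (simp add: sum_distrib_right)
    also have "\<dots> = 0" using c(2) by (intro sum.neutral) auto
    finally show ?case .
  qed
  thus False using b' c(1) unfolding l2_basis_def by blast
qed

lemma l2_dim_eq:
  assumes "l2_basis M V n b" shows "l2_dim M V = n"
  unfolding l2_dim_def using assms l2_basis_card_le[OF assms] l2_basis_card_le[OF _ assms]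
  by (intro the_equality) (auto intro: antisym)

lemma l2_orthonormal_basis_extend:
  assumes V: "l2_finite_dim M V" and e: "l2_orthonormal_in M V n e"
  obtains b where "l2_orthonormal_basis M V (l2_dim M V) b" "\<And>l. l \<in> {1..n} \<Longrightarrow> b l = e l" "n \<le> l2_dim M V"
proof -
  obtain K where K: "\<And>n e. l2_orthonormal_in M V n e \<Longrightarrow> n \<le> K" and sub: "l2_subspace M V"
    using V unfolding l2_finite_dim_def by blast
  have "\<exists>n' b. n \<le> n' \<and> l2_orthonormal_in M V n' b \<and> l2_basis M V n' b \<and> (\<forall>l\<in>{1..n}. b l = e l)"
    using e
  proof (induction "K - n" arbitrary: n e rule: less_induct)
    case less
    show ?case
    proof (cases "l2_basis M V n e")
      case True
      thus ?thesis using less.prems by blast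
    next
      case False
      then obtain z where z: "l2_orthonormal_in M V (Suc n) (e(Suc n := z))"
        using l2_orthonormal_extend[OF sub less.prems] by blast
      have "K - Suc n < K - n" using K[OF z] by simp
      from less.hyps[OF this z] obtain n' b where *: "Suc n \<le> n'" "l2_orthonormal_in M V n' b"
         "l2_basis M V n' b" "\<forall>l\<in>{1..Suc n}. b l = (e(Suc n := z)) l" by blast
      have "\<forall>l\<in>{1..n}. b l = e l" using *(4) by simp
      thus ?thesis using * by (intro exI[of _ n'] exI[of _ b]) simp
    qed
  qed
  then obtain n' b where *: "n \<le> n'" "l2_orthonormal_in M V n' b" "l2_basis M V n' b" "\<forall>l\<in>{1..n}. b l = e l"
    by blast
  moreover have "l2_dim M V = n'" using *(3) by (rule l2_dim_eq)
  ultimately show ?thesis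
    by (intro that[of b]) (auto simp: l2_orthonormal_basis_def l2_orthonormal_in_def)
qed

lemma l2_orthonormal_basis_exists:
  assumes "l2_finite_dim M V"
  obtains b where "l2_orthonormal_basis M V (l2_dim M V) b"
  using l2_orthonormal_basis_extend[OF assms, of 0 "\<lambda>_ _. 0"] by (auto simp: l2_orthonormal_in_def)

lemma l2_orthonormal_basis_imp_in:
  "l2_orthonormal_basis M V n b \<Longrightarrow> l2_orthonormal_in M V n b"
  by (auto simp: l2_orthonormal_basis_def l2_orthonormal_in_def l2_basis_def)

lemma l2_basis_sum_orthogonal:
  assumes V: "l2_subspace M V" and b: "l2_orthonormal_basis M V n b" and f: "f \<in> l2_space M" and u: "u \<in> V"
  shows "l2_inner M (\<lambda>x. f x - (\<Sum>l=1..n. l2_inner M f (b l) * b l x)) u = 0"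
proof -
  note bo = l2_orthonormal_basis_imp_in[OF b]
  have bV: "b l \<in> V" if "l \<in> {1..n}" for l using bo that by (auto simp: l2_orthonormal_in_def)
  note VL = l2_subspaceD(1)[OF V]
  define p where "p x = (\<Sum>l=1..n. l2_inner M f (b l) * b l x)" for x
  have p: "p \<in> V" unfolding p_def by (intro l2_subspace_sum[OF V] l2_subspaceD(6)[OF V] bV)
  have pk: "l2_inner M (\<lambda>x. f x - p x) (b k) = 0" if "k \<in> {1..n}" for k
  proof -
    have "l2_inner M p (b k) = l2_inner M f (b k)"
      unfolding p_def by (rule l2_orthonormal_inner[OF V bo that])
    thus ?thesis using f VL[OF p] VL[OF bV[OF that]] by simp
  qed
  obtain a where a: "AE x in M. u x = (\<Sum>l=1..n. a l * b l x)"
    using b u by (auto simp: l2_orthonormal_basis_def l2_basis_def)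
  have sumL: "(\<lambda>x. \<Sum>l=1..n. a l * b l x) \<in> l2_space M"
    using bV VL by (intro l2_space_sum l2_space_scale) auto
  have fp: "(\<lambda>x. f x - p x) \<in> l2_space M" using f VL[OF p] by simp
  have "l2_inner M (\<lambda>x. f x - p x) u = l2_inner M (\<lambda>x. \<Sum>l=1..n. a l * b l x) (\<lambda>x. f x - p x)"
    unfolding l2_inner_commute[of M _ u]
    by (rule l2_inner_AE_cong) (use a fp sumL VL[OF u] in \<open>auto dest: l2_space_measurable\<close>)
  also have "\<dots> = (\<Sum>l=1..n. a l * l2_inner M (b l) (\<lambda>x. f x - p x))"
    using bV VL fp by (subst l2_inner_sum_left) (auto simp del: l2_inner_diff_right)
  also have "\<dots> = 0"
    using pk by (intro sum.neutral) (auto simp: l2_inner_commute[of M "b _"] simp del: l2_inner_diff_right l2_inner_diff_left)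
  finally show ?thesis unfolding p_def .
qed

text \<open>The projection is chosen among functions that agree almost everywhere. The expansion in an
  orthonormal basis is a candidate, so there is something to choose from.\<close>

lemma l2_proj:
  assumes V: "l2_finite_dim M V" and f: "f \<in> l2_space M"
  shows l2_proj_mem: "l2_proj M V f \<in> V"
    and l2_proj_orthogonal: "u \<in> V \<Longrightarrow> l2_inner M (\<lambda>x. f x - l2_proj M V f x) u = 0"
proof -
  have sub: "l2_subspace M V" using V by (simp add: l2_finite_dim_def)
  obtain b where b: "l2_orthonormal_basis M V (l2_dim M V) b" using l2_orthonormal_basis_exists[OF V] .
  define p where "p = (\<lambda>x. \<Sum>l=1..l2_dim M V. l2_inner M f (b l) * b l x)"
  have "p \<in> V" unfolding p_def using b
    by (intro l2_subspace_sum[OF sub] l2_subspaceD(6)[OF sub]) (auto simp: l2_orthonormal_basis_def l2_basis_def)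
  moreover have "\<forall>u\<in>V. l2_inner M (\<lambda>x. f x - p x) u = 0"
    unfolding p_def using l2_basis_sum_orthogonal[OF sub b f] by blast
  ultimately have "l2_proj M V f \<in> V \<and> (\<forall>u\<in>V. l2_inner M (\<lambda>x. f x - l2_proj M V f x) u = 0)"
    unfolding l2_proj_def by (intro someI_ex[where P="\<lambda>h. h \<in> V \<and> (\<forall>u\<in>V. l2_inner M (\<lambda>x. f x - h x) u = 0)"]) blast
  thus "l2_proj M V f \<in> V" "u \<in> V \<Longrightarrow> l2_inner M (\<lambda>x. f x - l2_proj M V f x) u = 0" by auto
qed

lemma l2_proj_unique:
  assumes V: "l2_finite_dim M V" and f: "f \<in> l2_space M" and h: "h \<in> V"
    and orth: "\<And>u. u \<in> V \<Longrightarrow> l2_inner M (\<lambda>x. f x - h x) u = 0"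
  shows "l2_norm M (\<lambda>x. l2_proj M V f x - h x) = 0"
proof -
  have sub: "l2_subspace M V" using V by (simp add: l2_finite_dim_def)
  note VL = l2_subspaceD(1)[OF sub]
  let ?p = "l2_proj M V f"
  have p: "?p \<in> V" and po: "\<And>u. u \<in> V \<Longrightarrow> l2_inner M (\<lambda>x. f x - ?p x) u = 0"
    using l2_proj[OF V f] by auto
  have d: "(\<lambda>x. ?p x - h x) \<in> V" using l2_subspaceD(5)[OF sub p h] .
  have "l2_inner M (\<lambda>x. ?p x - h x) (\<lambda>x. ?p x - h x) = 0"
    using po[OF d] orth[OF d] f VL[OF p] VL[OF h] by simp
  thus ?thesis by (simp add: l2_norm_def)
qed

lemma l2_norm_eq_of_diff_zero:
  assumes "f \<in> l2_space M" "g \<in> l2_space M" "l2_norm M (\<lambda>x. f x - g x) = 0"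
  shows "l2_norm M f = l2_norm M g"
  using l2_norm_le_add_diff[OF assms(1,2)] l2_norm_le_add_diff[OF assms(2,1)] assms(3)
    l2_norm_minus_commute[of M f g] by simp

lemma l2_norm_proj:
  assumes V: "l2_finite_dim M V" and b: "l2_orthonormal_basis M V n b" and f: "f \<in> l2_space M"
  shows "(l2_norm M (l2_proj M V f))\<^sup>2 = (\<Sum>l=1..n. (l2_inner M f (b l))\<^sup>2)"
proof -
  have sub: "l2_subspace M V" using V by (simp add: l2_finite_dim_def)
  define p where "p = (\<lambda>x. \<Sum>l=1..n. l2_inner M f (b l) * b l x)"
  have p: "p \<in> V" unfolding p_def using b
    by (intro l2_subspace_sum[OF sub] l2_subspaceD(6)[OF sub]) (auto simp: l2_orthonormal_basis_def l2_basis_def)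
  have "l2_norm M (\<lambda>x. l2_proj M V f x - p x) = 0"
    using l2_basis_sum_orthogonal[OF sub b f] unfolding p_def[symmetric]
    by (intro l2_proj_unique[OF V f p]) (simp add: p_def)
  hence "l2_norm M (l2_proj M V f) = l2_norm M p"
    using l2_subspaceD(1)[OF sub] p l2_proj_mem[OF V f] by (intro l2_norm_eq_of_diff_zero) auto
  thus ?thesis unfolding p_def
    by (simp add: l2_orthonormal_norm[OF sub l2_orthonormal_basis_imp_in[OF b]] del: One_nat_def)
qed

text \<open>The Euclidean norm of a vector of coefficients is at most its \<open>\<ell>\<^sup>1\<close> norm. For this reason no
  eigenbasis can give less than the spectral norm.\<close>

lemma l2_norm_proj_le_sum:
  assumes V: "l2_finite_dim M V" and b: "l2_orthonormal_basis M V n b" and f: "f \<in> l2_space M"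
  shows "l2_norm M (l2_proj M V f) \<le> (\<Sum>l=1..n. \<bar>l2_inner M f (b l)\<bar>)"
proof -
  have "l2_norm M (l2_proj M V f) = sqrt (\<Sum>l=1..n. (l2_inner M f (b l))\<^sup>2)"
    unfolding l2_norm_proj[OF assms, symmetric] by simp
  also have "\<dots> \<le> (\<Sum>l=1..n. \<bar>l2_inner M f (b l)\<bar>)"
    using L2_set_le_sum_abs[of "\<lambda>l. l2_inner M f (b l)" "{1..n}"] by (simp add: L2_set_def)
  finally show ?thesis .
qed

text \<open>Equality of the Euclidean and the \<open>\<ell>\<^sup>1\<close> norm holds when at most one coefficient is nonzero, hence
  for an orthonormal basis that starts with the normalised projection. If the projection vanishes, any
  basis will do.\<close>

lemma l2_norm_proj_eq_adapted_basis:
  assumes V: "l2_finite_dim M V" and f: "f \<in> l2_space M"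
  obtains b where "l2_orthonormal_basis M V (l2_dim M V) b"
    "l2_norm M (l2_proj M V f) = (\<Sum>l=1..l2_dim M V. \<bar>l2_inner M f (b l)\<bar>)"
proof -
  have sub: "l2_subspace M V" using V by (simp add: l2_finite_dim_def)
  note VL = l2_subspaceD(1)[OF sub]
  let ?p = "l2_proj M V f"
  have p: "?p \<in> V" and po: "\<And>u. u \<in> V \<Longrightarrow> l2_inner M (\<lambda>x. f x - ?p x) u = 0"
    using l2_proj[OF V f] by auto
  have fu: "l2_inner M f u = l2_inner M ?p u" if "u \<in> V" for u
    using po[OF that] f VL[OF p] VL[OF that] by simp
  show ?thesis
  proof (cases "l2_norm M ?p = 0")
    case True
    obtain b where b: "l2_orthonormal_basis M V (l2_dim M V) b"
      using l2_orthonormal_basis_exists[OF V] .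
    have "l2_inner M f (b l) = 0" if "l \<in> {1..l2_dim M V}" for l
    proof -
      have bV: "b l \<in> V" using b that by (auto simp: l2_orthonormal_basis_def l2_basis_def)
      show ?thesis using l2_cauchy_schwarz[OF VL[OF p] VL[OF bV]] True fu[OF bV] by simp
    qed
    thus ?thesis using True by (intro that[OF b]) simp
  next
    case False
    define e where "e = (\<lambda>x. inverse (l2_norm M ?p) * ?p x)"
    have e: "e \<in> V" unfolding e_def by (rule l2_subspaceD(6)[OF sub p])
    have pe: "l2_inner M ?p u = l2_norm M ?p * l2_inner M e u" for u
      unfolding e_def using False by simp
    have ee: "l2_inner M e e = 1"
      unfolding e_def using False by (rule l2_inner_normalized)
    have "l2_orthonormal_in M V 1 (\<lambda>_. e)" using e ee by (auto simp: l2_orthonormal_in_def)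
    then obtain b where b: "l2_orthonormal_basis M V (l2_dim M V) b" "\<And>l. l \<in> {1..1} \<Longrightarrow> b l = e" "1 \<le> l2_dim M V"
      using l2_orthonormal_basis_extend[OF V] by metis
    have "\<bar>l2_inner M f (b l)\<bar> = (if l = 1 then l2_norm M ?p else 0)" if l: "l \<in> {1..l2_dim M V}" for l
    proof -
      have bV: "b l \<in> V" using b l by (auto simp: l2_orthonormal_basis_def l2_basis_def)
      have "l2_inner M e (b l) = (if l = 1 then 1 else 0)"
        using b l by (force simp: l2_orthonormal_basis_def)
      thus ?thesis using fu[OF bV] pe by auto
    qed
    hence "(\<Sum>l=1..l2_dim M V. \<bar>l2_inner M f (b l)\<bar>) = (\<Sum>l=1..l2_dim M V. if l = 1 then l2_norm M ?p else 0)"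
      by (intro sum.cong) auto
    also have "\<dots> = l2_norm M ?p" using b(3) by (subst sum.delta) auto
    finally show ?thesis using that[OF b(1)] by simp
  qed
qed

section \<open>Calculus of functions of class \<open>C\<^sup>k\<close>\<close>

lemma Ck_on_cong:
  assumes "open S" "\<And>x. x \<in> S \<Longrightarrow> f x = g x"
  shows "Ck_on k S f \<longleftrightarrow> Ck_on k S g"
proof -
  have imp: "Ck_on k S g" if "Ck_on k S f" "\<And>x. x \<in> S \<Longrightarrow> f x = g x" for f g :: "'a \<Rightarrow> 'b"
    using that
  proof (induction k arbitrary: f g)
    case 0 thus ?case by (simp cong: continuous_on_cong)
  next
    case (Suc k)
    have d: "(g has_derivative frechet_derivative f (at x)) (at x)" if "x \<in> S" for x
    proof (rule has_derivative_transform_within_open)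
      show "(f has_derivative frechet_derivative f (at x)) (at x)"
        using Suc.prems that by (simp add: frechet_derivative_works)
    qed (use assms Suc.prems that in auto)
    hence eq: "frechet_derivative f (at x) = frechet_derivative g (at x)" if "x \<in> S" for x
      using that by (intro frechet_derivative_at)
    have "Ck_on k S (\<lambda>x. frechet_derivative g (at x) v)" for v
    proof (rule Suc.IH)
      show "Ck_on k S (\<lambda>x. frechet_derivative f (at x) v)" using Suc.prems(1) by simp
    qed (use eq in simp)
    with d show ?case by (auto simp: differentiable_def)
  qed
  show ?thesis using imp[of f g] imp[of g f] assms by auto
qed

text \<open>The closure properties below are proved by induction on \<open>k\<close> with this rule: a derivative formula is
  exhibited whose ingredients are of class \<open>C\<^sup>k\<close> by the induction hypothesis.\<close>

lemma Ck_on_SucI: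
  assumes "open S" "\<And>x. x \<in> S \<Longrightarrow> (f has_derivative f' x) (at x)" "\<And>v. Ck_on k S (\<lambda>x. f' x v)"
  shows "Ck_on (Suc k) S f"
proof -
  have "frechet_derivative f (at x) = f' x" if "x \<in> S" for x
    using frechet_derivative_at[OF assms(2)[OF that]] by simp
  hence "Ck_on k S (\<lambda>x. frechet_derivative f (at x) v)" for v
    using assms(3)[of v] by (subst Ck_on_cong[OF assms(1)]) auto
  thus ?thesis using assms(2) by (auto simp: differentiable_def)
qed

lemma Ck_on_Suc_derivative:
  assumes "Ck_on (Suc k) S f" "x \<in> S"
  shows "(f has_derivative frechet_derivative f (at x)) (at x)"
  using assms by (simp add: frechet_derivative_works)

lemma Ck_on_Suc_D: "Ck_on (Suc k) S f \<Longrightarrow> Ck_on k S (\<lambda>x. frechet_derivative f (at x) v)"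
  by simp

lemma Ck_on_lower: "Ck_on (Suc k) S f \<Longrightarrow> Ck_on k S f"
proof (induction k arbitrary: f)
  case 0
  thus ?case by (auto intro!: continuous_at_imp_continuous_on differentiable_imp_continuous_within)
next
  case (Suc k)
  thus ?case by (metis Ck_on.simps(2))
qed

lemma Ck_on_imp_continuous_on: "Ck_on k S f \<Longrightarrow> continuous_on S f"
  by (induction k) (auto dest: Ck_on_lower simp del: Ck_on.simps(2))

lemma Ck_on_Un: "open S \<Longrightarrow> open T \<Longrightarrow> Ck_on k S f \<Longrightarrow> Ck_on k T f \<Longrightarrow> Ck_on k (S \<union> T) f"
  by (induction k arbitrary: f) (auto intro: continuous_on_open_Un)

lemma Ck_on_const: "open S \<Longrightarrow> Ck_on k S (\<lambda>_. c)"
proof (induction k arbitrary: c)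
  case (Suc k)
  show ?case by (rule Ck_on_SucI[OF Suc.prems, of _ "\<lambda>_ _. 0"]) (use Suc in auto)
qed auto

lemma Ck_on_bounded_linear:
  assumes "open S" "bounded_linear L" "Ck_on k S f"
  shows "Ck_on k S (\<lambda>x. L (f x))"
  using assms(3)
proof (induction k arbitrary: f)
  case 0 thus ?case using bounded_linear.continuous_on[OF assms(2), of S f] by simp
next
  case (Suc k)
  show ?case
    by (rule Ck_on_SucI[OF assms(1) bounded_linear.has_derivative[OF assms(2) Ck_on_Suc_derivative[OF Suc.prems]]
        Suc.IH[OF Ck_on_Suc_D[OF Suc.prems]]])
qed

lemma Ck_on_add:
  assumes "open S" "Ck_on k S f" "Ck_on k S g"
  shows "Ck_on k S (\<lambda>x. f x + g x)"
  using assms(2,3)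
proof (induction k arbitrary: f g)
  case 0 thus ?case by (auto intro: continuous_on_add)
next
  case (Suc k)
  show ?case
    by (rule Ck_on_SucI[OF assms(1) has_derivative_add[OF Ck_on_Suc_derivative[OF Suc.prems(1)] Ck_on_Suc_derivative[OF Suc.prems(2)]]
        Suc.IH[OF Ck_on_Suc_D[OF Suc.prems(1)] Ck_on_Suc_D[OF Suc.prems(2)]]])
qed

lemma Ck_on_mult:
  fixes f g :: "_ \<Rightarrow> real"
  assumes "open S" "Ck_on k S f" "Ck_on k S g"
  shows "Ck_on k S (\<lambda>x. f x * g x)"
  using assms(2,3)
proof (induction k arbitrary: f g)
  case 0 thus ?case by (auto intro: continuous_on_mult)
next
  case (Suc k)
  show ?case
  proof (rule Ck_on_SucI[OF assms(1), where f'="\<lambda>x v. f x * frechet_derivative g (at x) v + frechet_derivative f (at x) v * g x"])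
    show "((\<lambda>x. f x * g x) has_derivative (\<lambda>v. f x * frechet_derivative g (at x) v + frechet_derivative f (at x) v * g x)) (at x)"
      if x: "x \<in> S" for x
      by (rule has_derivative_mult[OF Ck_on_Suc_derivative[OF Suc.prems(1) x] Ck_on_Suc_derivative[OF Suc.prems(2) x]])
    show "Ck_on k S (\<lambda>x. f x * frechet_derivative g (at x) v + frechet_derivative f (at x) v * g x)" for v
      by (intro Ck_on_add assms(1) Suc.IH Ck_on_Suc_D Suc.prems Ck_on_lower[OF Suc.prems(1)] Ck_on_lower[OF Suc.prems(2)])
  qed
qed

lemma Ck_on_cmult:
  fixes f :: "_ \<Rightarrow> real"
  shows "open S \<Longrightarrow> Ck_on k S f \<Longrightarrow> Ck_on k S (\<lambda>x. c * f x)"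
  by (intro Ck_on_mult Ck_on_const)

lemma Ck_on_sum:
  fixes f :: "_ \<Rightarrow> _ \<Rightarrow> real"
  assumes "open S" "\<And>i. i \<in> I \<Longrightarrow> Ck_on k S (f i)"
  shows "Ck_on k S (\<lambda>x. \<Sum>i\<in>I. f i x)"
  using assms(2) by (induction I rule: infinite_finite_induct) (auto intro: Ck_on_const Ck_on_add assms(1))

lemma Ck_on_prod:
  fixes f :: "_ \<Rightarrow> _ \<Rightarrow> real"
  assumes "open S" "\<And>i. i \<in> I \<Longrightarrow> Ck_on k S (f i)"
  shows "Ck_on k S (\<lambda>x. \<Prod>i\<in>I. f i x)"
  using assms(2) by (induction I rule: infinite_finite_induct) (auto intro: Ck_on_const Ck_on_mult assms(1))

lemma Ck_on_inverse:
  fixes f :: "_ \<Rightarrow> real"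
  assumes "open S" "\<And>x. x \<in> S \<Longrightarrow> f x \<noteq> 0" "Ck_on k S f"
  shows "Ck_on k S (\<lambda>x. inverse (f x))"
  using assms(3)
proof (induction k)
  case 0 thus ?case using assms(2) by (auto intro: continuous_on_inverse)
next
  case (Suc k)
  show ?case
  proof (rule Ck_on_SucI[OF assms(1), where f'="\<lambda>x v. (-1) * (inverse (f x) * frechet_derivative f (at x) v * inverse (f x))"])
    show "((\<lambda>x. inverse (f x)) has_derivative (\<lambda>v. (-1) * (inverse (f x) * frechet_derivative f (at x) v * inverse (f x)))) (at x)"
      if "x \<in> S" for x
      using Deriv.has_derivative_inverse[OF assms(2)[OF that] Ck_on_Suc_derivative[OF Suc.prems that]] by simp
    show "Ck_on k S (\<lambda>x. (-1) * (inverse (f x) * frechet_derivative f (at x) v * inverse (f x)))" for v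
      by (intro Ck_on_cmult Ck_on_mult assms(1) Suc.IH Ck_on_Suc_D Suc.prems Ck_on_lower[OF Suc.prems])
  qed
qed

lemma Ck_on_sqrt:
  fixes f :: "_ \<Rightarrow> real"
  assumes "open S" "\<And>x. x \<in> S \<Longrightarrow> f x > 0" "Ck_on k S f"
  shows "Ck_on k S (\<lambda>x. sqrt (f x))"
  using assms(3)
proof (induction k)
  case 0 thus ?case by (auto intro: continuous_on_real_sqrt)
next
  case (Suc k)
  show ?case
  proof (rule Ck_on_SucI[OF assms(1), where f'="\<lambda>x v. (1/2) * (frechet_derivative f (at x) v * inverse (sqrt (f x)))"])
    show "((\<lambda>x. sqrt (f x)) has_derivative (\<lambda>v. (1/2) * (frechet_derivative f (at x) v * inverse (sqrt (f x))))) (at x)"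
      if x: "x \<in> S" for x
    proof -
      have "(sqrt has_field_derivative inverse (sqrt (f x)) / 2) (at (f x))"
        by (rule DERIV_real_sqrt[OF assms(2)[OF x]])
      from has_derivative_compose[OF Ck_on_Suc_derivative[OF Suc.prems x] this[unfolded has_field_derivative_def]]
      show ?thesis by (simp add: mult_ac)
    qed
    have "sqrt (f x) \<noteq> 0" if "x \<in> S" for x using assms(2)[OF that] by simp
    thus "Ck_on k S (\<lambda>x. (1/2) * (frechet_derivative f (at x) v * inverse (sqrt (f x))))" for v
      by (intro Ck_on_cmult Ck_on_mult assms(1) Ck_on_inverse Suc.IH Ck_on_Suc_D Suc.prems Ck_on_lower[OF Suc.prems])
  qed
qed

lemma Ck_on_vec_nth: "open S \<Longrightarrow> Ck_on k S f \<Longrightarrow> Ck_on k S (\<lambda>x. f x $ i)"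
  by (rule Ck_on_bounded_linear[OF _ bounded_linear_vec_nth])

lemma Ck_on_partial_deriv: "Ck_on (Suc k) S f \<Longrightarrow> Ck_on k S (partial_deriv i f)"
  using Ck_on_Suc_D[of k S f "axis i 1"] by (simp add: partial_deriv_def[abs_def])

lemma Ck_on_det:
  fixes A :: "_ \<Rightarrow> real^'n^'n"
  assumes "open S" "\<And>i j. Ck_on k S (\<lambda>x. A x $ i $ j)"
  shows "Ck_on k S (\<lambda>x. det (A x))"
  unfolding det_def by (intro Ck_on_sum Ck_on_cmult Ck_on_prod assms)

lemma matrix_inv_mult:
  fixes A :: "real^'n^'n"
  assumes "det A \<noteq> 0"
  shows "A ** matrix_inv A = mat 1" "matrix_inv A ** A = mat 1"
proof -
  have "\<exists>A'. A ** A' = mat 1 \<and> A' ** A = mat 1"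
    using assms invertible_det_nz[of A] unfolding invertible_def by blast
  hence "A ** matrix_inv A = mat 1 \<and> matrix_inv A ** A = mat 1"
    unfolding matrix_inv_def by (rule someI_ex)
  thus "A ** matrix_inv A = mat 1" "matrix_inv A ** A = mat 1" by auto
qed

text \<open>Cramer's rule expresses the entries of the inverse by determinants, which are polynomial in the
  entries of the matrix. Hence the inverse is as smooth as the matrix.\<close>

lemma matrix_inv_cramer:
  fixes A :: "real^'n^'n"
  assumes "det A \<noteq> 0"
  shows "matrix_inv A $ i $ j = det (\<chi> r c. if c = i then (axis j 1 :: real^'n) $ r else A $ r $ c) * inverse (det A)"
proof -
  let ?x = "matrix_inv A *v axis j 1"
  have "A *v ?x = axis j 1"
    using matrix_inv_mult(1)[OF assms] by (simp add: matrix_vector_mul_assoc)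
  hence x: "?x = (\<chi> k. det (\<chi> r c. if c = k then (axis j 1 :: real^'n) $ r else A $ r $ c) / det A)"
    using cramer[OF assms, of ?x "axis j 1"] by simp
  have "matrix_inv A $ i $ j = ?x $ i"
    by (simp add: matrix_vector_mult_basis column_def)
  thus ?thesis unfolding x by (simp add: divide_inverse)
qed

lemma Ck_on_matrix_inv:
  fixes A :: "_ \<Rightarrow> real^'n^'n"
  assumes "open S" "\<And>i j. Ck_on k S (\<lambda>x. A x $ i $ j)" "\<And>x. x \<in> S \<Longrightarrow> det (A x) \<noteq> 0"
  shows "Ck_on k S (\<lambda>x. matrix_inv (A x) $ i $ j)"
proof -
  have "Ck_on k S (\<lambda>x. det (\<chi> r c. if c = i then (axis j 1 :: real^'n) $ r else A x $ r $ c) * inverse (det (A x)))"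
  proof (intro Ck_on_mult Ck_on_inverse Ck_on_det assms)
    fix r c
    show "Ck_on k S (\<lambda>x. (\<chi> r c. if c = i then (axis j 1 :: real^'n) $ r else A x $ r $ c) $ r $ c)"
      by (cases "c = i") (simp_all add: Ck_on_const assms)
  qed
  thus ?thesis
    by (subst Ck_on_cong[OF assms(1)]) (use matrix_inv_cramer assms(3) in auto)
qed

section \<open>A flat function and smooth bumps\<close>

text \<open>The functions \<open>p (1/t) exp (-1/t)\<close>, extended by zero, are closed under differentiation: the
  derivative has the polynomial \<open>X\<^sup>2 (p - p')\<close>. Hence all of them are smooth.\<close>

definition flat :: "real poly \<Rightarrow> real \<Rightarrow> real" where
  "flat p t = (if t > 0 then poly p (1 / t) * exp (- 1 / t) else 0)"

definition flat_deriv :: "real poly \<Rightarrow> real poly" where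
  "flat_deriv p = [:0, 0, 1:] * (p - pderiv p)"

lemma poly_exp_tendsto_0: "((\<lambda>x::real. poly p x * exp (- x)) \<longlongrightarrow> 0) at_top"
proof -
  have "((\<lambda>x::real. \<Sum>i\<le>degree p. coeff p i * (x ^ i / exp x)) \<longlongrightarrow> (\<Sum>i\<le>degree p. coeff p i * 0)) at_top"
    by (intro tendsto_sum tendsto_mult tendsto_const tendsto_power_div_exp_0)
  moreover have "(\<lambda>x. \<Sum>i\<le>degree p. coeff p i * (x ^ i / exp x)) = (\<lambda>x. poly p x * exp (- x))"
    by (auto simp: poly_altdef sum_distrib_left exp_minus divide_inverse mult_ac)
  ultimately show ?thesis by simp
qed

lemma flat_has_derivative: "(flat p has_field_derivative flat (flat_deriv p) t) (at t)"
proof -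
  consider "t > 0" | "t < 0" | "t = 0" by linarith
  thus ?thesis
  proof cases
    case 1
    have "((\<lambda>t. poly p (1 / t) * exp (- 1 / t)) has_field_derivative flat (flat_deriv p) t) (at t)"
      using 1 by (auto intro!: derivative_eq_intros
          simp: flat_def flat_deriv_def power2_eq_square field_simps)
    moreover have "eventually (\<lambda>t. flat p t = poly p (1 / t) * exp (- 1 / t)) (nhds t)"
      using eventually_nhds_in_open[of "{0<..}" t] 1 by (auto elim!: eventually_mono simp: flat_def)
    ultimately show ?thesis by (subst DERIV_cong_ev[OF refl _ refl]) auto
  next
    case 2
    have "eventually (\<lambda>t. flat p t = 0) (nhds t)"
      using eventually_nhds_in_open[of "{..<0}" t] 2 by (auto elim!: eventually_mono simp: flat_def)
    thus ?thesis using 2 by (subst DERIV_cong_ev[OF refl _ refl]) (auto simp: flat_def)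
  next
    case 3
    have "((\<lambda>h. flat p h / h) \<longlongrightarrow> 0) (at 0)"
    proof (rule filterlim_split_at)
      have "((\<lambda>h. poly (pCons 0 p) (inverse h) * exp (- inverse h)) \<longlongrightarrow> 0) (at_right 0)"
        by (rule filterlim_compose[OF poly_exp_tendsto_0 filterlim_inverse_at_top_right])
      moreover have "eventually (\<lambda>h. poly (pCons 0 p) (inverse h) * exp (- inverse h) = flat p h / h) (at_right 0)"
        using eventually_at_right_less[of 0] by eventually_elim (simp add: flat_def field_simps)
      ultimately show "((\<lambda>h. flat p h / h) \<longlongrightarrow> 0) (at_right 0)" by (rule Lim_transform_eventually)
      have "eventually (\<lambda>h. 0 = flat p h / h) (at_left (0::real))"
        by (auto simp: eventually_at_filter flat_def)
      thus "((\<lambda>h. flat p h / h) \<longlongrightarrow> 0) (at_left 0)" by (rule Lim_transform_eventually[OF tendsto_const])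
    qed
    thus ?thesis using 3 by (simp add: DERIV_def flat_def)
  qed
qed

lemma Ck_on_flat:
  assumes "open S" "Ck_on k S u"
  shows "Ck_on k S (\<lambda>x. flat p (u x))"
  using assms(2)
proof (induction k arbitrary: p)
  case 0
  have "continuous_on UNIV (flat p)"
    using DERIV_isCont[OF flat_has_derivative] by (intro continuous_at_imp_continuous_on) auto
  thus ?case using 0 by (auto intro: continuous_on_compose2)
next
  case (Suc k)
  show ?case
  proof (rule Ck_on_SucI[OF assms(1), where f'="\<lambda>x v. flat (flat_deriv p) (u x) * frechet_derivative u (at x) v"])
    show "((\<lambda>x. flat p (u x)) has_derivative (\<lambda>v. flat (flat_deriv p) (u x) * frechet_derivative u (at x) v)) (at x)"
      if x: "x \<in> S" for x
      by (rule has_derivative_compose[OF Ck_on_Suc_derivative[OF Suc.prems x]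
            flat_has_derivative[unfolded has_field_derivative_def]])
    show "Ck_on k S (\<lambda>x. flat (flat_deriv p) (u x) * frechet_derivative u (at x) v)" for v
      by (intro Ck_on_mult assms(1) Suc.IH Ck_on_Suc_D Suc.prems Ck_on_lower[OF Suc.prems])
  qed
qed

lemma flat_1: "flat 1 t = (if t > 0 then exp (- 1 / t) else 0)"
  by (simp add: flat_def)

lemma flat_1_nonneg: "0 \<le> flat 1 t" and flat_1_le_1: "flat 1 t \<le> 1" and flat_1_pos_iff: "0 < flat 1 t \<longleftrightarrow> 0 < t"
  by (auto simp: flat_1)

text \<open>The product of flat functions of the distances to the faces is positive exactly inside the box and
  vanishes to infinite order at its boundary. No plateau is required below: partitions of unity are
  obtained by normalising sums, and indicators of open sets as limits.\<close>

definition box_bump :: "real^'n \<Rightarrow> real^'n \<Rightarrow> real^'n \<Rightarrow> real" where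
  "box_bump a b x = (\<Prod>i\<in>UNIV. flat 1 (x $ i - a $ i) * flat 1 (b $ i - x $ i))"

lemma box_bump_range: "0 \<le> box_bump a b x" "box_bump a b x \<le> 1"
  unfolding box_bump_def
  by (auto intro!: prod_nonneg prod_le_1 mult_nonneg_nonneg mult_le_one simp: flat_1_nonneg flat_1_le_1)

lemma box_bump_pos_iff: "0 < box_bump a b x \<longleftrightarrow> x \<in> box a b"
proof -
  have "box_bump a b x \<noteq> 0 \<longleftrightarrow> (\<forall>i. 0 < flat 1 (x $ i - a $ i) \<and> 0 < flat 1 (b $ i - x $ i))"
    unfolding box_bump_def using flat_1_nonneg by (auto simp: order_less_le)
  also have "\<dots> \<longleftrightarrow> x \<in> box a b"
    by (auto simp: flat_1_pos_iff mem_box_cart)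
  finally show ?thesis using box_bump_range(1)[of a b x] by linarith
qed

lemma Ck_on_box_bump:
  fixes f :: "'a::real_normed_vector \<Rightarrow> real^'n"
  assumes "open S" "Ck_on k S f"
  shows "Ck_on k S (\<lambda>x. box_bump a b (f x))"
proof -
  have "Ck_on k S (\<lambda>x. f x $ i + (- a $ i))" "Ck_on k S (\<lambda>x. b $ i + (-1) * f x $ i)" for i
    by (intro Ck_on_cmult Ck_on_add Ck_on_const Ck_on_vec_nth assms)+
  hence "Ck_on k S (\<lambda>x. f x $ i - a $ i)" "Ck_on k S (\<lambda>x. b $ i - f x $ i)" for i by simp_all
  thus ?thesis unfolding box_bump_def
    by (intro Ck_on_prod[OF assms(1)] Ck_on_mult[OF assms(1) Ck_on_flat[OF assms(1)] Ck_on_flat[OF assms(1)]])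
qed

section \<open>Compactly supported functions of class \<open>C\<^sup>1\<close> on Euclidean space\<close>

definition C1_supported :: "(real^'n) set \<Rightarrow> (real^'n \<Rightarrow> real) \<Rightarrow> bool" where
  "C1_supported K f \<longleftrightarrow> compact K \<and> Ck_on (Suc 0) UNIV f \<and> (\<forall>x. x \<notin> K \<longrightarrow> f x = 0)"

lemma continuous_compact_support_integrable:
  fixes f :: "'a::euclidean_space \<Rightarrow> real"
  assumes "continuous_on UNIV f" "compact K" "\<And>x. x \<notin> K \<Longrightarrow> f x = 0"
  shows "integrable lborel f"
proof -
  have "integrable lborel (\<lambda>x. indicator K x *\<^sub>R f x)"
    using assms by (intro borel_integrable_compact) (auto intro: continuous_on_subset)
  moreover have "(\<lambda>x. indicator K x *\<^sub>R f x) = f" using assms(3) by (auto simp: fun_eq_iff indicator_def)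
  ultimately show ?thesis by simp
qed

lemma l2_norm_square_integral: "(l2_norm M g)\<^sup>2 = (LINT x|M. (g x)\<^sup>2)"
  by (simp add: l2_norm_square) (simp add: l2_inner_def power2_eq_square)

lemma integral_translation:
  fixes f :: "'a::euclidean_space \<Rightarrow> real"
  assumes "f \<in> borel_measurable borel"
  shows "(LINT x|lborel. f (x + a)) = (LINT x|lborel. f x)"
proof -
  have "(LINT x|lborel. f x) = (LINT x|distr lborel borel ((+) a). f x)" by (simp add: lborel_distr_plus)
  also have "\<dots> = (LINT x|lborel. f (a + x))" using assms by (intro integral_distr) auto
  finally show ?thesis by (simp add: add.commute)
qed

lemma derivative_eq_sum_partial:
  fixes f :: "real^'n \<Rightarrow> real"
  assumes "f differentiable (at x)"
  shows "frechet_derivative f (at x) v = (\<Sum>i\<in>UNIV. v $ i * partial_deriv i f x)"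
proof -
  have lin: "linear (frechet_derivative f (at x))"
    using assms frechet_derivative_works has_derivative_linear by blast
  have "v = (\<Sum>i\<in>UNIV. v $ i *\<^sub>R axis i 1)" by (simp add: basis_expansion flip: scalar_mult_eq_scaleR)
  hence "frechet_derivative f (at x) v = frechet_derivative f (at x) (\<Sum>i\<in>UNIV. v $ i *\<^sub>R axis i 1)" by simp
  also have "\<dots> = (\<Sum>i\<in>UNIV. v $ i * frechet_derivative f (at x) (axis i 1))"
    by (simp add: linear_sum[OF lin] linear_scale[OF lin])
  finally show ?thesis by (simp add: partial_deriv_def)
qed

text \<open>The steps are \<open>1 / (n + 1)\<close>: dominated convergence is about sequences, and \<open>n + 1\<close> such steps add up
  to \<open>v\<close>.\<close>

definition difference_quotient :: "(real^'n \<Rightarrow> real) \<Rightarrow> real^'n \<Rightarrow> nat \<Rightarrow> real^'n \<Rightarrow> real" where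
  "difference_quotient f v n x = real (Suc n) * (f (x + inverse (real (Suc n)) *\<^sub>R v) - f x)"

context
  fixes K :: "(real^'n) set" and f :: "real^'n \<Rightarrow> real"
  assumes C1: "C1_supported K f"
begin

abbreviation (input) "df \<equiv> \<lambda>x. frechet_derivative f (at x)"

lemma C1_compact: "compact K" and C1_zero: "x \<notin> K \<Longrightarrow> f x = 0"
  and C1_derivative: "(f has_derivative df x) (at x)" and C1_derivative_continuous: "continuous_on UNIV (\<lambda>x. df x v)"
  using C1 by (auto simp: C1_supported_def frechet_derivative_works)

lemma C1_continuous: "continuous_on UNIV f"
  using C1 Ck_on_imp_continuous_on by (auto simp: C1_supported_def simp del: Ck_on.simps)

lemma C1_derivative_zero: "x \<notin> K \<Longrightarrow> df x v = 0"
proof -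
  assume "x \<notin> K"
  have "(f has_derivative (\<lambda>_. 0)) (at x)"
  proof (rule has_derivative_transform_within_open[of "\<lambda>_. 0"])
    show "open (- K)" using C1_compact by (simp add: compact_imp_closed open_Compl)
  qed (use \<open>x \<notin> K\<close> C1_zero in auto)
  from frechet_derivative_at[OF this] show ?thesis by metis
qed

lemma C1_measurable [measurable]: "f \<in> borel_measurable borel"
  and C1_derivative_measurable [measurable]: "(\<lambda>x. df x v) \<in> borel_measurable borel"
  using C1_continuous C1_derivative_continuous by (auto intro: borel_measurable_continuous_onI)

lemma C1_integrable: "integrable lborel f" and C1_derivative_integrable: "integrable lborel (\<lambda>x. df x v)"
  and C1_derivative_square_integrable: "integrable lborel (\<lambda>x. (df x v)\<^sup>2)"
  by (rule continuous_compact_support_integrable[of _ K];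
      use C1_continuous C1_derivative_continuous C1_compact C1_zero C1_derivative_zero in \<open>auto intro: continuous_on_power\<close>)+

lemma C1_l2: "f \<in> l2_space lborel"
proof -
  have "integrable lborel (\<lambda>x. (f x)\<^sup>2)"
    by (rule continuous_compact_support_integrable[of _ K])
      (use C1_continuous C1_compact C1_zero in \<open>auto intro: continuous_on_power\<close>)
  thus ?thesis by (simp add: l2_space_def)
qed

lemma C1_translate_l2: "(\<lambda>x. f (x + a)) \<in> l2_space lborel"
proof -
  have "integrable lborel (\<lambda>x. (f (x + a))\<^sup>2)"
  proof (rule continuous_compact_support_integrable)
    show "continuous_on UNIV (\<lambda>x. (f (x + a))\<^sup>2)"
      by (intro continuous_on_power continuous_on_compose2[OF C1_continuous] continuous_intros) auto
    show "compact ((+) (- a) ` K)" using C1_compact by (rule compact_translation)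
    show "(f (x + a))\<^sup>2 = 0" if "x \<notin> (+) (- a) ` K" for x
    proof -
      have "x + a \<notin> K"
      proof
        assume "x + a \<in> K"
        hence "(+) (- a) (x + a) \<in> (+) (- a) ` K" by (rule imageI)
        thus False using that by simp
      qed
      thus ?thesis by (simp add: C1_zero)
    qed
  qed
  thus ?thesis by (simp add: l2_space_def)
qed

lemma difference_quotient_tendsto: "(\<lambda>n. difference_quotient f v n x) \<longlonglongrightarrow> df x v"
proof -
  have "((\<lambda>t. x + t *\<^sub>R v) has_derivative (\<lambda>t. t *\<^sub>R v)) (at 0)"
    by (auto intro!: derivative_eq_intros)
  from has_derivative_compose[OF this, of f "df x"] C1_derivative[of x]
  have "((\<lambda>t. f (x + t *\<^sub>R v)) has_derivative (\<lambda>t. df x (t *\<^sub>R v))) (at 0)" by simp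
  moreover have "(\<lambda>t. df x (t *\<^sub>R v)) = (*) (df x v)"
    using linear_scale[OF has_derivative_linear[OF C1_derivative[of x]]] by (auto simp: mult.commute)
  ultimately have "((\<lambda>t. f (x + t *\<^sub>R v)) has_field_derivative df x v) (at 0)"
    by (simp add: has_field_derivative_def)
  hence lim: "((\<lambda>t. (f (x + t *\<^sub>R v) - f x) / t) \<longlongrightarrow> df x v) (at 0)"
    by (simp add: DERIV_def)
  have "filterlim (\<lambda>n. inverse (real (Suc n))) (at 0) sequentially"
    using LIMSEQ_inverse_real_of_nat by (simp add: filterlim_at)
  from filterlim_compose[OF lim this] show ?thesis
    by (simp add: difference_quotient_def divide_inverse mult.commute)
qed

lemma C1_derivative_bounded: "\<exists>B\<ge>0. \<forall>x. \<bar>df x v\<bar> \<le> B"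
proof -
  have "bounded ((\<lambda>x. df x v) ` K)"
    by (intro compact_imp_bounded compact_continuous_image continuous_on_subset[OF C1_derivative_continuous] C1_compact) auto
  then obtain B where B: "\<And>x. x \<in> K \<Longrightarrow> \<bar>df x v\<bar> \<le> B" by (auto simp: bounded_iff)
  show ?thesis
  proof (intro exI[of _ "max B 0"] conjI allI)
    fix x show "\<bar>df x v\<bar> \<le> max B 0" using B[of x] C1_derivative_zero[of x v] by (cases "x \<in> K") auto
  qed simp
qed

text \<open>By the mean value theorem and the compact support, one multiple of the indicator of a ball dominates
  all difference quotients.\<close>

lemma difference_quotient_bound:
  "\<exists>B R. 0 \<le> B \<and> (\<forall>n x. \<bar>difference_quotient f v n x\<bar> \<le> B * indicator (cball 0 R) x)"
proof -
  obtain B where B: "B \<ge> 0" "\<And>x. \<bar>df x v\<bar> \<le> B" using C1_derivative_bounded by blast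
  obtain R where R: "\<And>x. x \<in> K \<Longrightarrow> norm x \<le> R"
    using compact_imp_bounded[OF C1_compact] by (auto simp: bounded_iff)
  have "\<bar>difference_quotient f v n x\<bar> \<le> B * indicator (cball 0 (R + norm v)) x" for n x
  proof -
    define t where "t = inverse (real (Suc n))"
    have t: "0 < t" "t \<le> 1" by (auto simp: t_def field_simps)
    show ?thesis
    proof (cases "x \<in> cball 0 (R + norm v)")
      case True
      have "norm (f (x + t *\<^sub>R v) - f (x + 0 *\<^sub>R v)) \<le> B * norm (t - 0)"
      proof (rule field_differentiable_bound[of UNIV "\<lambda>s. f (x + s *\<^sub>R v)" "\<lambda>s. df (x + s *\<^sub>R v) v"])
        fix s :: real
        have "((\<lambda>s. x + s *\<^sub>R v) has_derivative (\<lambda>t. t *\<^sub>R v)) (at s)"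
          by (auto intro!: derivative_eq_intros)
        from has_derivative_compose[OF this C1_derivative]
        have "((\<lambda>s. f (x + s *\<^sub>R v)) has_derivative (\<lambda>t. df (x + s *\<^sub>R v) (t *\<^sub>R v))) (at s)" .
        moreover have "(\<lambda>t. df (x + s *\<^sub>R v) (t *\<^sub>R v)) = (*) (df (x + s *\<^sub>R v) v)"
          using linear_scale[OF has_derivative_linear[OF C1_derivative[of "x + s *\<^sub>R v"]]] by (auto simp: mult.commute)
        ultimately show "((\<lambda>s. f (x + s *\<^sub>R v)) has_field_derivative df (x + s *\<^sub>R v) v) (at s within UNIV)"
          by (simp add: has_field_derivative_def)
        show "norm (df (x + s *\<^sub>R v) v) \<le> B" using B by simp
      qed auto
      hence "\<bar>f (x + t *\<^sub>R v) - f x\<bar> \<le> B * t" using t by simp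
      hence "inverse t * \<bar>f (x + t *\<^sub>R v) - f x\<bar> \<le> inverse t * (B * t)"
        using t by (intro mult_left_mono) auto
      also have "\<dots> = B" using t by simp
      finally show ?thesis using True t by (simp add: difference_quotient_def abs_mult t_def)
    next
      case False
      have "norm (t *\<^sub>R v) \<le> norm v" using t by (simp add: mult_left_le_one_le)
      hence "norm x \<le> norm (x + t *\<^sub>R v) + norm v" using norm_triangle_ineq4[of "x + t *\<^sub>R v" "t *\<^sub>R v"] by simp
      hence "x + t *\<^sub>R v \<notin> K" using R[of "x + t *\<^sub>R v"] False by auto
      moreover have "x \<notin> K" using R[of x] False norm_ge_zero[of v] by force
      ultimately show ?thesis using False C1_zero by (simp add: difference_quotient_def t_def)
    qed
  qed
  with B(1) show ?thesis by blast
qed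

lemma difference_quotient_measurable [measurable]: "difference_quotient f v n \<in> borel_measurable borel"
  unfolding difference_quotient_def by measurable

text \<open>By translation invariance the difference quotients have integral zero.\<close>

lemma integral_derivative_zero: "(LINT x|lborel. df x v) = 0"
proof -
  obtain B R where B: "0 \<le> B" "\<And>n x. \<bar>difference_quotient f v n x\<bar> \<le> B * indicator (cball 0 R) x"
    using difference_quotient_bound by blast
  have "(\<lambda>n. LINT x|lborel. difference_quotient f v n x) \<longlonglongrightarrow> (LINT x|lborel. df x v)"
  proof (rule integral_dominated_convergence[where w="\<lambda>x. B * indicator (cball 0 R) x"])
    show "integrable lborel (\<lambda>x. B * indicator (cball 0 R) x :: real)"
      by (intro integrable_mult_right integrable_real_indicator) (use emeasure_lborel_cball_finite in auto)
  qed (use B difference_quotient_tendsto in auto)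
  moreover have "(LINT x|lborel. difference_quotient f v n x) = 0" for n
  proof -
    have "integrable lborel (\<lambda>x. f (x + a))" for a
    proof -
      have "integrable (distr lborel borel ((+) a)) f" using C1_integrable by (simp add: lborel_distr_plus)
      thus ?thesis by (subst (asm) integrable_distr_eq) (auto simp: add.commute)
    qed
    thus ?thesis unfolding difference_quotient_def using C1_integrable by (simp add: integral_translation)
  qed
  ultimately show ?thesis by (simp add: LIMSEQ_const_iff)
qed

text \<open>The \<open>L\<^sup>2\<close> modulus of continuity is subadditive in the step, so it is at most its rate at zero,
  which is the norm of the derivative.\<close>

lemma l2_translation_le:
  "l2_norm lborel (\<lambda>x. f (x + v) - f x) \<le> l2_norm lborel (\<lambda>x. df x v)"
proof -
  have eq_square: "(l2_norm lborel g)\<^sup>2 = (LINT x|lborel. (g x)\<^sup>2)" for g :: "real^'n \<Rightarrow> real"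
    by (simp add: l2_norm_square_integral)
  have translate: "l2_norm lborel (\<lambda>x. f (x + a + b) - f (x + a)) = l2_norm lborel (\<lambda>x. f (x + b) - f x)" for a b
  proof -
    have "(LINT x|lborel. (f (x + a + b) - f (x + a))\<^sup>2) = (LINT x|lborel. (f (x + b) - f x)\<^sup>2)"
      by (rule integral_translation[where f="\<lambda>x. (f (x + b) - f x)\<^sup>2"]) measurable
    thus ?thesis by (simp add: l2_norm_def l2_inner_def power2_eq_square)
  qed
  have le: "l2_norm lborel (\<lambda>x. f (x + v) - f x) \<le> l2_norm lborel (difference_quotient f v n)" for n
  proof -
    let ?h = "inverse (real (Suc n)) *\<^sub>R v"
    have "f (x + v) - f x = (\<Sum>k<Suc n. f (x + real k *\<^sub>R ?h + ?h) - f (x + real k *\<^sub>R ?h))" for x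
    proof -
      have "(\<Sum>k<Suc n. f (x + real (Suc k) *\<^sub>R ?h) - f (x + real k *\<^sub>R ?h)) = f (x + real (Suc n) *\<^sub>R ?h) - f (x + real 0 *\<^sub>R ?h)"
        by (rule sum_lessThan_telescope)
      moreover have "x + real (Suc k) *\<^sub>R ?h = x + real k *\<^sub>R ?h + ?h" for k
        by (simp only: of_nat_Suc scaleR_left_distrib scaleR_one ac_simps)
      moreover have "x + real (Suc n) *\<^sub>R ?h = x + v" "x + real 0 *\<^sub>R ?h = x" by simp_all
      ultimately show ?thesis by (simp only:)
    qed
    hence "l2_norm lborel (\<lambda>x. f (x + v) - f x)
        \<le> (\<Sum>k<Suc n. l2_norm lborel (\<lambda>x. f (x + real k *\<^sub>R ?h + ?h) - f (x + real k *\<^sub>R ?h)))"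
      by (simp only:) (intro l2_norm_sum_le l2_space_diff C1_translate_l2 | simp add: add.assoc C1_translate_l2 del: sum.lessThan_Suc)+
    also have "\<dots> = real (Suc n) * l2_norm lborel (\<lambda>x. f (x + ?h) - f x)"
      unfolding translate by simp
    also have "\<dots> = l2_norm lborel (difference_quotient f v n)"
      unfolding difference_quotient_def l2_norm_scale by simp
    finally show ?thesis .
  qed
  obtain B R where B: "0 \<le> B" "\<And>n x. \<bar>difference_quotient f v n x\<bar> \<le> B * indicator (cball 0 R) x"
    using difference_quotient_bound by blast
  have "(\<lambda>n. LINT x|lborel. (difference_quotient f v n x)\<^sup>2) \<longlonglongrightarrow> (LINT x|lborel. (df x v)\<^sup>2)"
  proof (rule integral_dominated_convergence[where w="\<lambda>x. B\<^sup>2 * indicator (cball 0 R) x"])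
    show "integrable lborel (\<lambda>x. B\<^sup>2 * indicator (cball 0 R) x :: real)"
      by (intro integrable_mult_right integrable_real_indicator) (use emeasure_lborel_cball_finite in auto)
    have "(difference_quotient f v n x)\<^sup>2 \<le> (B * indicator (cball 0 R) x)\<^sup>2" for n x
      using B(2)[of n x] by (metis abs_ge_zero power2_abs power_mono)
    moreover have "(B * indicator (cball 0 R) x)\<^sup>2 = B\<^sup>2 * indicator (cball 0 R) x" for x :: "real^'n"
      by (simp add: power_mult_distrib indicator_def)
    ultimately show "AE x in lborel. norm ((difference_quotient f v n x)\<^sup>2) \<le> B\<^sup>2 * indicator (cball 0 R) x" for n by simp
    show "AE x in lborel. (\<lambda>n. (difference_quotient f v n x)\<^sup>2) \<longlonglongrightarrow> (df x v)\<^sup>2"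
      by (intro AE_I2 tendsto_power difference_quotient_tendsto)
  qed simp_all
  hence "(\<lambda>n. (l2_norm lborel (difference_quotient f v n))\<^sup>2) \<longlonglongrightarrow> (l2_norm lborel (\<lambda>x. df x v))\<^sup>2"
    by (simp only: eq_square)
  from tendsto_real_sqrt[OF this] have "(\<lambda>n. l2_norm lborel (difference_quotient f v n)) \<longlonglongrightarrow> l2_norm lborel (\<lambda>x. df x v)"
    by simp
  thus ?thesis by (rule LIMSEQ_le_const) (use le in blast)
qed

lemma C1_derivative_square_le: "(df x v)\<^sup>2 \<le> (norm v)\<^sup>2 * (\<Sum>i\<in>UNIV. (partial_deriv i f x)\<^sup>2)"
proof -
  have "(df x v)\<^sup>2 \<le> (\<Sum>i\<in>UNIV. (v $ i)\<^sup>2) * (\<Sum>i\<in>UNIV. (partial_deriv i f x)\<^sup>2)"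
    unfolding derivative_eq_sum_partial[OF differentiableI[OF C1_derivative]] by (rule Cauchy_Schwarz_ineq_sum)
  also have "(\<Sum>i\<in>UNIV. (v $ i)\<^sup>2) = (norm v)\<^sup>2"
    by (simp add: norm_vec_def L2_set_def sum_nonneg)
  finally show ?thesis .
qed

lemma gradient_integrable: "integrable lborel (\<lambda>x. \<Sum>i\<in>UNIV. (partial_deriv i f x)\<^sup>2)"
  unfolding partial_deriv_def by (intro Bochner_Integration.integrable_sum C1_derivative_square_integrable)

lemma translation_square_le:
  "(LINT x|lborel. (f (x + v) - f x)\<^sup>2) \<le> (norm v)\<^sup>2 * (LINT x|lborel. (\<Sum>i\<in>UNIV. (partial_deriv i f x)\<^sup>2))"
proof -
  have "(LINT x|lborel. (f (x + v) - f x)\<^sup>2) = (l2_norm lborel (\<lambda>x. f (x + v) - f x))\<^sup>2"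
    by (simp add: l2_norm_square_integral)
  also have "\<dots> \<le> (l2_norm lborel (\<lambda>x. df x v))\<^sup>2"
    by (intro power_mono l2_translation_le) simp
  also have "\<dots> = (LINT x|lborel. (df x v)\<^sup>2)"
    by (simp add: l2_norm_square_integral)
  also have "\<dots> \<le> (LINT x|lborel. (norm v)\<^sup>2 * (\<Sum>i\<in>UNIV. (partial_deriv i f x)\<^sup>2))"
    by (intro integral_mono C1_derivative_square_integrable integrable_mult_right gradient_integrable C1_derivative_square_le)
  finally show ?thesis by simp
qed

end

section \<open>A quantitative Rellich inequality on Euclidean space\<close>

definition tent :: "real \<Rightarrow> real^'n \<Rightarrow> real" where
  "tent r y = max 0 (r - norm y)"

lemma tent_nonneg: "0 \<le> tent r y"
  by (simp add: tent_def)

lemma tent_continuous: "continuous_on UNIV (tent r)"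
  unfolding tent_def by (intro continuous_intros)

lemma tent_measurable [measurable]: "tent r \<in> borel_measurable borel"
  using tent_continuous by (rule borel_measurable_continuous_onI)

lemma tent_lipschitz: "\<bar>tent r x - tent r y\<bar> \<le> norm (x - y)"
  using norm_triangle_ineq2[of x y] norm_triangle_ineq2[of y x]
  by (auto simp: tent_def max_def norm_minus_commute)

lemma tent_0: "norm y \<ge> r \<Longrightarrow> tent r y = 0"
  by (simp add: tent_def)

lemma tent_integrable: "integrable lborel (tent r)"
  by (rule continuous_compact_support_integrable[of _ "cball 0 r"]) (auto simp: tent_continuous tent_0)

lemma tent_integral_pos:
  assumes "r > 0" shows "0 < (LINT y|lborel. tent r (y :: real^'n))"
proof -
  have "(LINT y|lborel. (r / 2) * indicator (ball 0 (r / 2)) (y :: real^'n)) \<le> (LINT y|lborel. tent r (y :: real^'n))"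
  proof (rule integral_mono)
    show "integrable lborel (\<lambda>y. (r / 2) * indicator (ball 0 (r / 2)) (y :: real^'n))"
      by (intro integrable_mult_right integrable_real_indicator) (use emeasure_lborel_ball_finite in auto)
    show "(r / 2) * indicator (ball 0 (r / 2)) y \<le> tent r y" for y :: "real^'n"
      by (auto simp: tent_def indicator_def max_def)
  qed (rule tent_integrable)
  moreover have "(LINT y|lborel. (r / 2) * indicator (ball 0 (r / 2)) (y :: real^'n)) = (r / 2) * measure lborel (ball (0 :: real^'n) (r / 2))"
    by simp
  moreover have "measure lborel (ball (0 :: real^'n) (r / 2)) > 0"
    using assms by (simp add: content_ball_pos)
  ultimately show ?thesis using assms by (smt (verit) half_gt_zero mult_pos_pos)
qed

text \<open>The tent kernel is compactly supported and Lipschitz. Nothing smoother is needed, since only the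
  Lipschitz constant of the average enters.\<close>

definition mollified :: "(real^'n \<Rightarrow> real) \<Rightarrow> real \<Rightarrow> real^'n \<Rightarrow> real" where
  "mollified f r x = (LINT y|lborel. f (x + y) * tent r y) / (LINT y|lborel. tent r (y :: real^'n))"

definition grad_energy :: "(real^'n \<Rightarrow> real) \<Rightarrow> real" where
  "grad_energy f = (LINT x|lborel. (\<Sum>i\<in>UNIV. (partial_deriv i f x)\<^sup>2))"

context
  fixes K :: "(real^'n) set" and f :: "real^'n \<Rightarrow> real" and r :: real
  assumes C1: "C1_supported K f" and r: "r > 0"
begin

lemma tent_integrable_vec: "integrable lborel (tent r :: real^'n \<Rightarrow> real)"
  by (rule tent_integrable)

lemma translate_tent_integrable: "integrable lborel (\<lambda>y. f (x + y) * tent r y)"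
proof (rule continuous_compact_support_integrable[of _ "cball 0 r"])
  show "continuous_on UNIV (\<lambda>y. f (x + y) * tent r y)"
    by (intro continuous_on_mult tent_continuous continuous_on_compose2[OF C1_continuous[OF C1]] continuous_intros) auto
qed (auto simp: tent_0)

lemma diff_tent_continuous: "continuous_on UNIV (\<lambda>y. (f (x + y) - f x)\<^sup>2 * tent r y)"
  by (intro continuous_on_mult continuous_on_power continuous_on_diff tent_continuous
      continuous_on_compose2[OF C1_continuous[OF C1]] continuous_intros) auto

lemma diff_tent_integrable: "integrable lborel (\<lambda>y. (f (x + y) - f x)\<^sup>2 * tent r y)"
  by (rule continuous_compact_support_integrable[of _ "cball 0 r"]) (auto simp: tent_0 diff_tent_continuous)

text \<open>Jensen's inequality for the average defining the mollification.\<close>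

lemma mollified_error:
  "(f x - mollified f r x)\<^sup>2 * (LINT y|lborel. tent r (y :: real^'n)) \<le> (LINT y|lborel. (f (x + y) - f x)\<^sup>2 * tent r y)"
proof -
  let ?c = "LINT y|lborel. tent r (y :: real^'n)"
  have c: "?c > 0" by (rule tent_integral_pos[OF r])
  define a where "a = mollified f r x - f x"
  have int1: "integrable lborel (\<lambda>y. (f (x + y) - f x) * tent r y)"
    using translate_tent_integrable[of x] tent_integrable_vec by (simp add: left_diff_distrib)
  have "(LINT y|lborel. (f (x + y) - f x) * tent r y) = (LINT y|lborel. f (x + y) * tent r y) - f x * ?c"
    using translate_tent_integrable[of x] tent_integrable_vec by (simp add: left_diff_distrib)
  also have "\<dots> = a * ?c" using c by (simp add: a_def mollified_def field_simps)
  finally have mean: "(LINT y|lborel. (f (x + y) - f x) * tent r y) = a * ?c" .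
  have "0 \<le> (LINT y|lborel. ((f (x + y) - f x) - a)\<^sup>2 * tent r y)"
    by (intro Bochner_Integration.integral_nonneg) (simp add: tent_nonneg)
  also have "\<dots> = (LINT y|lborel. (f (x + y) - f x)\<^sup>2 * tent r y - 2 * a * ((f (x + y) - f x) * tent r y) + a\<^sup>2 * tent r y)"
    by (intro Bochner_Integration.integral_cong) (auto simp: power2_eq_square algebra_simps)
  also have "\<dots> = (LINT y|lborel. (f (x + y) - f x)\<^sup>2 * tent r y) - 2 * a * (a * ?c) + a\<^sup>2 * ?c"
    using diff_tent_integrable[of x] int1 tent_integrable_vec by (simp add: mean)
  finally have "a\<^sup>2 * ?c \<le> (LINT y|lborel. (f (x + y) - f x)\<^sup>2 * tent r y)"
    by (simp add: power2_eq_square algebra_simps)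
  thus ?thesis by (simp add: a_def power2_commute)
qed

text \<open>The squared error of the average is at most the average of \<open>\<bar>f (x + y) - f x\<bar>\<^sup>2\<close> over the shifts \<open>y\<close> of
  length at most \<open>r\<close>. By Fubini, its integral is at most the largest integral for a single shift,
  which the gradient controls.\<close>

lemma mollified_error_integral:
  "(\<integral>\<^sup>+x. ennreal ((f x - mollified f r x)\<^sup>2) \<partial>lborel) \<le> ennreal (r\<^sup>2 * grad_energy f)"
proof -
  let ?c = "LINT y|lborel. tent r (y :: real^'n)"
  have c: "?c > 0" by (rule tent_integral_pos[OF r])
  have G: "grad_energy f \<ge> 0" unfolding grad_energy_def by (intro Bochner_Integration.integral_nonneg) (simp add: sum_nonneg)
  have fm [measurable]: "f \<in> borel_measurable borel" by (rule C1_measurable[OF C1])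
  have [measurable]: "(\<lambda>(x, y). f (x + y)) \<in> borel_measurable (borel \<Otimes>\<^sub>M borel)" by measurable
  have inner: "(\<integral>\<^sup>+x. ennreal ((f (x + y) - f x)\<^sup>2 * tent r y) \<partial>lborel) \<le> ennreal (r\<^sup>2 * grad_energy f) * ennreal (tent r y)" for y
  proof -
    have L: "(\<lambda>x. f (x + y) - f x) \<in> l2_space lborel"
      by (intro l2_space_diff C1_translate_l2[OF C1] C1_l2[OF C1])
    have "(\<integral>\<^sup>+x. ennreal ((f (x + y) - f x)\<^sup>2 * tent r y) \<partial>lborel) = ennreal (tent r y) * (\<integral>\<^sup>+x. ennreal ((f (x + y) - f x)\<^sup>2) \<partial>lborel)"
      by (subst nn_integral_cmult[symmetric]) (auto simp: ennreal_mult' tent_nonneg mult.commute)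
    also have "(\<integral>\<^sup>+x. ennreal ((f (x + y) - f x)\<^sup>2) \<partial>lborel) = ennreal (LINT x|lborel. (f (x + y) - f x)\<^sup>2)"
      using l2_nn_integral_square[OF L] by (simp add: l2_norm_square_integral)
    also have "ennreal (tent r y) * \<dots> \<le> ennreal (tent r y) * ennreal (r\<^sup>2 * grad_energy f)"
    proof (cases "norm y \<le> r")
      case True
      have "(LINT x|lborel. (f (x + y) - f x)\<^sup>2) \<le> (norm y)\<^sup>2 * grad_energy f"
        unfolding grad_energy_def by (rule translation_square_le[OF C1])
      also have "\<dots> \<le> r\<^sup>2 * grad_energy f"
        using True G by (intro mult_right_mono power_mono) auto
      finally show ?thesis by (intro mult_left_mono ennreal_leI) auto
    qed (simp add: tent_0)
    finally show ?thesis by (simp add: mult.commute)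
  qed
  have "ennreal ?c * (\<integral>\<^sup>+x. ennreal ((f x - mollified f r x)\<^sup>2) \<partial>lborel)
      \<le> (\<integral>\<^sup>+x. (\<integral>\<^sup>+y. ennreal ((f (x + y) - f x)\<^sup>2 * tent r y) \<partial>lborel) \<partial>lborel)"
  proof -
    have "ennreal ?c * (\<integral>\<^sup>+x. ennreal ((f x - mollified f r x)\<^sup>2) \<partial>lborel) = (\<integral>\<^sup>+x. ennreal ?c * ennreal ((f x - mollified f r x)\<^sup>2) \<partial>lborel)"
      by (rule nn_integral_cmult[symmetric]) (simp add: mollified_def)
    also have "\<dots> \<le> (\<integral>\<^sup>+x. (\<integral>\<^sup>+y. ennreal ((f (x + y) - f x)\<^sup>2 * tent r y) \<partial>lborel) \<partial>lborel)"
    proof (rule nn_integral_mono)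
      fix x
      have "(\<integral>\<^sup>+y. ennreal ((f (x + y) - f x)\<^sup>2 * tent r y) \<partial>lborel) = ennreal (LINT y|lborel. (f (x + y) - f x)\<^sup>2 * tent r y)"
        by (intro nn_integral_eq_integral diff_tent_integrable) (simp add: tent_nonneg)
      thus "ennreal ?c * ennreal ((f x - mollified f r x)\<^sup>2) \<le> (\<integral>\<^sup>+y. ennreal ((f (x + y) - f x)\<^sup>2 * tent r y) \<partial>lborel)"
        using mollified_error[of x] c by (simp add: ennreal_leI mult.commute flip: ennreal_mult')
    qed
    finally show ?thesis .
  qed
  also have "\<dots> = (\<integral>\<^sup>+y. (\<integral>\<^sup>+x. ennreal ((f (x + y) - f x)\<^sup>2 * tent r y) \<partial>lborel) \<partial>lborel)"
    by (rule lborel_pair.Fubini'[symmetric]) measurable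
  also have "\<dots> \<le> (\<integral>\<^sup>+y. ennreal (r\<^sup>2 * grad_energy f) * ennreal (tent r (y :: real^'n)) \<partial>lborel)"
    by (intro nn_integral_mono inner)
  also have "\<dots> = ennreal (r\<^sup>2 * grad_energy f) * ennreal ?c"
    by (subst nn_integral_cmult) (auto simp: nn_integral_eq_integral tent_integrable tent_nonneg)
  finally have "ennreal ?c * (\<integral>\<^sup>+x. ennreal ((f x - mollified f r x)\<^sup>2) \<partial>lborel) \<le> ennreal ?c * ennreal (r\<^sup>2 * grad_energy f)"
    by (simp add: mult.commute)
  thus ?thesis using c by (subst (asm) ennreal_mult_le_mult_iff) auto
qed

lemma mollified_eq_inner:
  "mollified f r z = (LINT y|lborel. f y * tent r (y - z)) / (LINT y|lborel. tent r (y :: real^'n))"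
proof -
  have [measurable]: "f \<in> borel_measurable borel" by (rule C1_measurable[OF C1])
  have "(LINT y|lborel. f y * tent r (y - z)) = (LINT y|lborel. f (y + z) * tent r (y + z - z))"
    by (rule integral_translation[symmetric, where f="\<lambda>y. f y * tent r (y - z)"]) measurable
  thus ?thesis by (simp add: mollified_def add.commute)
qed

text \<open>The average is the inner product of \<open>f\<close> with a translate of the tent, and the tent is Lipschitz.\<close>

lemma mollified_lipschitz:
  "\<bar>mollified f r x - mollified f r z\<bar> * (LINT y|lborel. tent r (y :: real^'n)) \<le> norm (x - z) * (sqrt (measure lborel K) * l2_norm lborel f)"
proof -
  let ?c = "LINT y|lborel. tent r (y :: real^'n)"
  have c: "?c > 0" by (rule tent_integral_pos[OF r])
  note K = C1_compact[OF C1]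
  have [measurable]: "f \<in> borel_measurable borel" by (rule C1_measurable[OF C1])
  have Km: "K \<in> sets borel" using K by (simp add: borel_compact)
  have Kfin: "emeasure lborel K < \<infinity>" using emeasure_compact_finite[OF K] .
  have indL: "indicator K \<in> l2_space lborel"
  proof -
    have "integrable lborel (indicator K :: _ \<Rightarrow> real)" using Km Kfin by (intro integrable_real_indicator) auto
    moreover have "(\<lambda>x. (indicator K x :: real)\<^sup>2) = indicator K" by (auto simp: indicator_def)
    ultimately show ?thesis using Km by (simp add: l2_space_def)
  qed
  have absL: "(\<lambda>y. \<bar>f y\<bar>) \<in> l2_space lborel" using C1_l2[OF C1] by (simp add: l2_space_def)
  have int: "integrable lborel (\<lambda>y. f y * tent r (y - w))" for w
  proof (rule continuous_compact_support_integrable[OF _ K])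
    show "continuous_on UNIV (\<lambda>y. f y * tent r (y - w))"
      by (intro continuous_on_mult C1_continuous[OF C1] continuous_on_compose2[OF tent_continuous] continuous_intros) auto
  qed (simp add: C1_zero[OF C1])
  have "(mollified f r x - mollified f r z) * ?c = (LINT y|lborel. f y * (tent r (y - x) - tent r (y - z)))"
    using c int[of x] int[of z] unfolding mollified_eq_inner by (simp add: field_simps)
  moreover have "\<bar>(mollified f r x - mollified f r z) * ?c\<bar> = \<bar>mollified f r x - mollified f r z\<bar> * ?c"
    using c by (simp add: abs_mult)
  ultimately have "\<bar>mollified f r x - mollified f r z\<bar> * ?c = \<bar>LINT y|lborel. f y * (tent r (y - x) - tent r (y - z))\<bar>"
    by simp
  also have "\<dots> \<le> (LINT y|lborel. \<bar>f y * (tent r (y - x) - tent r (y - z))\<bar>)"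
    by (rule integral_abs_bound)
  also have "\<dots> \<le> (LINT y|lborel. norm (x - z) * (indicator K y * \<bar>f y\<bar>))"
  proof (rule integral_mono)
    show "integrable lborel (\<lambda>y. \<bar>f y * (tent r (y - x) - tent r (y - z))\<bar>)"
      using int[of x] int[of z] by (simp add: right_diff_distrib)
    show "integrable lborel (\<lambda>y. norm (x - z) * (indicator K y * \<bar>f y\<bar>))"
      by (intro integrable_mult_right l2_space_integrable_mult indL absL)
    fix y
    have "\<bar>tent r (y - x) - tent r (y - z)\<bar> \<le> norm (x - z)"
      using tent_lipschitz[of r "y - x" "y - z"] by (simp add: norm_minus_commute)
    thus "\<bar>f y * (tent r (y - x) - tent r (y - z))\<bar> \<le> norm (x - z) * (indicator K y * \<bar>f y\<bar>)"
      by (cases "y \<in> K") (auto simp: abs_mult C1_zero[OF C1] mult.commute intro: mult_left_mono)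
  qed
  also have "\<dots> = norm (x - z) * l2_inner lborel (indicator K) (\<lambda>y. \<bar>f y\<bar>)"
    by (simp add: l2_inner_def)
  also have "l2_inner lborel (indicator K) (\<lambda>y. \<bar>f y\<bar>) \<le> l2_norm lborel (indicator K) * l2_norm lborel (\<lambda>y. \<bar>f y\<bar>)"
    using l2_cauchy_schwarz[OF indL absL] by linarith
  also have "l2_norm lborel (indicator K) = sqrt (measure lborel K)"
  proof -
    have "(\<lambda>x. (indicator K x :: real) * indicator K x) = indicator K" by (auto simp: indicator_def)
    thus ?thesis using Km Kfin by (simp add: l2_norm_def l2_inner_def)
  qed
  also have "l2_norm lborel (\<lambda>y. \<bar>f y\<bar>) = l2_norm lborel f"
    by (simp add: l2_norm_def l2_inner_def)
  finally show ?thesis by (simp add: mult_left_mono)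
qed

end

text \<open>This is the Rellich compactness theorem in a form without sequences. Averaging \<open>f\<close> over a small
  radius changes it by little compared with its Dirichlet energy. The average is Lipschitz with a
  constant controlled by the norm of \<open>f\<close>, so its values on a fine finite net of \<open>K\<close> determine it on
  \<open>K\<close> up to a fraction of that norm, which can be absorbed into the left-hand side. The radius and the
  net depend only on \<open>K\<close> and \<open>\<epsilon>\<close>, so the averages at the points of the net are finitely many linear
  functionals that serve for all \<open>f\<close>.\<close>

theorem rellich_inequality:
  fixes K :: "(real^'n) set"
  assumes K: "compact K" and \<epsilon>: "\<epsilon> > 0"
  obtains Z r C where "finite Z" "r > 0" "C \<ge> 0"
    "\<And>f. C1_supported K f \<Longrightarrow> (LINT x|lborel. (f x)\<^sup>2) \<le>
        \<epsilon> * (LINT x|lborel. (\<Sum>i\<in>UNIV. (partial_deriv i f x)\<^sup>2)) + C * (\<Sum>z\<in>Z. (LINT y|lborel. f y * tent r (y - z))\<^sup>2)"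
proof -
  \<comment> \<open>The mollification error contributes \<open>2 r\<^sup>2\<close> times the energy. Absorbing half of the norm doubles this.\<close>
  define r where "r = sqrt \<epsilon> / 2"
  have r: "r > 0" "4 * r\<^sup>2 = \<epsilon>" using \<epsilon> by (auto simp: r_def power_divide)
  define c where "c = (LINT y|lborel. tent r (y :: real^'n))"
  have c: "c > 0" unfolding c_def by (rule tent_integral_pos[OF r(1)])
  define m where "m = measure lborel K"
  have m: "m \<ge> 0" by (simp add: m_def)
  have Km: "K \<in> sets borel" using K by (simp add: borel_compact)
  have Kfin: "emeasure lborel K < \<infinity>" using emeasure_compact_finite[OF K] .
  \<comment> \<open>With this mesh the oscillation between net points contributes at most \<open>4/9\<close> of the norm; the
    summand 1 covers a null set \<open>K\<close>.\<close>
  define \<delta> where "\<delta> = c / (3 * (m + 1))"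
  have \<delta>: "\<delta> > 0" using c m by (simp add: \<delta>_def)
  have "K \<subseteq> (\<Union>x\<in>K. ball x \<delta>)" using \<delta> by auto
  then obtain Z where Z: "Z \<subseteq> K" "finite Z" "K \<subseteq> (\<Union>z\<in>Z. ball z \<delta>)"
    using compactE_image[OF K, of K "\<lambda>x. ball x \<delta>"] by (metis open_ball)
  define C where "C = 8 * m / c\<^sup>2"
  have C: "C \<ge> 0" using m by (simp add: C_def)
  show ?thesis
  proof (rule that[OF Z(2) r(1) C])
    fix f :: "real^'n \<Rightarrow> real" assume C1: "C1_supported K f"
    define N where "N = (LINT x|lborel. (f x)\<^sup>2)"
    have N: "N = (l2_norm lborel f)\<^sup>2" "N \<ge> 0" by (auto simp: N_def l2_norm_square_integral[symmetric])
    let ?u = "mollified f r"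
    define S where "S = (\<Sum>z\<in>Z. (?u z)\<^sup>2)"
    have S: "S \<ge> 0" by (simp add: S_def sum_nonneg)
    have G: "grad_energy f \<ge> 0" unfolding grad_energy_def by (intro Bochner_Integration.integral_nonneg) (simp add: sum_nonneg)
    have u_K: "(?u x)\<^sup>2 \<le> 2 * S + 2 * (\<delta> / c)\<^sup>2 * m * N" if x: "x \<in> K" for x
    proof -
      obtain z where z: "z \<in> Z" "dist z x < \<delta>" using Z(3) x by auto
      have "\<bar>?u x - ?u z\<bar> * c \<le> norm (x - z) * (sqrt m * l2_norm lborel f)"
        unfolding c_def m_def by (rule mollified_lipschitz[OF C1 r(1)])
      also have "\<dots> \<le> \<delta> * (sqrt m * l2_norm lborel f)"
        using z(2) m by (intro mult_right_mono) (auto simp: dist_norm norm_minus_commute)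
      finally have "\<bar>?u x - ?u z\<bar> \<le> (\<delta> / c) * (sqrt m * l2_norm lborel f)"
        using c by (simp add: field_simps)
      hence "\<bar>?u x - ?u z\<bar>\<^sup>2 \<le> ((\<delta> / c) * (sqrt m * l2_norm lborel f))\<^sup>2"
        by (intro power_mono) auto
      also have "\<dots> = (\<delta> / c)\<^sup>2 * m * N" using m by (simp add: power_mult_distrib power_divide N)
      finally have 1: "(?u x - ?u z)\<^sup>2 \<le> (\<delta> / c)\<^sup>2 * m * N" by simp
      have "(?u z)\<^sup>2 \<le> S" unfolding S_def using z(1) Z(2) by (intro member_le_sum) auto
      moreover have "(?u x)\<^sup>2 \<le> 2 * (?u z)\<^sup>2 + 2 * (?u x - ?u z)\<^sup>2"
        using zero_le_power2[of "?u x - 2 * ?u z"] by (simp add: power2_eq_square algebra_simps)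
      ultimately show ?thesis using 1 by linarith
    qed
    define B where "B = 2 * (2 * S + 2 * (\<delta> / c)\<^sup>2 * m * N)"
    have B: "B \<ge> 0" unfolding B_def using S m N by (intro mult_nonneg_nonneg add_nonneg_nonneg) auto
    have [measurable]: "f \<in> borel_measurable borel" by (rule C1_measurable[OF C1])
    have [measurable]: "?u \<in> borel_measurable borel"
    proof -
      have [measurable]: "(\<lambda>(x, y). f (x + y)) \<in> borel_measurable (borel \<Otimes>\<^sub>M borel)" by measurable
      show ?thesis unfolding mollified_def by measurable
    qed
    have "ennreal N = (\<integral>\<^sup>+x. ennreal ((f x)\<^sup>2) \<partial>lborel)"
      using l2_nn_integral_square[OF C1_l2[OF C1]] by (simp add: N)
    also have "\<dots> \<le> (\<integral>\<^sup>+x. 2 * ennreal ((f x - ?u x)\<^sup>2) + ennreal B * indicator K x \<partial>lborel)"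
    proof (rule nn_integral_mono)
      fix x
      show "ennreal ((f x)\<^sup>2) \<le> 2 * ennreal ((f x - ?u x)\<^sup>2) + ennreal B * indicator K x"
      proof (cases "x \<in> K")
        case True
        have "(f x)\<^sup>2 \<le> 2 * (f x - ?u x)\<^sup>2 + 2 * (?u x)\<^sup>2"
          using zero_le_power2[of "f x - 2 * ?u x"] by (simp add: power2_eq_square algebra_simps)
        also have "2 * (?u x)\<^sup>2 \<le> B"
          unfolding B_def by (rule mult_left_mono[OF u_K[OF True]]) simp
        finally have "(f x)\<^sup>2 \<le> 2 * (f x - ?u x)\<^sup>2 + B" by simp
        hence "ennreal ((f x)\<^sup>2) \<le> ennreal (2 * (f x - ?u x)\<^sup>2 + B)" by (rule ennreal_leI)
        thus ?thesis using True B by (simp add: ennreal_plus ennreal_mult')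
      qed (simp add: C1_zero[OF C1])
    qed
    also have "\<dots> = 2 * (\<integral>\<^sup>+x. ennreal ((f x - ?u x)\<^sup>2) \<partial>lborel) + ennreal B * emeasure lborel K"
      using Km by (simp add: nn_integral_add nn_integral_cmult nn_integral_cmult_indicator)
    also have "\<dots> \<le> 2 * ennreal (r\<^sup>2 * grad_energy f) + ennreal B * ennreal m"
      using mollified_error_integral[OF C1 r(1)] Kfin
      by (intro add_mono mult_left_mono) (auto simp: m_def emeasure_eq_ennreal_measure)
    also have "\<dots> = ennreal (2 * (r\<^sup>2 * grad_energy f) + B * m)"
      using B m G by (simp add: ennreal_plus ennreal_mult')
    finally have "N \<le> 2 * (r\<^sup>2 * grad_energy f) + B * m"
      using B m G by (subst (asm) ennreal_le_iff) auto
    also have "B * m = 4 * m * S + 4 * (\<delta> * m / c)\<^sup>2 * N"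
      by (simp add: B_def power2_eq_square algebra_simps)
    also have "4 * (\<delta> * m / c)\<^sup>2 * N \<le> (1 / 2) * N"
    proof (rule mult_right_mono[OF _ N(2)])
      have "\<delta> * m / c = m / (3 * (m + 1))" using c by (simp add: \<delta>_def)
      also have "\<dots> \<le> 1 / 3" using m by (simp add: field_simps)
      finally have "(\<delta> * m / c)\<^sup>2 \<le> (1 / 3)\<^sup>2" using \<delta> m c by (intro power_mono) auto
      thus "4 * (\<delta> * m / c)\<^sup>2 \<le> 1 / 2" by (simp add: power2_eq_square)
    qed
    finally have "N \<le> 4 * r\<^sup>2 * grad_energy f + 8 * m * S" by simp
    also have "8 * m * S = C * (\<Sum>z\<in>Z. (LINT y|lborel. f y * tent r (y - z))\<^sup>2)"
      unfolding S_def mollified_eq_inner[OF C1 r(1)] c_def[symmetric] C_def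
      by (simp add: power_divide sum_divide_distrib[symmetric])
    finally show "(LINT x|lborel. (f x)\<^sup>2) \<le> \<epsilon> * (LINT x|lborel. (\<Sum>i\<in>UNIV. (partial_deriv i f x)\<^sup>2))
        + C * (\<Sum>z\<in>Z. (LINT y|lborel. f y * tent r (y - z))\<^sup>2)"
      unfolding r(2) N_def grad_energy_def .
  qed
qed

section \<open>Positive definite matrices\<close>

lemma det_nz_if_ker_trivial:
  fixes G :: "real^'n^'n"
  assumes "\<And>v. G *v v = 0 \<Longrightarrow> v = 0"
  shows "det G \<noteq> 0"
  using assms matrix_left_invertible_ker[of G] invertible_left_inverse[of G] invertible_det_nz[of G] by blast

text \<open>The segment from the identity to a positive definite matrix consists of invertible matrices,
  so the determinant cannot change sign along it.\<close>

lemma posdef_det_pos: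
  fixes G :: "real^'n^'n"
  assumes pos: "\<And>v. v \<noteq> 0 \<Longrightarrow> v \<bullet> (G *v v) > 0"
  shows "det G > 0"
proof (rule ccontr)
  assume neg: "\<not> det G > 0"
  define N where "N t = t *\<^sub>R G + (1 - t) *\<^sub>R mat 1" for t :: real
  have "N t *v v = t *\<^sub>R (G *v v) + (1 - t) *\<^sub>R v" for t v
    by (simp add: N_def matrix_vector_mult_add_rdistrib scaleR_matrix_vector_assoc[symmetric])
  hence quad: "v \<bullet> (N t *v v) = t * (v \<bullet> (G *v v)) + (1 - t) * (v \<bullet> v)" for t v
    by (simp add: inner_add_right)
  have nz: "det (N t) \<noteq> 0" if t: "0 \<le> t" "t \<le> 1" for t
  proof (rule det_nz_if_ker_trivial, rule ccontr)
    fix v assume v: "N t *v v = 0" "v \<noteq> 0"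
    have "0 < t * (v \<bullet> (G *v v)) + (1 - t) * (v \<bullet> v)"
    proof (cases "t = 0")
      case True thus ?thesis using v(2) by simp
    next
      case False
      hence "0 < t * (v \<bullet> (G *v v))" using t pos[OF v(2)] by simp
      moreover have "0 \<le> (1 - t) * (v \<bullet> v)" using t by simp
      ultimately show ?thesis by linarith
    qed
    thus False using v(1) quad[of v t] by simp
  qed
  have "Ck_on 0 UNIV (\<lambda>t. det (N t))"
  proof (rule Ck_on_det[OF open_UNIV])
    fix i j show "Ck_on 0 UNIV (\<lambda>t. N t $ i $ j)"
      by (auto simp: N_def intro!: continuous_intros)
  qed
  hence cont: "continuous_on {0..1} (\<lambda>t. det (N t))" by (auto intro: continuous_on_subset)
  have "det (N 0) = 1" "det (N 1) = det G" by (simp_all add: N_def)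
  with neg IVT2'[of "\<lambda>t. det (N t)" 1 0 0] cont obtain t where "0 \<le> t" "t \<le> 1" "det (N t) = 0" by auto
  thus False using nz by blast
qed

context
  fixes G :: "real^'n^'n"
  assumes sym: "transpose G = G" and pos: "\<And>v. v \<noteq> 0 \<Longrightarrow> v \<bullet> (G *v v) > 0"
begin

lemma posdef_inv_right: "G *v (matrix_inv G *v a) = a"
  using matrix_inv_mult(1)[of G] posdef_det_pos[OF pos] by (simp add: matrix_vector_mul_assoc)

lemma posdef_swap: "(G *v v) \<bullet> w = v \<bullet> (G *v w)"
proof -
  have "(G *v v) \<bullet> w = (transpose G *v v) \<bullet> w" by (simp only: sym)
  thus ?thesis by (simp add: dot_lmul_matrix)
qed

lemma posdef_inv_sym: "a \<bullet> (matrix_inv G *v b) = b \<bullet> (matrix_inv G *v a)"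
  by (metis posdef_inv_right posdef_swap inner_commute)

lemma posdef_nonneg: "0 \<le> v \<bullet> (G *v v)"
  using pos[of v] by (cases "v = 0") auto

lemma posdef_inv_nonneg: "0 \<le> a \<bullet> (matrix_inv G *v a)"
  using posdef_nonneg[of "matrix_inv G *v a"] by (simp add: posdef_inv_right inner_commute)

text \<open>The Cauchy--Schwarz inequality of the inner product \<open>G\<close> between \<open>a\<close> and \<open>G\<^sup>-\<^sup>1 a\<close>. It bounds the
  coordinate gradient by the Riemannian one in terms of the entries of the metric alone.\<close>

lemma norm_square_le_posdef_inv:
  assumes B: "\<And>i j. \<bar>G $ i $ j\<bar> \<le> B"
  shows "a \<bullet> a \<le> (real CARD('n))\<^sup>2 * B * (a \<bullet> (matrix_inv G *v a))"
proof -
  let ?w = "matrix_inv G *v a"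
  have "(a \<bullet> (G *v ?w))\<^sup>2 \<le> (a \<bullet> (G *v a)) * (?w \<bullet> (G *v ?w))"
  proof (rule nonneg_quadratic_discriminant)
    fix t
    have "0 \<le> (a - t *\<^sub>R ?w) \<bullet> (G *v (a - t *\<^sub>R ?w))" by (rule posdef_nonneg)
    also have "\<dots> = a \<bullet> (G *v a) - 2 * t * (a \<bullet> (G *v ?w)) + t\<^sup>2 * (?w \<bullet> (G *v ?w))"
      using posdef_swap[of a ?w]
      by (simp add: matrix_vector_mult_diff_distrib matrix_vector_mult_scaleR inner_diff_left inner_diff_right
          inner_commute power2_eq_square algebra_simps)
    finally show "0 \<le> a \<bullet> (G *v a) - 2 * t * (a \<bullet> (G *v ?w)) + t\<^sup>2 * (?w \<bullet> (G *v ?w))" .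
  qed (rule posdef_nonneg)
  hence 1: "(a \<bullet> a)\<^sup>2 \<le> (a \<bullet> (G *v a)) * (a \<bullet> ?w)"
    by (simp add: posdef_inv_right inner_commute)
  have "a \<bullet> (G *v a) = (\<Sum>i\<in>UNIV. \<Sum>j\<in>UNIV. a $ i * (G $ i $ j * a $ j))"
    by (simp add: inner_vec_def matrix_vector_mult_def sum_distrib_left)
  also have "\<dots> \<le> (\<Sum>i\<in>(UNIV::'n set). \<Sum>j\<in>(UNIV::'n set). B * (a \<bullet> a))"
  proof (intro sum_mono)
    fix i j
    have nn: "\<bar>a $ k\<bar> \<le> norm a" for k by (rule component_le_norm_cart)
    have "a $ i * (G $ i $ j * a $ j) \<le> \<bar>G $ i $ j\<bar> * (\<bar>a $ i\<bar> * \<bar>a $ j\<bar>)"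
      by (metis abs_ge_self abs_mult mult.left_commute)
    also have "\<dots> \<le> B * (norm a * norm a)"
      using B[of i j] nn order_trans[OF abs_ge_zero B] by (intro mult_mono) auto
    finally show "a $ i * (G $ i $ j * a $ j) \<le> B * (a \<bullet> a)" by (simp add: dot_square_norm power2_eq_square)
  qed
  also have "\<dots> = (real CARD('n))\<^sup>2 * B * (a \<bullet> a)" by (simp add: power2_eq_square)
  finally have 2: "a \<bullet> (G *v a) \<le> (real CARD('n))\<^sup>2 * B * (a \<bullet> a)" .
  show ?thesis
  proof (cases "a = 0")
    case False
    have "(a \<bullet> a) * (a \<bullet> a) \<le> (a \<bullet> (G *v a)) * (a \<bullet> ?w)" using 1 by (simp add: power2_eq_square)
    also have "\<dots> \<le> ((real CARD('n))\<^sup>2 * B * (a \<bullet> a)) * (a \<bullet> ?w)"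
      by (rule mult_right_mono[OF 2 posdef_inv_nonneg])
    also have "\<dots> = ((real CARD('n))\<^sup>2 * B * (a \<bullet> ?w)) * (a \<bullet> a)" by simp
    finally show ?thesis by (rule mult_right_le_imp_le) (use False in simp)
  qed simp
qed

end

section \<open>The spectral theorem for Friedrichs extensions with compact resolvent\<close>

text \<open>A densely defined nonnegative symmetric operator \<open>T\<close> whose form domain embeds compactly into \<open>L\<^sup>2\<close>.
  Compactness is stated as an inequality on the core \<open>D\<close>: up to an arbitrarily small multiple of the
  form norm, the \<open>L\<^sup>2\<close> norm is controlled by finitely many bounded functionals. Such an inequality passes
  to limits, can be glued along a partition of unity, and gives finite-dimensional eigenspaces by
  counting dimensions.\<close>

locale compact_form =
  fixes M :: "'m measure" and D :: "('m \<Rightarrow> real) set" and T :: "('m \<Rightarrow> real) \<Rightarrow> 'm \<Rightarrow> real"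
  assumes D: "l2_subspace M D"
    and T_l2: "\<phi> \<in> D \<Longrightarrow> T \<phi> \<in> l2_space M"
    and T_linear: "\<phi> \<in> D \<Longrightarrow> \<psi> \<in> D \<Longrightarrow> T (\<lambda>x. a * \<phi> x + b * \<psi> x) = (\<lambda>x. a * T \<phi> x + b * T \<psi> x)"
    and T_sym: "\<phi> \<in> D \<Longrightarrow> \<psi> \<in> D \<Longrightarrow> l2_inner M (T \<phi>) \<psi> = l2_inner M \<phi> (T \<psi>)"
    and T_nonneg: "\<phi> \<in> D \<Longrightarrow> 0 \<le> l2_inner M (T \<phi>) \<phi>"
    and dense: "f \<in> l2_space M \<Longrightarrow> (\<And>\<phi>. \<phi> \<in> D \<Longrightarrow> l2_inner M f \<phi> = 0) \<Longrightarrow> AE x in M. f x = 0"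
    and rellich: "\<epsilon> > 0 \<Longrightarrow> \<exists>G C. finite G \<and> G \<subseteq> l2_space M \<and>
       (\<forall>\<phi>\<in>D. l2_inner M \<phi> \<phi> \<le> \<epsilon> * (l2_inner M \<phi> \<phi> + l2_inner M (T \<phi>) \<phi>) + C * (\<Sum>g\<in>G. (l2_inner M g \<phi>)\<^sup>2))"
begin

abbreviation F :: "('m \<Rightarrow> real) \<Rightarrow> ('m \<Rightarrow> real) \<Rightarrow> bool" where
  "F \<equiv> friedrichs_extension M D T"

abbreviation q :: "('m \<Rightarrow> real) \<Rightarrow> ('m \<Rightarrow> real) \<Rightarrow> real" where
  "q \<phi> \<psi> \<equiv> l2_inner M (T \<phi>) \<psi>"

lemmas D_l2 = l2_subspaceD(1)[OF D]
lemmas D_lin = l2_subspaceD(3)[OF D]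
lemmas D_diff = l2_subspaceD(5)[OF D]

lemma q_sym: "\<phi> \<in> D \<Longrightarrow> \<psi> \<in> D \<Longrightarrow> q \<phi> \<psi> = q \<psi> \<phi>"
  using T_sym l2_inner_commute by metis

lemma T_diff: "\<phi> \<in> D \<Longrightarrow> \<psi> \<in> D \<Longrightarrow> T (\<lambda>x. \<phi> x - \<psi> x) = (\<lambda>x. T \<phi> x - T \<psi> x)"
  using T_linear[of \<phi> \<psi> 1 "-1"] by simp

lemma q_quadratic:
  assumes "\<phi> \<in> D" "\<psi> \<in> D"
  shows "q (\<lambda>x. a * \<phi> x + b * \<psi> x) (\<lambda>x. a * \<phi> x + b * \<psi> x) = a\<^sup>2 * q \<phi> \<phi> + 2 * a * b * q \<phi> \<psi> + b\<^sup>2 * q \<psi> \<psi>"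
  using assms q_sym[of \<psi> \<phi>] by (simp add: T_linear T_l2 D_l2 power2_eq_square algebra_simps)

lemma q_diff_square:
  assumes "\<phi> \<in> D" "\<psi> \<in> D"
  shows "q (\<lambda>x. \<phi> x - \<psi> x) (\<lambda>x. \<phi> x - \<psi> x) = q \<phi> \<phi> - 2 * q \<phi> \<psi> + q \<psi> \<psi>"
  using q_quadratic[OF assms, of 1 "-1"] by simp

lemma q_cauchy_schwarz:
  assumes "\<phi> \<in> D" "\<psi> \<in> D"
  shows "(q \<phi> \<psi>)\<^sup>2 \<le> q \<phi> \<phi> * q \<psi> \<psi>"
proof (rule nonneg_quadratic_discriminant)
  fix t
  have "0 \<le> q (\<lambda>x. 1 * \<phi> x + (- t) * \<psi> x) (\<lambda>x. 1 * \<phi> x + (- t) * \<psi> x)"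
    by (intro T_nonneg D_lin assms)
  also have "\<dots> = q \<phi> \<phi> - 2 * t * q \<phi> \<psi> + t\<^sup>2 * q \<psi> \<psi>"
    using q_quadratic[OF assms, of 1 "-t"] by simp
  finally show "0 \<le> q \<phi> \<phi> - 2 * t * q \<phi> \<psi> + t\<^sup>2 * q \<psi> \<psi>" .
qed (use T_nonneg assms in auto)

lemma q_cauchy_schwarz_sqrt:
  assumes "\<phi> \<in> D" "\<psi> \<in> D"
  shows "\<bar>q \<phi> \<psi>\<bar> \<le> sqrt (q \<phi> \<phi>) * sqrt (q \<psi> \<psi>)"
  using real_sqrt_le_mono[OF q_cauchy_schwarz[OF assms]] by (simp add: real_sqrt_mult)

lemma q_sqrt_triangle:
  assumes "\<phi> \<in> D" "\<psi> \<in> D"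
  shows "sqrt (q \<phi> \<phi>) \<le> sqrt (q \<psi> \<psi>) + sqrt (q (\<lambda>x. \<phi> x - \<psi> x) (\<lambda>x. \<phi> x - \<psi> x))"
proof (rule power2_le_imp_le)
  let ?d = "\<lambda>x. \<phi> x - \<psi> x"
  have d: "?d \<in> D" by (intro D_diff assms)
  have n: "0 \<le> q \<phi> \<phi>" "0 \<le> q \<psi> \<psi>" "0 \<le> q ?d ?d" by (intro T_nonneg assms d)+
  have "\<phi> = (\<lambda>x. 1 * ?d x + 1 * \<psi> x)" by auto
  hence "q \<phi> \<phi> = q ?d ?d + 2 * q ?d \<psi> + q \<psi> \<psi>"
    using q_quadratic[OF d assms(2), of 1 1] by simp
  also have "q ?d \<psi> \<le> sqrt (q ?d ?d) * sqrt (q \<psi> \<psi>)" using q_cauchy_schwarz_sqrt[OF d assms(2)] by linarith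
  finally show "(sqrt (q \<phi> \<phi>))\<^sup>2 \<le> (sqrt (q \<psi> \<psi>) + sqrt (q ?d ?d))\<^sup>2"
    using n by (simp add: power2_sum mult_ac)
  show "0 \<le> sqrt (q \<psi> \<psi>) + sqrt (q ?d ?d)" using n by simp
qed

definition form_cauchy :: "(nat \<Rightarrow> 'm \<Rightarrow> real) \<Rightarrow> bool" where
  "form_cauchy w \<longleftrightarrow> (\<forall>n. w n \<in> D) \<and> (\<forall>\<epsilon>>0. \<exists>N. \<forall>m\<ge>N. \<forall>n\<ge>N.
           q (\<lambda>x. w m x - w n x) (\<lambda>x. w m x - w n x) < \<epsilon>)"

lemma F_iff:
  "F u f \<longleftrightarrow> u \<in> l2_space M \<and> f \<in> l2_space M \<and>
     (\<exists>w. form_cauchy w \<and> (\<lambda>n. l2_norm M (\<lambda>x. w n x - u x)) \<longlonglongrightarrow> 0) \<and>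
     (\<forall>\<phi>\<in>D. l2_inner M u (T \<phi>) = l2_inner M f \<phi>)"
  unfolding friedrichs_extension_def form_cauchy_def by meson

lemma form_cauchy_bounded:
  assumes w: "form_cauchy w"
  obtains B where "B > 0" "\<And>n. sqrt (q (w n) (w n)) \<le> B"
proof -
  obtain N where N: "\<And>m n. m \<ge> N \<Longrightarrow> n \<ge> N \<Longrightarrow> q (\<lambda>x. w m x - w n x) (\<lambda>x. w m x - w n x) < 1"
    using w unfolding form_cauchy_def by (meson zero_less_one)
  have wD: "w n \<in> D" for n using w by (simp add: form_cauchy_def)
  define B where "B = (\<Sum>n\<le>N. sqrt (q (w n) (w n))) + 1"
  have le: "sqrt (q (w n) (w n)) \<le> (\<Sum>n\<le>N. sqrt (q (w n) (w n)))" if "n \<le> N" for n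
    using that wD by (intro member_le_sum) (auto intro!: T_nonneg)
  have "sqrt (q (w n) (w n)) \<le> B" for n
  proof (cases "n \<le> N")
    case True thus ?thesis using le[OF True] by (simp add: B_def)
  next
    case False
    have "sqrt (q (w n) (w n)) \<le> sqrt (q (w N) (w N)) + sqrt (q (\<lambda>x. w n x - w N x) (\<lambda>x. w n x - w N x))"
      by (rule q_sqrt_triangle[OF wD wD])
    also have "sqrt (q (\<lambda>x. w n x - w N x) (\<lambda>x. w n x - w N x)) \<le> 1"
      using N[of n N] False by simp
    finally show ?thesis using le[of N] by (simp add: B_def)
  qed
  moreover have "B > 0" using le[of 0] T_nonneg[OF wD, of 0] unfolding B_def
    by (smt (verit) real_sqrt_ge_0_iff zero_le)
  ultimately show ?thesis using that by blast
qed

text \<open>Passing to the limit in one argument of the form costs only the distance in the form norm;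
  this is where being Cauchy for the form, and not only in \<open>L\<^sup>2\<close>, is used.\<close>

lemma form_limit:
  assumes w: "form_cauchy w" and u: "u \<in> l2_space M" "(\<lambda>n. l2_norm M (\<lambda>x. w n x - u x)) \<longlonglongrightarrow> 0"
    and z: "form_cauchy z"
  shows "(\<lambda>n. l2_inner M u (T (z n)) - q (w n) (z n)) \<longlonglongrightarrow> 0"
proof (rule LIMSEQ_I)
  fix r :: real assume "r > 0"
  obtain B where B: "B > 0" "\<And>n. sqrt (q (z n) (z n)) \<le> B" using form_cauchy_bounded[OF z] by blast
  have wD: "w n \<in> D" and zD: "z n \<in> D" for n using w z by (auto simp: form_cauchy_def)
  define \<delta> where "\<delta> = (r / (2 * B))\<^sup>2"
  have "\<delta> > 0" using B \<open>r > 0\<close> by (simp add: \<delta>_def)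
  then obtain N where N: "\<And>m n. m \<ge> N \<Longrightarrow> n \<ge> N \<Longrightarrow> q (\<lambda>x. w m x - w n x) (\<lambda>x. w m x - w n x) < \<delta>"
    using w unfolding form_cauchy_def by meson
  have "\<bar>l2_inner M u (T (z n)) - q (w n) (z n)\<bar> \<le> r / 2" if n: "n \<ge> N" for n
  proof (rule LIMSEQ_le_const2)
    have "(\<lambda>m. l2_inner M (w m) (T (z n))) \<longlonglongrightarrow> l2_inner M u (T (z n))"
      by (rule l2_inner_tendsto) (use wD zD D_l2 T_l2 u in auto)
    thus "(\<lambda>m. \<bar>l2_inner M (w m) (T (z n)) - q (w n) (z n)\<bar>) \<longlonglongrightarrow> \<bar>l2_inner M u (T (z n)) - q (w n) (z n)\<bar>"
      by (intro tendsto_intros)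
    show "\<exists>N'. \<forall>m\<ge>N'. \<bar>l2_inner M (w m) (T (z n)) - q (w n) (z n)\<bar> \<le> r / 2"
    proof (intro exI[of _ N] allI impI)
      fix m assume m: "m \<ge> N"
      let ?d = "\<lambda>x. w m x - w n x"
      have d: "?d \<in> D" by (intro D_diff wD)
      have "l2_inner M (w m) (T (z n)) - q (w n) (z n) = q ?d (z n)"
        using wD zD by (simp add: T_diff T_l2 D_l2 flip: T_sym)
      also have "\<bar>\<dots>\<bar> \<le> sqrt (q ?d ?d) * sqrt (q (z n) (z n))" by (rule q_cauchy_schwarz_sqrt[OF d zD])
      also have "\<dots> \<le> sqrt \<delta> * B"
        using N[OF m n] B T_nonneg[OF d] T_nonneg[OF zD] \<open>\<delta> > 0\<close> by (intro mult_mono) (auto intro: less_imp_le)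
      also have "\<dots> = r / 2" using B \<open>r > 0\<close> by (simp add: \<delta>_def real_sqrt_abs)
      finally show "\<bar>l2_inner M (w m) (T (z n)) - q (w n) (z n)\<bar> \<le> r / 2" .
    qed
  qed
  thus "\<exists>N. \<forall>n\<ge>N. norm (l2_inner M u (T (z n)) - q (w n) (z n) - 0) < r"
    using \<open>r > 0\<close> by (intro exI[of _ N]) force
qed

text \<open>Both sides are limits of the form evaluated on approximating sequences of \<open>u\<close> and \<open>v\<close>.\<close>

lemma F_symmetric:
  assumes uf: "F u f" and vh: "F v h"
  shows "l2_inner M f v = l2_inner M u h"
proof -
  obtain w where w: "form_cauchy w" "(\<lambda>n. l2_norm M (\<lambda>x. w n x - u x)) \<longlonglongrightarrow> 0"
    using uf F_iff by blast
  obtain z where z: "form_cauchy z" "(\<lambda>n. l2_norm M (\<lambda>x. z n x - v x)) \<longlonglongrightarrow> 0"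
    using vh F_iff by blast
  have wD: "w n \<in> D" and zD: "z n \<in> D" for n using w z by (auto simp: form_cauchy_def)
  have L2: "u \<in> l2_space M" "f \<in> l2_space M" "v \<in> l2_space M" "h \<in> l2_space M"
    using uf vh F_iff by auto
  have "(\<lambda>n. l2_inner M (z n) f) \<longlonglongrightarrow> l2_inner M v f"
    by (rule l2_inner_tendsto) (use zD D_l2 L2 z in auto)
  hence 1: "(\<lambda>n. l2_inner M u (T (z n))) \<longlonglongrightarrow> l2_inner M f v"
    using uf zD unfolding F_iff by (simp add: l2_inner_commute)
  have "(\<lambda>n. l2_inner M (w n) h) \<longlonglongrightarrow> l2_inner M u h"
    by (rule l2_inner_tendsto) (use wD D_l2 L2 w in auto)
  hence 2: "(\<lambda>n. l2_inner M v (T (w n))) \<longlonglongrightarrow> l2_inner M u h"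
    using vh wD unfolding F_iff by (simp add: l2_inner_commute)
  have 3: "(\<lambda>n. l2_inner M u (T (z n)) - q (w n) (z n)) \<longlonglongrightarrow> 0"
    by (rule form_limit) (use w z L2 in auto)
  have 4: "(\<lambda>n. l2_inner M v (T (w n)) - q (w n) (z n)) \<longlonglongrightarrow> 0"
    using form_limit[OF z(1) L2(3) z(2) w(1)] q_sym[OF wD zD] by simp
  have "(\<lambda>n. l2_inner M u (T (z n)) - l2_inner M v (T (w n))) \<longlonglongrightarrow> 0"
    using tendsto_diff[OF 3 4] by simp
  with tendsto_diff[OF 1 2] have "l2_inner M f v - l2_inner M u h = 0"
    using LIMSEQ_unique by blast
  thus ?thesis by simp
qed

text \<open>The form values converge along the approximating sequence. Inequalities for the form on \<open>D\<close> thus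
  extend to the domain of the Friedrichs extension.\<close>

lemma F_approximants:
  assumes uf: "F u f"
  obtains w where "\<And>n. w n \<in> D" "(\<lambda>n. l2_norm M (\<lambda>x. w n x - u x)) \<longlonglongrightarrow> 0"
    "(\<lambda>n. q (w n) (w n)) \<longlonglongrightarrow> l2_inner M f u"
proof -
  obtain w where w: "form_cauchy w" "(\<lambda>n. l2_norm M (\<lambda>x. w n x - u x)) \<longlonglongrightarrow> 0"
    using uf F_iff by blast
  have wD: "w n \<in> D" for n using w by (auto simp: form_cauchy_def)
  have L2: "u \<in> l2_space M" "f \<in> l2_space M" using uf F_iff by auto
  have "(\<lambda>n. l2_inner M (w n) f) \<longlonglongrightarrow> l2_inner M u f"
    by (rule l2_inner_tendsto) (use wD D_l2 L2 w in auto)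
  hence "(\<lambda>n. l2_inner M u (T (w n))) \<longlonglongrightarrow> l2_inner M f u"
    using uf wD unfolding F_iff by (simp add: l2_inner_commute)
  from tendsto_diff[OF this form_limit[OF w(1) L2(1) w(2) w(1)]]
  have "(\<lambda>n. q (w n) (w n)) \<longlonglongrightarrow> l2_inner M f u" by simp
  with wD w(2) show ?thesis by (rule that)
qed

lemma F_nonneg: "F u f \<Longrightarrow> 0 \<le> l2_inner M f u"
  by (erule F_approximants) (rule LIMSEQ_le_const, assumption, use T_nonneg in blast)

lemma form_cauchy_lin:
  assumes w: "form_cauchy w" and z: "form_cauchy z"
  shows "form_cauchy (\<lambda>n x. a * w n x + b * z n x)"
  unfolding form_cauchy_def
proof (intro conjI allI impI)
  have wD: "w n \<in> D" and zD: "z n \<in> D" for n using w z by (auto simp: form_cauchy_def)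
  show "(\<lambda>x. a * w n x + b * z n x) \<in> D" for n using wD zD by (rule D_lin)
  fix e :: real assume "e > 0"
  define \<delta> where "\<delta> = e / (4 * (a\<^sup>2 + b\<^sup>2 + 1))"
  have ab: "a\<^sup>2 + b\<^sup>2 + 1 > 0" by (simp add: add_nonneg_pos)
  have \<delta>: "\<delta> > 0" using \<open>e > 0\<close> ab by (simp add: \<delta>_def)
  obtain N1 where N1: "\<And>m n. m \<ge> N1 \<Longrightarrow> n \<ge> N1 \<Longrightarrow> q (\<lambda>x. w m x - w n x) (\<lambda>x. w m x - w n x) < \<delta>"
    using w \<delta> unfolding form_cauchy_def by meson
  obtain N2 where N2: "\<And>m n. m \<ge> N2 \<Longrightarrow> n \<ge> N2 \<Longrightarrow> q (\<lambda>x. z m x - z n x) (\<lambda>x. z m x - z n x) < \<delta>"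
    using z \<delta> unfolding form_cauchy_def by meson
  show "\<exists>N. \<forall>m\<ge>N. \<forall>n\<ge>N. q (\<lambda>x. a * w m x + b * z m x - (a * w n x + b * z n x))
      (\<lambda>x. a * w m x + b * z m x - (a * w n x + b * z n x)) < e"
  proof (intro exI[of _ "max N1 N2"] allI impI)
    fix m n assume mn: "max N1 N2 \<le> m" "max N1 N2 \<le> n"
    let ?d = "\<lambda>x. w m x - w n x" and ?e = "\<lambda>x. z m x - z n x"
    have d: "?d \<in> D" and ee: "?e \<in> D" by (intro D_diff wD zD)+
    have eq: "(\<lambda>x. a * w m x + b * z m x - (a * w n x + b * z n x)) = (\<lambda>x. a * ?d x + b * ?e x)"
      by (auto simp: algebra_simps)
    have "0 \<le> q (\<lambda>x. a * ?d x + (-b) * ?e x) (\<lambda>x. a * ?d x + (-b) * ?e x)"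
      by (intro T_nonneg D_lin d ee)
    hence "2 * a * b * q ?d ?e \<le> a\<^sup>2 * q ?d ?d + b\<^sup>2 * q ?e ?e"
      unfolding q_quadratic[OF d ee] by simp
    hence "q (\<lambda>x. a * ?d x + b * ?e x) (\<lambda>x. a * ?d x + b * ?e x) \<le> 2 * (a\<^sup>2 * q ?d ?d + b\<^sup>2 * q ?e ?e)"
      unfolding q_quadratic[OF d ee] by simp
    also have "\<dots> \<le> 2 * (a\<^sup>2 * \<delta> + b\<^sup>2 * \<delta>)"
      using N1[of m n] N2[of m n] mn by (intro mult_left_mono add_mono) auto
    also have "\<dots> \<le> e / 2"
    proof -
      have "2 * (a\<^sup>2 * \<delta> + b\<^sup>2 * \<delta>) = (a\<^sup>2 + b\<^sup>2) * (2 * \<delta>)" by (simp add: algebra_simps)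
      also have "\<dots> \<le> (a\<^sup>2 + b\<^sup>2 + 1) * (2 * \<delta>)" using \<delta> by (intro mult_right_mono) auto
      also have "\<dots> = e / 2" using ab unfolding \<delta>_def by (simp add: field_simps)
      finally show ?thesis .
    qed
    finally show "q (\<lambda>x. a * w m x + b * z m x - (a * w n x + b * z n x))
      (\<lambda>x. a * w m x + b * z m x - (a * w n x + b * z n x)) < e"
      unfolding eq using \<open>e > 0\<close> by linarith
  qed
qed

lemma F_linear:
  assumes uf: "F u f" and vh: "F v h"
  shows "F (\<lambda>x. a * u x + b * v x) (\<lambda>x. a * f x + b * h x)"
proof -
  obtain w where w: "form_cauchy w" "(\<lambda>n. l2_norm M (\<lambda>x. w n x - u x)) \<longlonglongrightarrow> 0"
    using uf F_iff by blast
  obtain z where z: "form_cauchy z" "(\<lambda>n. l2_norm M (\<lambda>x. z n x - v x)) \<longlonglongrightarrow> 0"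
    using vh F_iff by blast
  have wD: "w n \<in> D" and zD: "z n \<in> D" for n using w z by (auto simp: form_cauchy_def)
  have L2: "u \<in> l2_space M" "f \<in> l2_space M" "v \<in> l2_space M" "h \<in> l2_space M"
    using uf vh F_iff by auto
  have "(\<lambda>n. l2_norm M (\<lambda>x. (a * w n x + b * z n x) - (a * u x + b * v x))) \<longlonglongrightarrow> 0"
  proof (rule Lim_null_comparison)
    show "(\<lambda>n. \<bar>a\<bar> * l2_norm M (\<lambda>x. w n x - u x) + \<bar>b\<bar> * l2_norm M (\<lambda>x. z n x - v x)) \<longlonglongrightarrow> 0"
      using tendsto_add[OF tendsto_mult_right_zero[OF w(2)] tendsto_mult_right_zero[OF z(2)]] by simp
    have "l2_norm M (\<lambda>x. (a * w n x + b * z n x) - (a * u x + b * v x))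
       \<le> \<bar>a\<bar> * l2_norm M (\<lambda>x. w n x - u x) + \<bar>b\<bar> * l2_norm M (\<lambda>x. z n x - v x)" for n
    proof -
      have "(\<lambda>x. (a * w n x + b * z n x) - (a * u x + b * v x)) = (\<lambda>x. a * (w n x - u x) + b * (z n x - v x))"
        by (auto simp: algebra_simps)
      thus ?thesis
        using l2_norm_triangle[of "\<lambda>x. a * (w n x - u x)" M "\<lambda>x. b * (z n x - v x)"] wD zD D_l2 L2
        by (simp only: l2_norm_scale l2_space_scale l2_space_diff simp_thms)
    qed
    thus "\<forall>\<^sub>F n in sequentially. norm (l2_norm M (\<lambda>x. a * w n x + b * z n x - (a * u x + b * v x)))
        \<le> \<bar>a\<bar> * l2_norm M (\<lambda>x. w n x - u x) + \<bar>b\<bar> * l2_norm M (\<lambda>x. z n x - v x)"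
      by simp
  qed
  moreover have "l2_inner M (\<lambda>x. a * u x + b * v x) (T \<phi>) = l2_inner M (\<lambda>x. a * f x + b * h x) \<phi>" if "\<phi> \<in> D" for \<phi>
    using uf vh that D_l2[OF that] T_l2[OF that] unfolding F_iff by simp
  ultimately show ?thesis using form_cauchy_lin[OF w(1) z(1)] L2 unfolding F_iff by auto
qed

text \<open>Limits in \<open>L\<^sup>2\<close> are determined up to null sets only, so an eigenvector that is found as a limit at
  first satisfies its equation only almost everywhere.\<close>

lemma F_AE_cong:
  assumes uf: "F u f" and h: "h \<in> l2_space M" "AE x in M. f x = h x"
  shows "F u h"
proof -
  have "l2_inner M f \<phi> = l2_inner M h \<phi>" if "\<phi> \<in> D" for \<phi>
    using uf h that by (intro l2_inner_AE_cong l2_space_measurable) (auto simp: F_iff D_l2)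
  thus ?thesis using uf h(1) by (auto simp: F_iff)
qed

section \<open>The resolvent\<close>

text \<open>The direct method. The functional \<open>\<phi> \<mapsto> q \<phi> \<phi> + \<langle>\<phi>, \<phi>\<rangle> - 2 \<langle>f, \<phi>\<rangle>\<close> is bounded below on \<open>D\<close>. By the
  parallelogram law a minimising sequence is Cauchy for the form and in \<open>L\<^sup>2\<close>, so that its limit lies in
  the form domain, and near-minimality gives the Euler--Lagrange equation \<open>T u + u = f\<close> in the limit.\<close>

lemma resolvent_exists:
  assumes f: "f \<in> l2_space M"
  shows "\<exists>u. F u (\<lambda>x. f x - u x)"
proof -
  define J where "J \<phi> = q \<phi> \<phi> + l2_inner M \<phi> \<phi> - 2 * l2_inner M f \<phi>" for \<phi>
  have J_lower: "- l2_inner M f f \<le> J \<phi>" if "\<phi> \<in> D" for \<phi>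
  proof -
    have "0 \<le> (l2_norm M (\<lambda>x. f x - \<phi> x))\<^sup>2" by simp
    also have "\<dots> = l2_inner M f f - 2 * l2_inner M f \<phi> + l2_inner M \<phi> \<phi>"
      using l2_norm_diff_square[OF f D_l2[OF that]] by (simp add: l2_norm_square)
    finally show ?thesis using T_nonneg[OF that] by (simp add: J_def)
  qed
  define I where "I = Inf (J ` D)"
  have bdd: "bdd_below (J ` D)" using J_lower by (intro bdd_belowI2)
  have ne: "J ` D \<noteq> {}" using l2_subspaceD(2)[OF D] by auto
  have I_le: "I \<le> J \<phi>" if "\<phi> \<in> D" for \<phi>
    unfolding I_def using that by (intro cInf_lower bdd) auto
  have "\<exists>\<phi>\<in>D. J \<phi> < I + 1 / real (Suc n)" for n
    using cInf_lessD[OF ne, of "I + 1 / real (Suc n)"] by (auto simp: I_def)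
  then obtain w where wD: "\<And>n. w n \<in> D" and wJ: "\<And>n. J (w n) < I + 1 / real (Suc n)" by metis
  have wL: "w n \<in> l2_space M" for n by (intro D_l2 wD)
  have J_quad: "J (\<lambda>x. a * \<phi> x + b * \<psi> x) = a\<^sup>2 * (q \<phi> \<phi> + l2_inner M \<phi> \<phi>)
     + 2 * a * b * (q \<phi> \<psi> + l2_inner M \<phi> \<psi>) + b\<^sup>2 * (q \<psi> \<psi> + l2_inner M \<psi> \<psi>)
     - 2 * a * l2_inner M f \<phi> - 2 * b * l2_inner M f \<psi>" if "\<phi> \<in> D" "\<psi> \<in> D" for \<phi> \<psi> a b
    unfolding J_def q_quadratic[OF that]
    using D_l2[OF that(1)] D_l2[OF that(2)] f l2_inner_commute[of M \<psi> \<phi>]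
    by (simp add: power2_eq_square algebra_simps)
  have parallelogram: "q (\<lambda>x. w m x - w n x) (\<lambda>x. w m x - w n x) + (l2_norm M (\<lambda>x. w m x - w n x))\<^sup>2
      \<le> 2 / real (Suc m) + 2 / real (Suc n)" for m n
  proof -
    have "I \<le> J (\<lambda>x. (1/2) * w m x + (1/2) * w n x)" by (intro I_le D_lin wD)
    also have "\<dots> = (1/4) * (q (w m) (w m) + l2_inner M (w m) (w m)) + (1/2) * (q (w m) (w n) + l2_inner M (w m) (w n))
        + (1/4) * (q (w n) (w n) + l2_inner M (w n) (w n)) - l2_inner M f (w m) - l2_inner M f (w n)"
      unfolding J_quad[OF wD wD] by (simp add: power2_eq_square)
    finally have 1: "I \<le> \<dots>" .
    have "q (\<lambda>x. w m x - w n x) (\<lambda>x. w m x - w n x) + (l2_norm M (\<lambda>x. w m x - w n x))\<^sup>2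
      = q (w m) (w m) - 2 * q (w m) (w n) + q (w n) (w n) + l2_inner M (w m) (w m) - 2 * l2_inner M (w m) (w n) + l2_inner M (w n) (w n)"
      unfolding q_diff_square[OF wD wD] l2_norm_diff_square[OF wL wL] by (simp add: l2_norm_square)
    also have "\<dots> \<le> 2 * J (w m) + 2 * J (w n) - 4 * I"
      using 1 unfolding J_def by argo
    also have "\<dots> \<le> 2 / real (Suc m) + 2 / real (Suc n)" using wJ[of m] wJ[of n] by simp
    finally show ?thesis .
  qed
  have small: "\<exists>N. \<forall>m\<ge>N. \<forall>n\<ge>N. 2 / real (Suc m) + 2 / real (Suc n) < e" if e: "e > 0" for e
  proof -
    obtain N where N: "inverse (real (Suc N)) < e / 4" using reals_Archimedean[of "e/4"] e by auto
    have "2 / real (Suc m) < e / 2" if "m \<ge> N" for m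
    proof -
      have "inverse (real (Suc m)) \<le> inverse (real (Suc N))" using that by (intro le_imp_inverse_le) auto
      thus ?thesis using N unfolding divide_inverse[of 2] by linarith
    qed
    thus ?thesis by (intro exI[of _ N] allI impI) (metis add_strict_mono field_sum_of_halves)
  qed
  have form: "form_cauchy w" unfolding form_cauchy_def
  proof (intro conjI allI impI wD)
    fix e :: real assume "e > 0"
    with small obtain N where N: "\<And>m n. m \<ge> N \<Longrightarrow> n \<ge> N \<Longrightarrow> 2 / real (Suc m) + 2 / real (Suc n) < e" by blast
    show "\<exists>N. \<forall>m\<ge>N. \<forall>n\<ge>N. q (\<lambda>x. w m x - w n x) (\<lambda>x. w m x - w n x) < e"
    proof (intro exI[of _ N] allI impI)
      fix m n assume "N \<le> m" "N \<le> n"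
      thus "q (\<lambda>x. w m x - w n x) (\<lambda>x. w m x - w n x) < e"
        using N[of m n] parallelogram[of m n] zero_le_power2[of "l2_norm M (\<lambda>x. w m x - w n x)"] by linarith
    qed
  qed
  have L2_cauchy: "\<exists>N. \<forall>m\<ge>N. \<forall>n\<ge>N. l2_norm M (\<lambda>x. w m x - w n x) < e" if e: "e > 0" for e
  proof -
    from small[of "e\<^sup>2"] e obtain N where N: "\<And>m n. m \<ge> N \<Longrightarrow> n \<ge> N \<Longrightarrow> 2 / real (Suc m) + 2 / real (Suc n) < e\<^sup>2" by auto
    have "(l2_norm M (\<lambda>x. w m x - w n x))\<^sup>2 < e\<^sup>2" if "m \<ge> N" "n \<ge> N" for m n
      using N[OF that] parallelogram[of m n] T_nonneg[OF D_diff[OF wD wD], of m n] by linarith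
    thus ?thesis using \<open>e > 0\<close> by (intro exI[of _ N]) (auto intro: power2_less_imp_less)
  qed
  obtain u where u: "u \<in> l2_space M" "(\<lambda>n. l2_norm M (\<lambda>x. w n x - u x)) \<longlonglongrightarrow> 0"
  proof (rule l2_complete[of w M])
    show "w n \<in> l2_space M" for n by (rule wL)
    show "\<exists>N. \<forall>m\<ge>N. \<forall>n\<ge>N. l2_norm M (\<lambda>x. w m x - w n x) < e" if "e > 0" for e
      using that by (rule L2_cauchy)
  qed auto
  have "l2_inner M u (T \<phi>) = l2_inner M (\<lambda>x. f x - u x) \<phi>" if \<phi>: "\<phi> \<in> D" for \<phi>
  proof -
    note L = D_l2[OF \<phi>] T_l2[OF \<phi>]
    \<comment> \<open>\<open>a n\<close> is half the derivative of \<open>J\<close> at \<open>w n\<close> in the direction \<open>\<phi>\<close>. A quadratic polynomial that is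
      nearly minimal at 0 has a small linear coefficient.\<close>
    define a where "a n = q (w n) \<phi> + l2_inner M (w n) \<phi> - l2_inner M f \<phi>" for n
    define K where "K = q \<phi> \<phi> + l2_inner M \<phi> \<phi>"
    have "K \<ge> 0" unfolding K_def using T_nonneg[OF \<phi>] l2_inner_self_nonneg[of M \<phi>] by simp
    have sq: "(a n)\<^sup>2 \<le> (1 / real (Suc n)) * K" for n
    proof (rule nonneg_quadratic_discriminant)
      fix t
      have "I \<le> J (\<lambda>x. 1 * w n x + (- t) * \<phi> x)" by (intro I_le D_lin wD \<phi>)
      also have "\<dots> = J (w n) - 2 * t * a n + t\<^sup>2 * K"
        unfolding J_quad[OF wD \<phi>] by (simp add: J_def a_def K_def algebra_simps)
      finally show "0 \<le> 1 / real (Suc n) - 2 * t * a n + t\<^sup>2 * K" using wJ[of n] by linarith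
    qed fact
    have "(\<lambda>n. (1 / real (Suc n)) * K) \<longlonglongrightarrow> 0"
      using tendsto_mult_left_zero[OF LIMSEQ_inverse_real_of_nat, of K] by (simp add: inverse_eq_divide)
    hence "(\<lambda>n. (a n)\<^sup>2) \<longlonglongrightarrow> 0"
      by (rule Lim_null_comparison[rotated]) (use sq in simp)
    from tendsto_real_sqrt[OF this] have "(\<lambda>n. \<bar>a n\<bar>) \<longlonglongrightarrow> 0" by simp
    hence a0: "a \<longlonglongrightarrow> 0" by (rule tendsto_rabs_zero_cancel)
    have "(\<lambda>n. l2_inner M (w n) (T \<phi>) + l2_inner M (w n) \<phi> - l2_inner M f \<phi>)
       \<longlonglongrightarrow> l2_inner M u (T \<phi>) + l2_inner M u \<phi> - l2_inner M f \<phi>"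
      by (intro tendsto_add tendsto_diff tendsto_const l2_inner_tendsto wL u L)
    moreover have "(\<lambda>n. l2_inner M (w n) (T \<phi>) + l2_inner M (w n) \<phi> - l2_inner M f \<phi>) = a"
      by (auto simp: a_def T_sym[OF wD \<phi>])
    ultimately have "l2_inner M u (T \<phi>) + l2_inner M u \<phi> - l2_inner M f \<phi> = 0"
      using a0 LIMSEQ_unique by metis
    thus ?thesis using f u L by simp
  qed
  thus ?thesis using form u f unfolding F_iff by (intro exI[of _ u]) auto
qed

definition R :: "('m \<Rightarrow> real) \<Rightarrow> 'm \<Rightarrow> real" where
  "R f = (SOME u. F u (\<lambda>x. f x - u x))"

lemma F_R: "f \<in> l2_space M \<Longrightarrow> F (R f) (\<lambda>x. f x - R f x)"
  unfolding R_def using resolvent_exists by (rule someI_ex)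

lemma F_l2: "F u f \<Longrightarrow> u \<in> l2_space M" "F u f \<Longrightarrow> f \<in> l2_space M"
  by (auto simp: F_iff)

lemma F_diff: "F u f \<Longrightarrow> F v h \<Longrightarrow> F (\<lambda>x. u x - v x) (\<lambda>x. f x - h x)"
  using F_linear[of u f v h 1 "-1"] by simp

lemma R_l2: "f \<in> l2_space M \<Longrightarrow> R f \<in> l2_space M"
  using F_R F_l2 by blast

lemma R_symmetric:
  assumes "f \<in> l2_space M" "h \<in> l2_space M"
  shows "l2_inner M (R f) h = l2_inner M f (R h)"
  using F_symmetric[OF F_R[OF assms(1)] F_R[OF assms(2)]] assms R_l2[OF assms(1)] R_l2[OF assms(2)] by simp

text \<open>Since \<open>T (R f) = f - R f\<close>, the difference of the two sides is the form of \<open>T\<close> at \<open>R f\<close>.\<close>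

lemma R_coercive:
  assumes f: "f \<in> l2_space M"
  shows "(l2_norm M (R f))\<^sup>2 \<le> l2_inner M (R f) f"
  using F_nonneg[OF F_R[OF f]] f R_l2[OF f] l2_inner_commute[of M f] by (simp add: l2_norm_square)

lemma R_nonneg: "f \<in> l2_space M \<Longrightarrow> 0 \<le> l2_inner M (R f) f"
  using R_coercive[of f] by (smt (verit) zero_le_power2)

lemma R_contraction:
  assumes f: "f \<in> l2_space M"
  shows "l2_norm M (R f) \<le> l2_norm M f"
proof (cases "l2_norm M (R f) = 0")
  case False
  have "l2_norm M (R f) * l2_norm M (R f) \<le> l2_norm M (R f) * l2_norm M f"
    using R_coercive[OF f] l2_cauchy_schwarz[OF R_l2[OF f] f] by (simp add: power2_eq_square)
  thus ?thesis using False l2_norm_nonneg[of M "R f"] by (simp add: less_eq_real_def mult_le_cancel_left)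
qed simp

lemma R_diff_contraction:
  assumes f: "f \<in> l2_space M" and h: "h \<in> l2_space M"
  shows "l2_norm M (\<lambda>x. R f x - R h x) \<le> l2_norm M (\<lambda>x. f x - h x)"
proof -
  let ?d = "\<lambda>x. R f x - R h x" and ?e = "\<lambda>x. f x - h x"
  note L = R_l2[OF f] R_l2[OF h]
  have d: "?d \<in> l2_space M" and e: "?e \<in> l2_space M" using f h L by auto
  have "l2_norm M ?d * l2_norm M ?d = l2_inner M ?e (R ?d)"
    using L f h R_l2[OF d] R_symmetric[OF f d] R_symmetric[OF h d]
    by (simp flip: power2_eq_square add: l2_norm_square)
  also have "\<dots> \<le> l2_norm M ?e * l2_norm M (R ?d)"
    using l2_cauchy_schwarz[OF e R_l2[OF d]] by linarith
  also have "\<dots> \<le> l2_norm M ?e * l2_norm M ?d" by (intro mult_left_mono R_contraction d) simp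
  finally have le: "l2_norm M ?d * l2_norm M ?d \<le> l2_norm M ?e * l2_norm M ?d" .
  show ?thesis
  proof (cases "l2_norm M ?d = 0")
    case False
    hence "0 < l2_norm M ?d" using l2_norm_nonneg[of M ?d] by linarith
    with le show ?thesis by (rule mult_right_le_imp_le)
  qed simp
qed

text \<open>If \<open>R f\<close> vanishes, the weak equation says that \<open>f\<close> is orthogonal to the dense set \<open>D\<close>.\<close>

lemma R_injective:
  assumes f: "f \<in> l2_space M" and 0: "l2_norm M (R f) = 0"
  shows "AE x in M. f x = 0"
proof (rule dense[OF f])
  fix \<phi> assume \<phi>: "\<phi> \<in> D"
  note L = R_l2[OF f] D_l2[OF \<phi>] T_l2[OF \<phi>]
  have z: "l2_inner M (R f) g = 0" if "g \<in> l2_space M" for g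
    using l2_cauchy_schwarz[OF L(1) that] 0 by simp
  have "l2_inner M (R f) (T \<phi>) = l2_inner M (\<lambda>x. f x - R f x) \<phi>"
    using F_R[OF f] \<phi> by (simp add: F_iff)
  thus "l2_inner M f \<phi> = 0" using z[OF L(2)] z[OF L(3)] f L by simp
qed

text \<open>The quadratic form of the resolvent is semidefinite, so it has its own Cauchy--Schwarz inequality.\<close>

lemma R_form_cauchy_schwarz:
  assumes f: "f \<in> l2_space M" and h: "h \<in> l2_space M"
  shows "(l2_inner M (R f) h)\<^sup>2 \<le> l2_inner M (R f) f * l2_inner M (R h) h"
proof (rule nonneg_quadratic_discriminant)
  fix t
  let ?k = "\<lambda>x. f x - t * h x"
  have k: "?k \<in> l2_space M" using f h by simp
  note L = f h k R_l2[OF f] R_l2[OF h] R_l2[OF k]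
  have "0 \<le> l2_inner M (R ?k) ?k" by (rule R_nonneg[OF k])
  also have "\<dots> = l2_inner M (R ?k) f - t * l2_inner M (R ?k) h" using L by simp
  also have "l2_inner M (R ?k) f = l2_inner M (R f) f - t * l2_inner M (R f) h"
    using L R_symmetric[OF k f] R_symmetric[OF h f]
    by (simp add: l2_inner_commute[of M f "R f"] l2_inner_commute[of M h "R f"])
  also have "l2_inner M (R ?k) h = l2_inner M (R f) h - t * l2_inner M (R h) h"
    using L R_symmetric[OF k h] R_symmetric[OF f h]
    by (simp add: l2_inner_commute[of M h "R h"])
  finally show "0 \<le> l2_inner M (R f) f - 2 * t * l2_inner M (R f) h + t\<^sup>2 * l2_inner M (R h) h"
    by (simp add: power2_eq_square algebra_simps)
qed (rule R_nonneg[OF h])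

lemma rellich_F:
  assumes G: "finite G" "G \<subseteq> l2_space M"
    and le: "\<And>\<phi>. \<phi> \<in> D \<Longrightarrow> l2_inner M \<phi> \<phi> \<le> \<epsilon> * (l2_inner M \<phi> \<phi> + q \<phi> \<phi>) + C * (\<Sum>g\<in>G. (l2_inner M g \<phi>)\<^sup>2)"
    and F: "F u f"
  shows "l2_inner M u u \<le> \<epsilon> * (l2_inner M u u + l2_inner M f u) + C * (\<Sum>g\<in>G. (l2_inner M g u)\<^sup>2)"
proof -
  obtain w where w: "\<And>n. w n \<in> D" "(\<lambda>n. l2_norm M (\<lambda>x. w n x - u x)) \<longlonglongrightarrow> 0"
    "(\<lambda>n. q (w n) (w n)) \<longlonglongrightarrow> l2_inner M f u" using F_approximants[OF F] by blast
  note u = F_l2(1)[OF F]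
  have 1: "(\<lambda>n. l2_inner M (w n) (w n)) \<longlonglongrightarrow> l2_inner M u u"
    by (rule l2_inner_tendsto_both) (use w D_l2 u in auto)
  have 2: "(\<lambda>n. l2_inner M g (w n)) \<longlonglongrightarrow> l2_inner M g u" if "g \<in> G" for g
    unfolding l2_inner_commute[of M g] by (rule l2_inner_tendsto) (use w D_l2 u G that in auto)
  have 3: "(\<lambda>n. \<epsilon> * (l2_inner M (w n) (w n) + q (w n) (w n)) + C * (\<Sum>g\<in>G. (l2_inner M g (w n))\<^sup>2))
      \<longlonglongrightarrow> \<epsilon> * (l2_inner M u u + l2_inner M f u) + C * (\<Sum>g\<in>G. (l2_inner M g u)\<^sup>2)"
    by (intro tendsto_add tendsto_mult tendsto_const tendsto_sum tendsto_power 1 2 w(3))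
  show ?thesis by (rule LIMSEQ_le[OF 1 3]) (use le w in blast)
qed

text \<open>The compactness inequalities for \<open>\<epsilon> = 1 / (k + 1)\<close> involve countably many functionals altogether. A
  diagonal subsequence makes all of them converge on the images \<open>R (f n)\<close>, and the form norms of these
  images are bounded, so each inequality bounds the \<open>L\<^sup>2\<close> oscillation of the subsequence by a multiple of
  its \<open>\<epsilon>\<close>.\<close>

lemma R_compact:
  assumes f: "\<And>n. f n \<in> l2_space M" "\<And>n. l2_norm M (f n) \<le> 1"
  obtains r :: "nat \<Rightarrow> nat" where "strict_mono r"
    "\<And>e. e > 0 \<Longrightarrow> \<exists>N. \<forall>m\<ge>N. \<forall>n\<ge>N. l2_norm M (\<lambda>x. R (f (r m)) x - R (f (r n)) x) < e"
proof -
  have "\<forall>k. \<exists>G C. finite G \<and> G \<subseteq> l2_space M \<and>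
       (\<forall>\<phi>\<in>D. l2_inner M \<phi> \<phi> \<le> inverse (Suc k) * (l2_inner M \<phi> \<phi> + q \<phi> \<phi>) + C * (\<Sum>g\<in>G. (l2_inner M g \<phi>)\<^sup>2))"
    by (intro allI rellich) simp
  then obtain G C where G: "\<And>k. finite (G k)" "\<And>k. G k \<subseteq> l2_space M"
    and GC: "\<And>k \<phi>. \<phi> \<in> D \<Longrightarrow> l2_inner M \<phi> \<phi> \<le> inverse (Suc k) * (l2_inner M \<phi> \<phi> + q \<phi> \<phi>) + C k * (\<Sum>g\<in>G k. (l2_inner M g \<phi>)\<^sup>2)"
    by metis
  define S where "S = (\<Union>k. G k)"
  have S: "countable S" "S \<subseteq> l2_space M" unfolding S_def using G by (auto intro: countable_finite)
  have uL: "R (f n) \<in> l2_space M" for n by (intro R_l2 f)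
  have un: "l2_norm M (R (f n)) \<le> 1" for n using R_contraction[OF f(1)] f(2) order_trans by blast
  \<comment> \<open>Scaled to be bounded by 1 for all functionals; the summand 1 keeps the denominator positive.\<close>
  define A where "A n g = l2_inner M g (R (f n)) / (1 + l2_norm M g)" for n g
  have "norm (A n g) \<le> 1" if "g \<in> S" for n g
  proof -
    have "\<bar>l2_inner M g (R (f n))\<bar> \<le> l2_norm M g * l2_norm M (R (f n))"
      using that S by (intro l2_cauchy_schwarz uL) auto
    also have "\<dots> \<le> l2_norm M g * 1" by (intro mult_left_mono un) simp
    finally show ?thesis by (simp add: A_def field_simps add_nonneg_pos abs_div)
  qed
  then obtain r where r: "strict_mono r" "\<And>g. g \<in> S \<Longrightarrow> \<exists>l. (\<lambda>n. A (r n) g) \<longlonglongrightarrow> l"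
    using function_convergent_subsequence[OF S(1), of A 1] by metis
  have conv: "Cauchy (\<lambda>n. l2_inner M g (R (f (r n))))" if g: "g \<in> S" for g
  proof -
    obtain l where "(\<lambda>n. A (r n) g) \<longlonglongrightarrow> l" using r(2)[OF g] by blast
    hence "(\<lambda>n. (1 + l2_norm M g) * A (r n) g) \<longlonglongrightarrow> (1 + l2_norm M g) * l" by (intro tendsto_intros)
    moreover have "(1 + l2_norm M g) * A n g = l2_inner M g (R (f n))" for n
      unfolding A_def using l2_norm_nonneg[of M g] by (simp add: add_nonneg_eq_0_iff)
    ultimately show ?thesis using LIMSEQ_imp_Cauchy by force
  qed
  define d where "d m n = (\<lambda>x. R (f (r m)) x - R (f (r n)) x)" for m n
  have bound: "(l2_norm M (d m n))\<^sup>2 \<le> inverse (Suc k) * 8 + C k * (\<Sum>g\<in>G k. (l2_inner M g (d m n))\<^sup>2)" for k m n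
  proof -
    let ?h = "\<lambda>x. (f (r m) x - R (f (r m)) x) - (f (r n) x - R (f (r n)) x)"
    have F: "F (d m n) ?h"
      unfolding d_def by (intro F_diff F_R f(1))
    have dL: "d m n \<in> l2_space M" and hL: "?h \<in> l2_space M" using F_l2[OF F] .
    have d2: "l2_norm M (d m n) \<le> 2"
      unfolding d_def using l2_norm_triangle_diff[OF uL l2_space_zero uL, of "r m" "r n"] un[of "r m"] un[of "r n"]
        l2_norm_scale[of M "-1" "R (f (r n))"] by simp
    have fd: "l2_norm M (\<lambda>x. f (r m) x - f (r n) x) \<le> 2"
      using l2_norm_triangle_diff[OF f(1) l2_space_zero f(1), of "r m" "r n"] f(2)[of "r m"] f(2)[of "r n"]
        l2_norm_scale[of M "-1" "f (r n)"] by simp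
    have "l2_inner M (d m n) (d m n) + l2_inner M ?h (d m n) = l2_inner M (\<lambda>x. f (r m) x - f (r n) x) (d m n)"
    proof -
      have "?h = (\<lambda>x. (f (r m) x - f (r n) x) - d m n x)" by (auto simp: d_def)
      thus ?thesis using f(1) dL by (simp only: l2_inner_diff_left l2_space_diff)
    qed
    also have "\<dots> \<le> l2_norm M (\<lambda>x. f (r m) x - f (r n) x) * l2_norm M (d m n)"
      using l2_cauchy_schwarz[of "\<lambda>x. f (r m) x - f (r n) x" M "d m n"] f(1) dL
      by (simp del: l2_inner_diff_left)
    also have "\<dots> \<le> 2 * 2" using fd d2 by (intro mult_mono) auto
    finally have "l2_inner M (d m n) (d m n) + l2_inner M ?h (d m n) \<le> 8" by simp
    hence "inverse (Suc k) * (l2_inner M (d m n) (d m n) + l2_inner M ?h (d m n)) \<le> inverse (Suc k) * 8"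
      by (intro mult_left_mono) auto
    moreover have "l2_inner M (d m n) (d m n) \<le> inverse (Suc k) * (l2_inner M (d m n) (d m n) + l2_inner M ?h (d m n))
       + C k * (\<Sum>g\<in>G k. (l2_inner M g (d m n))\<^sup>2)"
      by (rule rellich_F[OF G GC F])
    ultimately show ?thesis by (simp only: l2_norm_square)
  qed
  have "\<exists>N. \<forall>m\<ge>N. \<forall>n\<ge>N. l2_norm M (d m n) < e" if "e > 0" for e
  proof -
    obtain k where k: "inverse (real (Suc k)) < e\<^sup>2 / 16" using reals_Archimedean[of "e\<^sup>2/16"] \<open>e > 0\<close> by auto
    define K where "K = (\<bar>C k\<bar> + 1) * (real (card (G k)) + 1)"
    have K: "K > 0" unfolding K_def by (intro mult_pos_pos) auto
    define \<delta> where "\<delta> = sqrt (e\<^sup>2 / (2 * K))"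
    have \<delta>: "\<delta> > 0" using \<open>e > 0\<close> K by (simp add: \<delta>_def)
    have "\<forall>g\<in>G k. \<exists>N. \<forall>m\<ge>N. \<forall>n\<ge>N. \<bar>l2_inner M g (R (f (r m))) - l2_inner M g (R (f (r n)))\<bar> < \<delta>"
      using conv \<delta> unfolding Cauchy_def S_def dist_real_def by blast
    then obtain N where N: "\<And>g m n. g \<in> G k \<Longrightarrow> m \<ge> N g \<Longrightarrow> n \<ge> N g \<Longrightarrow>
        \<bar>l2_inner M g (R (f (r m))) - l2_inner M g (R (f (r n)))\<bar> < \<delta>" by metis
    define N0 where "N0 = (\<Sum>g\<in>G k. N g)"
    have N0: "N g \<le> N0" if "g \<in> G k" for g
      unfolding N0_def using that G by (intro member_le_sum) auto
    have "l2_norm M (d m n) < e" if mn: "m \<ge> N0" "n \<ge> N0" for m n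
    proof (rule power2_less_imp_less)
      have gd: "(l2_inner M g (d m n))\<^sup>2 \<le> \<delta>\<^sup>2" if "g \<in> G k" for g
      proof -
        have "\<bar>l2_inner M g (d m n)\<bar> < \<delta>"
          using N[OF that, of m n] N0[OF that] mn uL G(2) that unfolding d_def by force
        thus ?thesis using \<delta> by (metis abs_le_square_iff abs_of_pos less_imp_le)
      qed
      have "C k * (\<Sum>g\<in>G k. (l2_inner M g (d m n))\<^sup>2) \<le> (\<bar>C k\<bar> + 1) * (\<Sum>g\<in>G k. (l2_inner M g (d m n))\<^sup>2)"
        by (intro mult_right_mono sum_nonneg) auto
      also have "\<dots> \<le> (\<bar>C k\<bar> + 1) * ((real (card (G k)) + 1) * \<delta>\<^sup>2)"
      proof (intro mult_left_mono)
        have "(\<Sum>g\<in>G k. (l2_inner M g (d m n))\<^sup>2) \<le> real (card (G k)) * \<delta>\<^sup>2"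
          using sum_bounded_above[of "G k" "\<lambda>g. (l2_inner M g (d m n))\<^sup>2" "\<delta>\<^sup>2"] gd by simp
        also have "\<dots> \<le> (real (card (G k)) + 1) * \<delta>\<^sup>2" by (intro mult_right_mono) auto
        finally show "(\<Sum>g\<in>G k. (l2_inner M g (d m n))\<^sup>2) \<le> (real (card (G k)) + 1) * \<delta>\<^sup>2" .
      qed auto
      also have "\<dots> = K * \<delta>\<^sup>2" by (simp add: K_def)
      also have "\<dots> = e\<^sup>2 / 2" using K by (simp add: \<delta>_def)
      finally have "(l2_norm M (d m n))\<^sup>2 \<le> inverse (Suc k) * 8 + e\<^sup>2 / 2" using bound[of m n k] by linarith
      also have "\<dots> < e\<^sup>2" using k by linarith
      finally show "(l2_norm M (d m n))\<^sup>2 < e\<^sup>2" .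
    qed (use \<open>e > 0\<close> in simp)
    thus ?thesis by blast
  qed
  with r(1) show ?thesis unfolding d_def by (rule that)
qed

section \<open>Eigenspaces and their completeness\<close>

definition eig :: "real \<Rightarrow> ('m \<Rightarrow> real) set" where
  "eig \<kappa> = {u. F u (\<lambda>x. \<kappa> * u x)}"

lemma eig_subspace: "l2_subspace M (eig \<kappa>)"
  unfolding l2_subspace_def
proof (intro conjI ballI allI subsetI)
  fix u assume "u \<in> eig \<kappa>" thus "u \<in> l2_space M" using F_l2(1) by (auto simp: eig_def)
next
  have "form_cauchy (\<lambda>n _. 0)"
    using l2_subspaceD(2)[OF D] T_linear[OF l2_subspaceD(2)[OF D] l2_subspaceD(2)[OF D], of 0 0]
    by (auto simp: form_cauchy_def)
  thus "(\<lambda>_. 0) \<in> eig \<kappa>" unfolding eig_def F_iff by auto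
next
  fix u v a b assume "u \<in> eig \<kappa>" "v \<in> eig \<kappa>"
  hence "F (\<lambda>x. a * u x + b * v x) (\<lambda>x. a * (\<kappa> * u x) + b * (\<kappa> * v x))"
    unfolding eig_def by (intro F_linear) auto
  moreover have "(\<lambda>x. a * (\<kappa> * u x) + b * (\<kappa> * v x)) = (\<lambda>x. \<kappa> * (a * u x + b * v x))"
    by (auto simp: algebra_simps)
  ultimately show "(\<lambda>x. a * u x + b * v x) \<in> eig \<kappa>" by (simp add: eig_def)
qed

lemma eig_orthogonal:
  assumes "u \<in> eig \<kappa>" "v \<in> eig \<tau>" "\<kappa> \<noteq> \<tau>"
  shows "l2_inner M u v = 0"
  using F_symmetric[of u "\<lambda>x. \<kappa> * u x" v "\<lambda>x. \<tau> * v x"] assms by (simp add: eig_def)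

lemma eig_nonneg:
  assumes "u \<in> eig \<kappa>" "l2_norm M u \<noteq> 0"
  shows "0 \<le> \<kappa>"
proof -
  have "0 \<le> \<kappa> * (l2_norm M u)\<^sup>2"
    using F_nonneg[of u "\<lambda>x. \<kappa> * u x"] assms by (simp add: eig_def l2_norm_square)
  moreover have "(l2_norm M u)\<^sup>2 > 0" using assms by simp
  ultimately show ?thesis by (simp add: zero_le_mult_iff)
qed

text \<open>With more orthonormal eigenvectors than functionals in the compactness inequality, some nonzero
  combination would be annihilated by all functionals. On an eigenvector the form norm is a multiple of
  the \<open>L\<^sup>2\<close> norm, so for small \<open>\<epsilon>\<close> the inequality would force this combination to vanish.\<close>

lemma eig_finite_dim: "l2_finite_dim M (eig \<kappa>)"
proof -
  define \<epsilon> where "\<epsilon> = inverse (2 * (1 + \<bar>\<kappa>\<bar>))"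
  have \<epsilon>: "\<epsilon> > 0" by (simp add: \<epsilon>_def)
  obtain G C where G: "finite G" "G \<subseteq> l2_space M"
    and le: "\<And>\<phi>. \<phi> \<in> D \<Longrightarrow> l2_inner M \<phi> \<phi> \<le> \<epsilon> * (l2_inner M \<phi> \<phi> + q \<phi> \<phi>) + C * (\<Sum>g\<in>G. (l2_inner M g \<phi>)\<^sup>2)"
    using rellich[OF \<epsilon>] by blast
  have "n \<le> card G" if e: "l2_orthonormal_in M (eig \<kappa>) n e" for n e
  proof (rule ccontr)
    assume "\<not> n \<le> card G"
    then obtain c where c: "\<exists>j\<in>{1..n}. c j \<noteq> 0" "\<forall>g\<in>G. (\<Sum>j=1..n. c j * l2_inner M g (e j)) = 0"
      using homogeneous_system_nontrivial[of G "{1..n}" "\<lambda>j g. l2_inner M g (e j)"] G(1) by auto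
    have eV: "e j \<in> eig \<kappa>" if "j \<in> {1..n}" for j using e that by (auto simp: l2_orthonormal_in_def)
    define u where "u = (\<lambda>x. \<Sum>j=1..n. c j * e j x)"
    have u: "u \<in> eig \<kappa>" unfolding u_def
      by (intro l2_subspace_sum[OF eig_subspace] l2_subspaceD(6)[OF eig_subspace] eV)
    have "l2_inner M g u = 0" if "g \<in> G" for g
      unfolding u_def using c(2) that G(2) l2_subspaceD(1)[OF eig_subspace eV]
      by (subst l2_inner_sum_right) auto
    hence "l2_inner M u u \<le> \<epsilon> * (l2_inner M u u + \<kappa> * l2_inner M u u)"
      using rellich_F[OF G le, of u "\<lambda>x. \<kappa> * u x"] u by (simp add: eig_def)
    also have "\<dots> = \<epsilon> * (1 + \<kappa>) * l2_inner M u u" by (simp add: algebra_simps)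
    also have "\<dots> \<le> (1 / 2) * l2_inner M u u"
    proof (rule mult_right_mono[OF _ l2_inner_self_nonneg])
      have "\<epsilon> * (1 + \<kappa>) \<le> \<epsilon> * (1 + \<bar>\<kappa>\<bar>)" using \<epsilon> by (intro mult_left_mono) auto
      also have "\<dots> = 1 / 2" unfolding \<epsilon>_def by (simp add: field_simps)
      finally show "\<epsilon> * (1 + \<kappa>) \<le> 1 / 2" .
    qed
    finally have "l2_inner M u u \<le> 0" by simp
    moreover have "l2_inner M u u = (\<Sum>j=1..n. (c j)\<^sup>2)"
      unfolding u_def l2_norm_square[symmetric] by (rule l2_orthonormal_norm[OF eig_subspace e])
    moreover obtain j where "j \<in> {1..n}" "c j \<noteq> 0" using c(1) by blast
    hence "(\<Sum>j=1..n. (c j)\<^sup>2) > 0" by (intro sum_pos2[of _ j]) auto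
    ultimately show False by simp
  qed
  thus ?thesis unfolding l2_finite_dim_def using eig_subspace by blast
qed

definition eig_perp :: "('m \<Rightarrow> real) set" where
  "eig_perp = {f \<in> l2_space M. \<forall>\<kappa>. \<forall>v\<in>eig \<kappa>. l2_inner M f v = 0}"

lemma eig_perp_l2: "f \<in> eig_perp \<Longrightarrow> f \<in> l2_space M" by (simp add: eig_perp_def)

lemma eig_perp_scale: "f \<in> eig_perp \<Longrightarrow> (\<lambda>x. c * f x) \<in> eig_perp" by (simp add: eig_perp_def)

lemma R_eig_perp:
  assumes f: "f \<in> eig_perp" shows "R f \<in> eig_perp"
  unfolding eig_perp_def
proof safe
  note fL = eig_perp_l2[OF f]
  show "R f \<in> l2_space M" by (rule R_l2[OF fL])
  fix \<kappa> v assume v: "v \<in> eig \<kappa>"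
  note vL = l2_subspaceD(1)[OF eig_subspace v]
  have "l2_inner M (\<lambda>x. f x - R f x) v = \<kappa> * l2_inner M (R f) v"
    using F_symmetric[OF F_R[OF fL], of v "\<lambda>x. \<kappa> * v x"] v by (simp add: eig_def)
  moreover have "l2_inner M f v = 0" using f v by (auto simp: eig_perp_def)
  ultimately have "(1 + \<kappa>) * l2_inner M (R f) v = 0"
    using fL vL R_l2[OF fL] by (simp add: algebra_simps)
  moreover have "l2_inner M (R f) v = 0" if "1 + \<kappa> = 0"
  proof -
    have "l2_norm M v = 0" using eig_nonneg[OF v] that by linarith
    thus ?thesis using l2_cauchy_schwarz[OF R_l2[OF fL] vL] by simp
  qed
  ultimately show "l2_inner M (R f) v = 0" by auto
qed

text \<open>Completeness of the eigenfunctions: the resolvent maps the orthogonal complement \<open>eig_perp\<close> of all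
  eigenspaces to itself. If \<open>eig_perp\<close> were nonzero, a maximising sequence of the quadratic form of the
  resolvent on its unit sphere would, by compactness, converge to an eigenvector inside \<open>eig_perp\<close>.\<close>

theorem eigenfunctions_complete:
  assumes f: "f \<in> l2_space M" and orth: "\<And>\<kappa> v. v \<in> eig \<kappa> \<Longrightarrow> l2_inner M f v = 0"
  shows "AE x in M. f x = 0"
proof (rule ccontr)
  assume "\<not> (AE x in M. f x = 0)"
  hence fn: "l2_norm M f \<noteq> 0" using l2_norm_eq_0_iff[OF f] by simp
  have fW: "f \<in> eig_perp" using f orth by (simp add: eig_perp_def)
  define Q where "Q = (\<lambda>h. l2_inner M (R h) h) ` {h \<in> eig_perp. l2_norm M h = 1}"
  define m where "m = Sup Q"
  have Q_le1: "l2_inner M (R h) h \<le> 1" if "h \<in> eig_perp" "l2_norm M h = 1" for h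
  proof -
    have "l2_inner M (R h) h \<le> l2_norm M (R h) * l2_norm M h"
      using l2_cauchy_schwarz[OF R_l2[OF eig_perp_l2[OF that(1)]] eig_perp_l2[OF that(1)]] by linarith
    thus ?thesis using R_contraction[OF eig_perp_l2[OF that(1)]] that(2) by simp
  qed
  have bdd: "bdd_above Q" unfolding Q_def using Q_le1 by (intro bdd_aboveI2[where M=1]) auto
  define f1 where "f1 = (\<lambda>x. inverse (l2_norm M f) * f x)"
  have f1: "f1 \<in> eig_perp" "l2_norm M f1 = 1"
    using fn eig_perp_scale[OF fW] by (auto simp: f1_def)
  have Rf1: "l2_norm M (R f1) \<noteq> 0"
    using R_injective[OF eig_perp_l2[OF f1(1)]] l2_norm_eq_0_iff[OF eig_perp_l2[OF f1(1)]] f1(2) by auto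
  have m_upper: "l2_inner M (R h) h \<le> m" if "h \<in> eig_perp" "l2_norm M h = 1" for h
    unfolding m_def using that by (intro cSup_upper bdd) (auto simp: Q_def)
  have ne: "Q \<noteq> {}" using f1 by (auto simp: Q_def)
  have "0 < (l2_norm M (R f1))\<^sup>2" using Rf1 by simp
  also have "\<dots> \<le> l2_inner M (R f1) f1" by (rule R_coercive[OF eig_perp_l2[OF f1(1)]])
  also have "\<dots> \<le> m" by (rule m_upper[OF f1])
  finally have m: "m > 0" .
  have form_le: "l2_inner M (R h) h \<le> m * (l2_norm M h)\<^sup>2" if h: "h \<in> eig_perp" for h
  proof (cases "l2_norm M h = 0")
    case True
    thus ?thesis using l2_cauchy_schwarz[OF R_l2[OF eig_perp_l2[OF h]] eig_perp_l2[OF h]] by simp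
  next
    case False
    let ?c = "inverse (l2_norm M h)"
    let ?k = "\<lambda>x. ?c * h x"
    have k: "?k \<in> eig_perp" "l2_norm M ?k = 1" using False eig_perp_scale[OF h] by auto
    have "l2_inner M (R ?k) ?k = ?c * (?c * l2_inner M (R h) h)"
      using R_symmetric[OF eig_perp_l2[OF k(1)] eig_perp_l2[OF h]] by (simp add: l2_inner_commute[of M h "R h"])
    moreover have "l2_inner M (R ?k) ?k \<le> m"
      by (rule m_upper[OF k])
    ultimately have "?c * (?c * l2_inner M (R h) h) * (l2_norm M h)\<^sup>2 \<le> m * (l2_norm M h)\<^sup>2"
      by (intro mult_right_mono) auto
    moreover have "?c * (?c * l2_inner M (R h) h) * (l2_norm M h)\<^sup>2 = l2_inner M (R h) h"
      using False by (simp add: field_simps power2_eq_square)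
    ultimately show ?thesis by simp
  qed
  \<comment> \<open>Cauchy--Schwarz for the form of \<open>R\<close> between \<open>h\<close> and \<open>R h\<close>, where the form at \<open>R h\<close> is bounded by its
    supremum \<open>m\<close>.\<close>
  have R_square_le: "(l2_norm M (R h))\<^sup>2 \<le> m * l2_inner M (R h) h" if h: "h \<in> eig_perp" for h
  proof (cases "l2_norm M (R h) = 0")
    case True thus ?thesis using R_nonneg[OF eig_perp_l2[OF h]] m by simp
  next
    case False
    define s where "s = (l2_norm M (R h))\<^sup>2"
    have s: "s > 0" using False by (simp add: s_def)
    note L = eig_perp_l2[OF h] R_l2[OF eig_perp_l2[OF h]]
    have "s\<^sup>2 = (l2_inner M (R h) (R h))\<^sup>2" by (simp add: s_def l2_norm_square)
    also have "\<dots> \<le> l2_inner M (R h) h * l2_inner M (R (R h)) (R h)"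
      by (rule R_form_cauchy_schwarz[OF L])
    also have "\<dots> \<le> l2_inner M (R h) h * (m * s)"
      unfolding s_def by (intro mult_left_mono form_le R_eig_perp h R_nonneg L)
    finally have "s * s \<le> (m * l2_inner M (R h) h) * s" by (simp add: power2_eq_square mult_ac)
    thus ?thesis using s unfolding s_def[symmetric] by (rule mult_right_le_imp_le)
  qed
  have "\<exists>h. h \<in> eig_perp \<and> l2_norm M h = 1 \<and> m - inverse (Suc n) < l2_inner M (R h) h" for n
    using less_cSupD[OF ne, of "m - inverse (Suc n)"] by (auto simp: m_def Q_def)
  then obtain w where w: "\<And>n. w n \<in> eig_perp" "\<And>n. l2_norm M (w n) = 1"
    and wm: "\<And>n. m - inverse (Suc n) < l2_inner M (R (w n)) (w n)" by metis
  note wL = eig_perp_l2[OF w(1)]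
  note RwL = R_l2[OF wL]
  \<comment> \<open>By the previous bound, a maximising sequence consists of approximate eigenvectors for \<open>m\<close>.\<close>
  have near: "(l2_norm M (\<lambda>x. R (w n) x - m * w n x))\<^sup>2 \<le> m * inverse (Suc n)" for n
  proof -
    have "(l2_norm M (\<lambda>x. R (w n) x - m * w n x))\<^sup>2 = (l2_norm M (R (w n)))\<^sup>2 - 2 * (m * l2_inner M (R (w n)) (w n)) + m\<^sup>2"
      using l2_norm_diff_square[OF RwL l2_space_scale[OF wL], of n m n] w(2) by simp
    also have "\<dots> \<le> m * (m - l2_inner M (R (w n)) (w n))"
      using R_square_le[OF w(1), of n] by (simp add: power2_eq_square algebra_simps)
    also have "\<dots> \<le> m * inverse (Suc n)" using wm[of n] m by (intro mult_left_mono) auto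
    finally show ?thesis .
  qed
  have "(\<lambda>n. m * inverse (real (Suc n))) \<longlonglongrightarrow> 0"
    using tendsto_mult_right_zero[OF LIMSEQ_inverse_real_of_nat, of m] by simp
  hence "(\<lambda>n. (l2_norm M (\<lambda>x. R (w n) x - m * w n x))\<^sup>2) \<longlonglongrightarrow> 0"
    by (rule Lim_null_comparison[rotated]) (use near in simp)
  from tendsto_real_sqrt[OF this]
  have near0: "(\<lambda>n. l2_norm M (\<lambda>x. R (w n) x - m * w n x)) \<longlonglongrightarrow> 0" by simp
  obtain r :: "nat \<Rightarrow> nat" where r: "strict_mono r"
    and rC: "\<And>e. e > 0 \<Longrightarrow> \<exists>N. \<forall>i\<ge>N. \<forall>n\<ge>N. l2_norm M (\<lambda>x. R (w (r i)) x - R (w (r n)) x) < e"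
  proof (rule R_compact[of w])
    show "w n \<in> l2_space M" for n by (rule wL)
    show "l2_norm M (w n) \<le> 1" for n by (simp add: w(2))
  qed auto
  obtain h where h: "h \<in> l2_space M" "(\<lambda>n. l2_norm M (\<lambda>x. R (w (r n)) x - h x)) \<longlonglongrightarrow> 0"
  proof (rule l2_complete[of "\<lambda>n. R (w (r n))" M])
    show "R (w (r n)) \<in> l2_space M" for n by (rule RwL)
    show "\<exists>N. \<forall>i\<ge>N. \<forall>n\<ge>N. l2_norm M (\<lambda>x. R (w (r i)) x - R (w (r n)) x) < e" if "e > 0" for e
      using that by (rule rC)
  qed auto
  define e where "e = (\<lambda>x. inverse m * h x)"
  have eL: "e \<in> l2_space M" using h by (simp add: e_def)
  have we: "(\<lambda>n. l2_norm M (\<lambda>x. w (r n) x - e x)) \<longlonglongrightarrow> 0"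
  proof (rule Lim_null_comparison)
    show "(\<lambda>n. inverse m * (l2_norm M (\<lambda>x. R (w (r n)) x - m * w (r n) x) + l2_norm M (\<lambda>x. R (w (r n)) x - h x))) \<longlonglongrightarrow> 0"
      using tendsto_mult_right_zero[OF tendsto_add_zero[OF LIMSEQ_subseq_LIMSEQ[OF near0 r] h(2)], of "inverse m"]
      by (simp add: o_def)
    have "l2_norm M (\<lambda>x. w (r n) x - e x) \<le> inverse m * (l2_norm M (\<lambda>x. R (w (r n)) x - m * w (r n) x) + l2_norm M (\<lambda>x. R (w (r n)) x - h x))" for n
    proof -
      have "(\<lambda>x. w (r n) x - e x) = (\<lambda>x. inverse m * (m * w (r n) x - h x))"
        using m by (auto simp: e_def field_simps)
      hence "l2_norm M (\<lambda>x. w (r n) x - e x) = inverse m * l2_norm M (\<lambda>x. m * w (r n) x - h x)"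
        using m by (simp only: l2_norm_scale) simp
      also have "l2_norm M (\<lambda>x. m * w (r n) x - h x) \<le> l2_norm M (\<lambda>x. m * w (r n) x - R (w (r n)) x) + l2_norm M (\<lambda>x. R (w (r n)) x - h x)"
        by (intro l2_norm_triangle_diff l2_space_scale wL RwL h)
      finally show ?thesis using m by (simp add: l2_norm_minus_commute[of M "\<lambda>x. m * w (r n) x"] mult_left_mono)
    qed
    thus "\<forall>\<^sub>F n in sequentially. norm (l2_norm M (\<lambda>x. w (r n) x - e x))
        \<le> inverse m * (l2_norm M (\<lambda>x. R (w (r n)) x - m * w (r n) x) + l2_norm M (\<lambda>x. R (w (r n)) x - h x))"
      by simp
  qed
  have "(\<lambda>n. l2_norm M (w (r n))) \<longlonglongrightarrow> l2_norm M e" by (rule l2_norm_tendsto[OF wL eL we])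
  hence e1: "l2_norm M e = 1" using w(2) LIMSEQ_unique[OF _ tendsto_const] by fastforce
  have eW: "e \<in> eig_perp" unfolding eig_perp_def
  proof safe
    fix \<kappa> v assume v: "v \<in> eig \<kappa>"
    have "(\<lambda>n. l2_inner M (w (r n)) v) \<longlonglongrightarrow> l2_inner M e v"
      by (rule l2_inner_tendsto[OF wL eL l2_subspaceD(1)[OF eig_subspace v] we])
    moreover have "l2_inner M (w (r n)) v = 0" for n using w(1)[of "r n"] v by (auto simp: eig_perp_def)
    ultimately show "l2_inner M e v = 0" using LIMSEQ_unique[OF _ tendsto_const] by fastforce
  qed (rule eL)
  have "l2_norm M (\<lambda>x. R e x - h x) \<le> 0"
  proof (rule LIMSEQ_le_const)
    show "(\<lambda>n. l2_norm M (\<lambda>x. w (r n) x - e x) + l2_norm M (\<lambda>x. R (w (r n)) x - h x)) \<longlonglongrightarrow> 0"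
      using tendsto_add_zero[OF we h(2)] .
    have "l2_norm M (\<lambda>x. R e x - h x) \<le> l2_norm M (\<lambda>x. w (r n) x - e x) + l2_norm M (\<lambda>x. R (w (r n)) x - h x)" for n
      using l2_norm_triangle_diff[OF R_l2[OF eL] RwL h(1), of "r n"] R_diff_contraction[OF eL wL, of "r n"]
        l2_norm_minus_commute[of M e "w (r n)"] by linarith
    thus "\<exists>N. \<forall>n\<ge>N. l2_norm M (\<lambda>x. R e x - h x) \<le> l2_norm M (\<lambda>x. w (r n) x - e x) + l2_norm M (\<lambda>x. R (w (r n)) x - h x)"
      by blast
  qed
  hence "l2_norm M (\<lambda>x. R e x - h x) = 0" using l2_norm_nonneg[of M "\<lambda>x. R e x - h x"] by linarith
  hence Re: "AE x in M. R e x - h x = 0"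
    using l2_norm_eq_0_iff[OF l2_space_diff[OF R_l2[OF eL] h(1)]] by simp
  \<comment> \<open>\<open>R e = m e\<close> means \<open>T e = (1/m - 1) e\<close>.\<close>
  define v where "v = (\<lambda>x. inverse m * R e x)"
  have vL: "v \<in> l2_space M" unfolding v_def by (intro l2_space_scale R_l2 eL)
  have ve: "AE x in M. v x = e x" using Re by eventually_elim (simp add: v_def e_def)
  have "F v (\<lambda>x. inverse m * (e x - R e x))"
    using F_linear[OF F_R[OF eL] F_R[OF eL], of "inverse m" 0] by (simp add: v_def)
  moreover have "AE x in M. inverse m * (e x - R e x) = (inverse m - 1) * v x"
    using ve by eventually_elim (use m in \<open>simp add: v_def field_simps\<close>)
  ultimately have "F v (\<lambda>x. (inverse m - 1) * v x)" by (rule F_AE_cong[OF _ l2_space_scale[OF vL]])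
  hence "v \<in> eig (inverse m - 1)" by (simp add: eig_def)
  hence "l2_inner M e v = 0" using eW by (auto simp: eig_perp_def)
  moreover have "l2_inner M v e = l2_inner M e e"
    by (rule l2_inner_AE_cong[OF vL[THEN l2_space_measurable] eL[THEN l2_space_measurable] eL[THEN l2_space_measurable] ve])
  ultimately have "l2_inner M e e = 0" by (simp add: l2_inner_commute)
  thus False using e1 by (simp add: l2_norm_def)
qed

end

section \<open>Orthogonal decompositions and the spectral variation norm\<close>

text \<open>What the proposition uses of the eigenspaces: an orthogonal sequence of finite-dimensional subspaces
  whose orthogonal complement is trivial.\<close>

locale orthogonal_decomposition =
  fixes M :: "'m measure" and E :: "nat \<Rightarrow> ('m \<Rightarrow> real) set"
  assumes finite_dim: "l2_finite_dim M (E j)"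
    and orthogonal: "u \<in> E j \<Longrightarrow> v \<in> E k \<Longrightarrow> j \<noteq> k \<Longrightarrow> l2_inner M u v = 0"
    and complete: "f \<in> l2_space M \<Longrightarrow> (\<And>j u. u \<in> E j \<Longrightarrow> l2_inner M f u = 0) \<Longrightarrow> AE x in M. f x = 0"
begin

abbreviation P :: "nat \<Rightarrow> ('m \<Rightarrow> real) \<Rightarrow> 'm \<Rightarrow> real" where
  "P j \<equiv> l2_proj M (E j)"

lemma subspace: "l2_subspace M (E j)"
  using finite_dim by (simp add: l2_finite_dim_def)

lemmas E_l2 = l2_subspaceD(1)[OF subspace]
lemmas P_E = l2_proj_mem[OF finite_dim]
lemmas P_l2 = E_l2[OF P_E]

lemma P_inner:
  assumes "f \<in> l2_space M" "u \<in> E j"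
  shows "l2_inner M (P j f) u = l2_inner M f u"
  using l2_proj_orthogonal[OF finite_dim assms] assms P_l2[OF assms(1)] E_l2[OF assms(2)] by simp

lemma P_orthogonal:
  assumes "f \<in> l2_space M" "j \<noteq> k"
  shows "l2_inner M (P j f) (P k f) = 0"
  using orthogonal[OF P_E[OF assms(1)] P_E[OF assms(1)] assms(2)] .

lemma P_norm_square: "f \<in> l2_space M \<Longrightarrow> (l2_norm M (P j f))\<^sup>2 = l2_inner M f (P j f)"
  using P_inner[OF _ P_E] by (simp add: l2_norm_square)

lemma P_contraction:
  assumes f: "f \<in> l2_space M" shows "l2_norm M (P j f) \<le> l2_norm M f"
proof (cases "l2_norm M (P j f) = 0")
  case False
  hence pos: "0 < l2_norm M (P j f)" using l2_norm_nonneg[of M "P j f"] by linarith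
  have "l2_norm M (P j f) * l2_norm M (P j f) \<le> l2_norm M f * l2_norm M (P j f)"
    using P_norm_square[OF f, of j] l2_cauchy_schwarz[OF f P_l2[OF f], of j] by (simp add: power2_eq_square)
  thus ?thesis using pos by (rule mult_right_le_imp_le)
qed simp

lemma P_linear_combination:
  assumes a: "\<And>r. r \<in> I \<Longrightarrow> a r \<in> l2_space M"
  shows "l2_norm M (P j (\<lambda>x. \<Sum>r\<in>I. c r * a r x)) \<le> (\<Sum>r\<in>I. \<bar>c r\<bar> * l2_norm M (P j (a r)))"
proof -
  let ?f = "\<lambda>x. \<Sum>r\<in>I. c r * a r x" and ?h = "\<lambda>x. \<Sum>r\<in>I. c r * P j (a r) x"
  have f: "?f \<in> l2_space M" using a by (intro l2_space_sum l2_space_scale)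
  have h: "?h \<in> E j" using a by (intro l2_subspace_sum[OF subspace] l2_subspaceD(6)[OF subspace] P_E)
  have "l2_norm M (\<lambda>x. P j ?f x - ?h x) = 0"
  proof (rule l2_proj_unique[OF finite_dim f h])
    fix u assume u: "u \<in> E j"
    have "l2_inner M ?f u = (\<Sum>r\<in>I. c r * l2_inner M (a r) u)"
      using a E_l2[OF u] by (subst l2_inner_sum_left) auto
    moreover have "l2_inner M ?h u = (\<Sum>r\<in>I. c r * l2_inner M (P j (a r)) u)"
      using a P_l2 E_l2[OF u] by (subst l2_inner_sum_left) auto
    ultimately have "l2_inner M ?f u = l2_inner M ?h u"
      using P_inner[OF a u] by simp
    thus "l2_inner M (\<lambda>x. ?f x - ?h x) u = 0"
      using l2_inner_diff_left[OF f E_l2[OF h] E_l2[OF u]] by simp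
  qed
  hence "l2_norm M (P j ?f) = l2_norm M ?h" by (rule l2_norm_eq_of_diff_zero[OF P_l2[OF f] E_l2[OF h]])
  also have "\<dots> \<le> (\<Sum>r\<in>I. l2_norm M (\<lambda>x. c r * P j (a r) x))"
    using a P_l2 by (intro l2_norm_sum_le l2_space_scale) auto
  finally show ?thesis by simp
qed

lemma P_norm_le_add:
  assumes f: "f \<in> l2_space M" and h: "h \<in> l2_space M"
  shows "l2_norm M (P j f) \<le> l2_norm M (P j h) + l2_norm M (\<lambda>x. f x - h x)"
proof -
  let ?a = "\<lambda>r::nat. if r = 0 then h else (\<lambda>x. f x - h x)"
  have "(\<lambda>x. \<Sum>r\<in>{0,1}. 1 * ?a r x) = f" by auto
  hence "l2_norm M (P j f) \<le> (\<Sum>r\<in>{0,1::nat}. \<bar>1::real\<bar> * l2_norm M (P j (?a r)))"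
    using P_linear_combination[of "{0,1}" ?a j "\<lambda>_. 1"] f h by auto
  also have "\<dots> = l2_norm M (P j h) + l2_norm M (P j (\<lambda>x. f x - h x))" by simp
  finally show ?thesis using P_contraction[of "\<lambda>x. f x - h x" j] f h by simp
qed

lemma sum_P_norm_square:
  assumes f: "f \<in> l2_space M" and I: "finite I"
  shows "(l2_norm M (\<lambda>x. \<Sum>j\<in>I. P j f x))\<^sup>2 = (\<Sum>j\<in>I. (l2_norm M (P j f))\<^sup>2)"
proof -
  have S: "(\<lambda>x. \<Sum>j\<in>I. P j f x) \<in> l2_space M" by (intro l2_space_sum P_l2 f)
  have "(l2_norm M (\<lambda>x. \<Sum>j\<in>I. P j f x))\<^sup>2 = (\<Sum>k\<in>I. \<Sum>j\<in>I. l2_inner M (P j f) (P k f))"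
    unfolding l2_norm_square using f P_l2 S
    by (simp add: l2_inner_sum_right l2_inner_sum_left)
  also have "\<dots> = (\<Sum>k\<in>I. \<Sum>j\<in>I. if j = k then (l2_norm M (P k f))\<^sup>2 else 0)"
    by (intro sum.cong) (auto simp: P_orthogonal[OF f] l2_norm_square)
  finally show ?thesis using I by simp
qed

lemma bessel:
  assumes f: "f \<in> l2_space M"
  shows "(\<Sum>j<N. (l2_norm M (P j f))\<^sup>2) \<le> (l2_norm M f)\<^sup>2"
proof -
  let ?S = "\<lambda>x. \<Sum>j<N. P j f x"
  have S: "?S \<in> l2_space M" by (intro l2_space_sum P_l2 f)
  have "l2_inner M f ?S = (\<Sum>j<N. (l2_norm M (P j f))\<^sup>2)"
    using f P_l2 by (simp add: l2_inner_sum_right P_norm_square)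
  moreover have "0 \<le> (l2_norm M (\<lambda>x. f x - ?S x))\<^sup>2" by simp
  ultimately show ?thesis
    unfolding l2_norm_diff_square[OF f S] sum_P_norm_square[OF f finite_lessThan] by simp
qed

text \<open>By Bessel's inequality the partial sums converge. Their limit has the same inner products as \<open>f\<close> with
  all elements of the subspaces, so it is \<open>f\<close> by completeness.\<close>

theorem partial_sums_tendsto:
  assumes f: "f \<in> l2_space M"
  shows "(\<lambda>N. l2_norm M (\<lambda>x. f x - (\<Sum>j<N. P j f x))) \<longlonglongrightarrow> 0"
proof -
  define S where "S N = (\<lambda>x. \<Sum>j<N. P j f x)" for N :: nat
  have S: "S N \<in> l2_space M" for N unfolding S_def by (intro l2_space_sum P_l2 f)
  have "summable (\<lambda>j. (l2_norm M (P j f))\<^sup>2)"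
    by (rule bounded_imp_summable[of _ "(l2_norm M f)\<^sup>2"])
       (use bessel[OF f, of "Suc _"] in \<open>auto simp: lessThan_Suc_atMost\<close>)
  hence cauchy: "\<And>e. e > 0 \<Longrightarrow> \<exists>N. \<forall>m\<ge>N. \<forall>n. norm (\<Sum>j=m..<n. (l2_norm M (P j f))\<^sup>2) < e"
    unfolding summable_Cauchy by blast
  have diff: "(l2_norm M (\<lambda>x. S n x - S m x))\<^sup>2 = (\<Sum>j=m..<n. (l2_norm M (P j f))\<^sup>2)" if "m \<le> n" for m n
  proof -
    have "(\<lambda>x. S n x - S m x) = (\<lambda>x. \<Sum>j=m..<n. P j f x)"
      unfolding S_def using that by (auto simp: lessThan_atLeast0 sum_diff_nat_ivl)
    thus ?thesis using sum_P_norm_square[OF f, of "{m..<n}"] by simp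
  qed
  obtain g where g: "g \<in> l2_space M" "(\<lambda>N. l2_norm M (\<lambda>x. S N x - g x)) \<longlonglongrightarrow> 0"
  proof (rule l2_complete[of S M])
    fix e :: real assume e: "e > 0"
    then obtain N where N: "\<And>m n. m \<ge> N \<Longrightarrow> norm (\<Sum>j=m..<n. (l2_norm M (P j f))\<^sup>2) < e\<^sup>2"
      using cauchy[of "e\<^sup>2"] by auto
    have 1: "l2_norm M (\<lambda>x. S n x - S m x) < e" if "N \<le> m" "m \<le> n" for m n
    proof (rule power2_less_imp_less)
      show "(l2_norm M (\<lambda>x. S n x - S m x))\<^sup>2 < e\<^sup>2"
        unfolding diff[OF that(2)] using N[OF that(1), of n] by simp
    qed (use e in simp)
    show "\<exists>N. \<forall>m\<ge>N. \<forall>n\<ge>N. l2_norm M (\<lambda>x. S m x - S n x) < e"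
    proof (intro exI[of _ N] allI impI)
      fix m n assume "N \<le> m" "N \<le> n"
      thus "l2_norm M (\<lambda>x. S m x - S n x) < e"
        using 1[of m n] 1[of n m] l2_norm_minus_commute[of M "S m" "S n"] by (cases "m \<le> n") auto
    qed
  qed (use S in auto)
  have fg: "(\<lambda>x. f x - g x) \<in> l2_space M" using f g by simp
  have "AE x in M. f x - g x = 0"
  proof (rule complete[OF fg])
    fix k u assume u: "u \<in> E k"
    note uL = E_l2[OF u]
    have "l2_inner M (S N) u = l2_inner M f u" if "N > k" for N
    proof -
      have "l2_inner M (S N) u = (\<Sum>j<N. l2_inner M (P j f) u)"
        unfolding S_def using P_l2[OF f] uL by (simp add: l2_inner_sum_left)
      also have "\<dots> = (\<Sum>j<N. if j = k then l2_inner M f u else 0)"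
        using orthogonal[OF P_E[OF f] u] P_inner[OF f u] by (intro sum.cong) auto
      finally show ?thesis using that by simp
    qed
    hence "(\<lambda>N. l2_inner M (S N) u) \<longlonglongrightarrow> l2_inner M f u"
      by (intro tendsto_eventually eventually_sequentiallyI[of "Suc k"]) auto
    moreover have "(\<lambda>N. l2_inner M (S N) u) \<longlonglongrightarrow> l2_inner M g u"
      by (rule l2_inner_tendsto[OF S g(1) uL g(2)])
    ultimately show "l2_inner M (\<lambda>x. f x - g x) u = 0"
      using LIMSEQ_unique f g(1) uL by (metis l2_inner_diff_left right_minus_eq)
  qed
  hence fg0: "l2_norm M (\<lambda>x. f x - g x) = 0" using l2_norm_eq_0_iff[OF fg] by simp
  have "l2_norm M (\<lambda>x. f x - S N x) \<le> l2_norm M (\<lambda>x. S N x - g x)" for N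
    using l2_norm_triangle_diff[OF f g(1) S, of N] fg0 l2_norm_minus_commute[of M g "S N"] by simp
  hence "\<forall>\<^sub>F N in sequentially. norm (l2_norm M (\<lambda>x. f x - S N x)) \<le> l2_norm M (\<lambda>x. S N x - g x)"
    by simp
  hence "(\<lambda>N. l2_norm M (\<lambda>x. f x - S N x)) \<longlonglongrightarrow> 0"
    by (rule Lim_null_comparison[OF _ g(2)])
  thus ?thesis by (simp add: S_def)
qed

end

locale spectral_variation = orthogonal_decomposition M E
  for M :: "'m measure" and E :: "nat \<Rightarrow> ('m \<Rightarrow> real) set" +
  fixes \<mu> :: "nat \<Rightarrow> real" and s :: real
  assumes \<mu>_nonneg: "0 \<le> \<mu> j"
begin

definition w :: "nat \<Rightarrow> real" where "w j = (1 + \<mu> j) powr (s / 2)"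

lemma w_pos: "w j > 0"
  using \<mu>_nonneg[of j] by (simp add: w_def)

lemma inverse_w: "(1 + \<mu> j) powr (- s / 2) = inverse (w j)"
  by (simp add: w_def powr_minus)

text \<open>Reducing the norm to finite partial sums makes its lower semicontinuity visible: every partial sum is
  continuous in \<open>L\<^sup>2\<close>.\<close>

lemma spec_norm_le_1_iff:
  "spec_norm M \<mu> E s f \<le> 1 \<longleftrightarrow> (\<forall>N. (\<Sum>j<N. w j * l2_norm M (P j f)) \<le> 1)"
proof -
  have eq: "(\<Sum>j<N. ennreal (w j * l2_norm M (P j f))) = ennreal (\<Sum>j<N. w j * l2_norm M (P j f))" for N
    using w_pos by (intro sum_ennreal) (simp add: less_imp_le)
  have "spec_norm M \<mu> E s f = (\<Sum>j. ennreal (w j * l2_norm M (P j f)))"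
    by (simp add: spec_norm_def w_def)
  also have "\<dots> \<le> 1 \<longleftrightarrow> (\<forall>N. (\<Sum>j<N. ennreal (w j * l2_norm M (P j f))) \<le> 1)"
    by (simp add: suminf_eq_SUP SUP_le_iff)
  finally show ?thesis unfolding eq by simp
qed

lemma atom_norm:
  assumes a: "a \<in> spec_atoms M \<mu> E s"
  shows "a \<in> l2_space M" "(\<Sum>j<N. w j * l2_norm M (P j a)) \<le> 1"
proof -
  obtain k u where a_def: "a = (\<lambda>x. inverse (w k) * u x)" and u: "u \<in> E k" "l2_norm M u = 1"
    using a unfolding spec_atoms_def inverse_w by blast
  note uL = E_l2[OF u(1)]
  have "a \<in> E k" unfolding a_def by (rule l2_subspaceD(6)[OF subspace u(1)])
  thus aL: "a \<in> l2_space M" by (rule E_l2)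
  have "w j * l2_norm M (P j a) \<le> (if j = k then 1 else 0)" for j
  proof (cases "j = k")
    case True
    have "l2_norm M (P j a) \<le> l2_norm M a" by (rule P_contraction[OF aL])
    also have "\<dots> = inverse (w k)" unfolding a_def using u w_pos[of k] by simp
    finally show ?thesis using True w_pos[of k] by (simp add: field_simps)
  next
    case False
    have "(l2_norm M (P j a))\<^sup>2 = 0"
      using P_norm_square[OF aL] orthogonal[OF \<open>a \<in> E k\<close> P_E[OF aL], of j] False by simp
    thus ?thesis using False by simp
  qed
  hence "(\<Sum>j<N. w j * l2_norm M (P j a)) \<le> (\<Sum>j<N. if j = k then 1 else 0)" by (intro sum_mono)
  also have "\<dots> \<le> 1" by simp
  finally show "(\<Sum>j<N. w j * l2_norm M (P j a)) \<le> 1" .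
qed

text \<open>Every weighted partial sum of norms of projections is a seminorm, and it is at most 1 on the atoms.\<close>

lemma hull_norm:
  assumes h: "h \<in> absolutely_convex_hull (spec_atoms M \<mu> E s)"
  shows "h \<in> l2_space M" "(\<Sum>j<N. w j * l2_norm M (P j h)) \<le> 1"
proof -
  obtain n :: nat and c a where h_def: "h = (\<lambda>x. \<Sum>r<n. c r * a r x)" and a': "\<forall>r<n. a r \<in> spec_atoms M \<mu> E s"
    and c: "(\<Sum>r<n. \<bar>c r\<bar>) \<le> 1"
    using h unfolding absolutely_convex_hull_def by blast
  have a: "a r \<in> spec_atoms M \<mu> E s" if "r < n" for r using a' that by blast
  have aL: "a r \<in> l2_space M" if "r < n" for r by (rule atom_norm(1)[OF a[OF that]])
  show "h \<in> l2_space M" unfolding h_def using aL by (intro l2_space_sum l2_space_scale) auto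
  have "(\<Sum>j<N. w j * l2_norm M (P j h)) \<le> (\<Sum>j<N. w j * (\<Sum>r<n. \<bar>c r\<bar> * l2_norm M (P j (a r))))"
    unfolding h_def using aL w_pos by (intro sum_mono mult_left_mono P_linear_combination) (auto intro: less_imp_le)
  also have "\<dots> = (\<Sum>r<n. \<bar>c r\<bar> * (\<Sum>j<N. w j * l2_norm M (P j (a r))))"
    unfolding sum_distrib_left by (subst sum.swap) (simp add: mult_ac)
  also have "\<dots> \<le> (\<Sum>r<n. \<bar>c r\<bar> * 1)"
    using atom_norm(2)[OF a] by (intro sum_mono mult_left_mono) auto
  finally show "(\<Sum>j<N. w j * l2_norm M (P j h)) \<le> 1" using c by simp
qed

lemma normalized_atom:
  assumes u: "u \<in> E j" "l2_norm M u \<noteq> 0"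
  shows "(\<lambda>x. inverse (w j) * (inverse (l2_norm M u) * u x)) \<in> spec_atoms M \<mu> E s"
proof -
  have "(\<lambda>x. inverse (l2_norm M u) * u x) \<in> E j" by (rule l2_subspaceD(6)[OF subspace u(1)])
  moreover have "l2_norm M (\<lambda>x. inverse (l2_norm M u) * u x) = 1" using u(2) by simp
  ultimately show ?thesis unfolding spec_atoms_def inverse_w
    by (intro UN_I[of j] CollectI exI[of _ "\<lambda>x. inverse (l2_norm M u) * u x"] conjI refl) auto
qed

text \<open>Each nonzero component is its weighted norm times an atom, and the weighted norms sum to at most 1.
  The sum of the components is thus an absolutely convex combination of atoms.\<close>

lemma partial_sum_near_hull:
  assumes f: "f \<in> l2_space M" and le: "(\<Sum>j<N. w j * l2_norm M (P j f)) \<le> 1"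
  shows "\<exists>h\<in>absolutely_convex_hull (spec_atoms M \<mu> E s). l2_norm M (\<lambda>x. (\<Sum>j<N. P j f x) - h x) = 0"
proof (cases "\<forall>j<N. l2_norm M (P j f) = 0")
  case True
  have "(\<lambda>_. 0) \<in> absolutely_convex_hull (spec_atoms M \<mu> E s)"
    unfolding absolutely_convex_hull_def by (auto intro!: exI[of _ "0::nat"])
  moreover have "(l2_norm M (\<lambda>x. (\<Sum>j<N. P j f x)))\<^sup>2 = 0"
    using True by (simp add: sum_P_norm_square[OF f])
  ultimately show ?thesis by (intro bexI[of _ "\<lambda>_. 0"]) auto
next
  case False
  then obtain j0 where j0: "j0 < N" "l2_norm M (P j0 f) \<noteq> 0" by blast
  define b where "b j = (\<lambda>x. inverse (w j) * (inverse (l2_norm M (P j f)) * P j f x))" for j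
  \<comment> \<open>A vanishing component gets the coefficient 0, so that any atom may stand in for it.\<close>
  define a where "a j = (if l2_norm M (P j f) = 0 then b j0 else b j)" for j
  define c where "c j = w j * l2_norm M (P j f)" for j
  have b: "b j \<in> spec_atoms M \<mu> E s" if "l2_norm M (P j f) \<noteq> 0" for j
    unfolding b_def by (rule normalized_atom[OF P_E[OF f] that])
  have a: "a j \<in> spec_atoms M \<mu> E s" for j using b j0 by (auto simp: a_def)
  have "(\<Sum>j<N. \<bar>c j\<bar>) \<le> 1" using le w_pos by (simp add: c_def abs_mult less_imp_le)
  hence h: "(\<lambda>x. \<Sum>j<N. c j * a j x) \<in> absolutely_convex_hull (spec_atoms M \<mu> E s)"
    unfolding absolutely_convex_hull_def using a by blast
  have zero_diff: "l2_norm M (\<lambda>x. P j f x - c j * a j x) = 0" for j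
  proof (cases "l2_norm M (P j f) = 0")
    case True thus ?thesis by (simp add: c_def)
  next
    case False
    have "w j * n * (inverse (w j) * (inverse n * y)) = y" if "n \<noteq> 0" for n y :: real
      using that w_pos[of j] by (simp add: field_simps)
    with False have "(\<lambda>x. P j f x - c j * a j x) = (\<lambda>_. 0)"
      by (auto simp: c_def a_def b_def)
    thus ?thesis by simp
  qed
  have "l2_norm M (\<lambda>x. (\<Sum>j<N. P j f x) - (\<Sum>j<N. c j * a j x)) = l2_norm M (\<lambda>x. \<Sum>j<N. (P j f x - c j * a j x))"
    by (simp add: sum_subtractf)
  also have "\<dots> \<le> (\<Sum>j<N. l2_norm M (\<lambda>x. P j f x - c j * a j x))"
    by (intro l2_norm_sum_le l2_space_diff l2_space_scale P_l2[OF f] atom_norm(1)[OF a])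
  also have "\<dots> = 0" using zero_diff by simp
  finally have "l2_norm M (\<lambda>x. (\<Sum>j<N. P j f x) - (\<Sum>j<N. c j * a j x)) = 0"
    by (rule antisym) (rule l2_norm_nonneg)
  with h show ?thesis by (intro bexI[of _ "\<lambda>x. \<Sum>j<N. c j * a j x"])
qed

text \<open>The partial sums of an element of the ball lie in the hull and converge to it. Conversely, the bounds
  on the weighted partial sums hold on the hull, and they survive \<open>L\<^sup>2\<close> limits because projections are
  contractions.\<close>

theorem unit_ball_eq_closure:
  "{f \<in> spec_space M \<mu> E s. spec_norm M \<mu> E s f \<le> 1} =
     l2_closure M (absolutely_convex_hull (spec_atoms M \<mu> E s))"
proof (intro equalityI subsetI)
  fix f assume "f \<in> {f \<in> spec_space M \<mu> E s. spec_norm M \<mu> E s f \<le> 1}"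
  hence f: "f \<in> l2_space M" and le: "(\<Sum>j<N. w j * l2_norm M (P j f)) \<le> 1" for N
    using spec_norm_le_1_iff by (auto simp: spec_space_def)
  show "f \<in> l2_closure M (absolutely_convex_hull (spec_atoms M \<mu> E s))"
    unfolding l2_closure_def
  proof (intro CollectI conjI allI impI f)
    fix e :: real assume "e > 0"
    then obtain N where N: "l2_norm M (\<lambda>x. f x - (\<Sum>j<N. P j f x)) < e"
      using LIMSEQ_D[OF partial_sums_tendsto[OF f], of e] by force
    obtain h where h: "h \<in> absolutely_convex_hull (spec_atoms M \<mu> E s)"
        "l2_norm M (\<lambda>x. (\<Sum>j<N. P j f x) - h x) = 0"
      using partial_sum_near_hull[OF f le] by blast
    have "l2_norm M (\<lambda>x. f x - h x) \<le> l2_norm M (\<lambda>x. f x - (\<Sum>j<N. P j f x)) + l2_norm M (\<lambda>x. (\<Sum>j<N. P j f x) - h x)"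
      by (intro l2_norm_triangle_diff f l2_space_sum P_l2 hull_norm(1)[OF h(1)])
    thus "\<exists>h\<in>absolutely_convex_hull (spec_atoms M \<mu> E s). l2_norm M (\<lambda>x. f x - h x) < e"
      using h N by (intro bexI[of _ h]) auto
  qed
next
  fix f assume "f \<in> l2_closure M (absolutely_convex_hull (spec_atoms M \<mu> E s))"
  hence f: "f \<in> l2_space M" and close: "\<And>e. e > 0 \<Longrightarrow> \<exists>h\<in>absolutely_convex_hull (spec_atoms M \<mu> E s). l2_norm M (\<lambda>x. f x - h x) < e"
    by (auto simp: l2_closure_def)
  have "(\<Sum>j<N. w j * l2_norm M (P j f)) \<le> 1" for N
  proof (rule field_le_epsilon)
    fix e :: real assume "e > 0"
    \<comment> \<open>A Lipschitz constant of the \<open>N\<close>-th partial sum; the summand 1 makes it positive for \<open>N = 0\<close>.\<close>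
    define K where "K = (\<Sum>j<N. w j) + 1"
    have "K > 0" unfolding K_def using w_pos by (intro add_nonneg_pos sum_nonneg) (auto intro: less_imp_le)
    then obtain h where h: "h \<in> absolutely_convex_hull (spec_atoms M \<mu> E s)" "l2_norm M (\<lambda>x. f x - h x) < e / K"
      using close[of "e / K"] \<open>e > 0\<close> by auto
    have "(\<Sum>j<N. w j * l2_norm M (P j f)) \<le> (\<Sum>j<N. w j * (l2_norm M (P j h) + e / K))"
    proof (intro sum_mono mult_left_mono)
      fix j show "l2_norm M (P j f) \<le> l2_norm M (P j h) + e / K"
        using P_norm_le_add[OF f hull_norm(1)[OF h(1)], of j] h(2) by linarith
      show "0 \<le> w j" using w_pos[of j] by simp
    qed
    also have "\<dots> = (\<Sum>j<N. w j * l2_norm M (P j h)) + (\<Sum>j<N. w j) * (e / K)"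
      unfolding distrib_left sum.distrib sum_distrib_right ..
    also have "(\<Sum>j<N. w j) * (e / K) \<le> K * (e / K)"
      using \<open>e > 0\<close> \<open>K > 0\<close> by (intro mult_right_mono) (auto simp: K_def)
    also have "\<dots> = e" using \<open>K > 0\<close> by simp
    finally show "(\<Sum>j<N. w j * l2_norm M (P j f)) \<le> 1 + e"
      using hull_norm(2)[OF h(1), of N] by linarith
  qed
  hence "spec_norm M \<mu> E s f \<le> 1" using spec_norm_le_1_iff by blast
  moreover from this have "spec_norm M \<mu> E s f < \<infinity>" by (rule le_less_trans) simp
  ultimately show "f \<in> {f \<in> spec_space M \<mu> E s. spec_norm M \<mu> E s f \<le> 1}"
    using f by (simp add: spec_space_def)
qed

theorem spec_norm_le_sb_norm:
  assumes f: "f \<in> l2_space M" and B: "B \<in> eigenbases M E"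
  shows "spec_norm M \<mu> E s f \<le> sb_norm M \<mu> E s B f"
  unfolding spec_norm_def sb_norm_def
proof (intro suminf_le allI ennreal_leI mult_left_mono)
  fix j
  show "l2_norm M (P j f) \<le> (\<Sum>l=1..l2_dim M (E j). \<bar>l2_inner M f (B j l)\<bar>)"
    using B by (intro l2_norm_proj_le_sum[OF finite_dim _ f]) (simp add: eigenbases_def)
qed auto

theorem spec_norm_attained:
  assumes f: "f \<in> l2_space M"
  shows "\<exists>B\<in>eigenbases M E. spec_norm M \<mu> E s f = sb_norm M \<mu> E s B f"
proof -
  have "\<forall>j. \<exists>b. l2_orthonormal_basis M (E j) (l2_dim M (E j)) b \<and>
      l2_norm M (P j f) = (\<Sum>l=1..l2_dim M (E j). \<bar>l2_inner M f (b l)\<bar>)"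
    using l2_norm_proj_eq_adapted_basis[OF finite_dim f] by metis
  then obtain B where B: "\<And>j. l2_orthonormal_basis M (E j) (l2_dim M (E j)) (B j)"
    "\<And>j. l2_norm M (P j f) = (\<Sum>l=1..l2_dim M (E j). \<bar>l2_inner M f (B j l)\<bar>)" by metis
  thus ?thesis unfolding spec_norm_def sb_norm_def
    by (intro bexI[of _ B]) (auto simp: eigenbases_def)
qed

end

section \<open>Smooth functions on a closed manifold\<close>

text \<open>The extension is smooth on \<open>S\<close> and, being zero, on the complement of \<open>K\<close>; these two open sets cover the
  space.\<close>

lemma Ck_on_zero_extension:
  fixes h :: "'a::real_normed_vector \<Rightarrow> real"
  assumes "open S" "closed K" "K \<subseteq> S" "Ck_on k S h" "\<And>x. x \<in> S \<Longrightarrow> x \<notin> K \<Longrightarrow> h x = 0"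
  shows "Ck_on k UNIV (\<lambda>x. if x \<in> S then h x else 0)"
proof -
  let ?e = "\<lambda>x. if x \<in> S then h x else 0"
  have K: "open (- K)" using assms(2) by (rule open_Compl)
  have "Ck_on k S ?e" using assms(4) by (subst Ck_on_cong[OF assms(1), of _ h]) auto
  moreover have "Ck_on k (- K) ?e"
    using Ck_on_const[OF K, of k 0] assms(5) by (subst Ck_on_cong[OF K, of _ "\<lambda>_. 0"]) auto
  ultimately have "Ck_on k (S \<union> - K) ?e" by (rule Ck_on_Un[OF assms(1) K])
  moreover have "S \<union> - K = UNIV" using assms(3) by auto
  ultimately show ?thesis by simp
qed

locale closed_atlas =
  fixes A :: "('m::t2_space, 'n::finite) chart set"
  assumes atlas: "smooth_atlas A" and compact_M: "compact (UNIV :: 'm set)"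
begin

abbreviation U :: "('m, 'n) chart \<Rightarrow> 'm set" where "U c \<equiv> fst c"
abbreviation X :: "('m, 'n) chart \<Rightarrow> 'm \<Rightarrow> real^'n" where "X c \<equiv> snd c"
abbreviation Y :: "('m, 'n) chart \<Rightarrow> real^'n \<Rightarrow> 'm" where "Y c \<equiv> chart_inv c"
abbreviation Om :: "('m, 'n) chart \<Rightarrow> (real^'n) set" where "Om c \<equiv> snd c ` fst c"
abbreviation D :: "('m \<Rightarrow> real) set" where "D \<equiv> smooth_functions A"

lemma cover: "\<exists>c\<in>A. p \<in> U c"
proof -
  have "p \<in> (\<Union>c\<in>A. fst c)" using atlas by (simp add: smooth_atlas_def)
  thus ?thesis by blast
qed

lemma
  assumes c: "c \<in> A"
  shows U_open: "open (U c)" and Om_open: "open (Om c)"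
    and YX: "p \<in> U c \<Longrightarrow> Y c (X c p) = p" and XY: "z \<in> Om c \<Longrightarrow> X c (Y c z) = z"
    and Y_in: "z \<in> Om c \<Longrightarrow> Y c z \<in> U c"
    and X_cont: "continuous_on (U c) (X c)" and Y_cont: "continuous_on (Om c) (Y c)"
proof -
  have "is_chart c" using atlas c by (simp add: smooth_atlas_def)
  hence *: "open (U c)" "open (Om c)" "homeomorphism (U c) (Om c) (X c) (Y c)" by (auto simp: is_chart_def)
  show "open (U c)" "open (Om c)" by fact+
  show yx: "p \<in> U c \<Longrightarrow> Y c (X c p) = p" for p using *(3) by (simp add: homeomorphism_def)
  show "z \<in> Om c \<Longrightarrow> X c (Y c z) = z" using *(3) by (auto simp: homeomorphism_def)
  show "z \<in> Om c \<Longrightarrow> Y c z \<in> U c" using yx by auto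
  show "continuous_on (U c) (X c)" "continuous_on (Om c) (Y c)" using *(3) by (auto simp: homeomorphism_def)
qed

lemma X_image:
  assumes "c \<in> A" shows "X c ` (U c \<inter> S) = Om c \<inter> Y c -` S"
  using YX[OF assms] by force

lemma X_open:
  assumes c: "c \<in> A" and "open S" shows "open (X c ` (U c \<inter> S))"
  unfolding X_image[OF c] using assms(2) by (rule continuous_open_preimage[OF Y_cont[OF c] Om_open[OF c]])

lemma transition_smooth:
  assumes "c \<in> A" "d \<in> A" shows "Ck_on k (X c ` (U c \<inter> U d)) (X d \<circ> Y c)"
  using atlas assms by (simp add: smooth_atlas_def smooth_on_def)

lemma D_iff: "u \<in> D \<longleftrightarrow> (\<forall>c\<in>A. \<forall>k. Ck_on k (Om c) (\<lambda>z. u (Y c z)))"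
  by (simp add: smooth_functions_def smooth_on_def o_def)

lemma D_Ck: "u \<in> D \<Longrightarrow> c \<in> A \<Longrightarrow> Ck_on k (Om c) (\<lambda>z. u (Y c z))"
  by (simp add: D_iff)

lemma continuous_on_chartwise:
  fixes h :: "'m \<Rightarrow> 'b::topological_space"
  assumes "\<And>c. c \<in> A \<Longrightarrow> continuous_on (Om c) (\<lambda>z. h (Y c z))"
  shows "continuous_on UNIV h"
proof -
  have "continuous_on (U c) h" if c: "c \<in> A" for c
  proof -
    have "continuous_on (U c) (\<lambda>p. h (Y c (X c p)))"
      by (rule continuous_on_compose2[OF assms[OF c] X_cont[OF c]]) auto
    thus ?thesis by (rule continuous_on_eq) (simp add: YX[OF c])
  qed
  hence "continuous_on (\<Union>c\<in>A. U c) h" by (intro continuous_on_open_UN U_open) auto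
  moreover have "(\<Union>c\<in>A. U c) = UNIV" using cover by auto
  ultimately show ?thesis by simp
qed

lemma D_continuous: "u \<in> D \<Longrightarrow> continuous_on UNIV u"
  by (rule continuous_on_chartwise) (rule Ck_on_imp_continuous_on[OF D_Ck])

lemma continuous_bounded:
  fixes u :: "'m \<Rightarrow> real"
  assumes "continuous_on UNIV u" shows "\<exists>B\<ge>0. \<forall>p. \<bar>u p\<bar> \<le> B"
proof -
  have "bounded (range u)" by (intro compact_imp_bounded compact_continuous_image assms compact_M)
  then obtain B where "\<And>p. \<bar>u p\<bar> \<le> B" by (auto simp: bounded_iff)
  thus ?thesis by (metis abs_ge_zero order_trans)
qed

lemma D_const: "(\<lambda>_. a) \<in> D"
  unfolding D_iff by (intro ballI allI Ck_on_const Om_open)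

lemma D_add: "u \<in> D \<Longrightarrow> v \<in> D \<Longrightarrow> (\<lambda>p. u p + v p) \<in> D"
  unfolding D_iff by (intro ballI allI Ck_on_add Om_open) auto

lemma D_mult: "u \<in> D \<Longrightarrow> v \<in> D \<Longrightarrow> (\<lambda>p. u p * v p) \<in> D"
  unfolding D_iff by (intro ballI allI Ck_on_mult Om_open) auto

lemma D_cmult: "u \<in> D \<Longrightarrow> (\<lambda>p. a * u p) \<in> D"
  by (intro D_mult D_const)

lemma D_lin: "u \<in> D \<Longrightarrow> v \<in> D \<Longrightarrow> (\<lambda>p. a * u p + b * v p) \<in> D"
  by (intro D_add D_cmult)

lemma D_sum: "(\<And>i. i \<in> I \<Longrightarrow> u i \<in> D) \<Longrightarrow> (\<lambda>p. \<Sum>i\<in>I. u i p) \<in> D"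
  unfolding D_iff by (intro ballI allI Ck_on_sum Om_open) auto

lemma D_prod: "(\<And>i. i \<in> I \<Longrightarrow> u i \<in> D) \<Longrightarrow> (\<lambda>p. \<Prod>i\<in>I. u i p) \<in> D"
  unfolding D_iff by (intro ballI allI Ck_on_prod Om_open) auto

lemma D_inverse: "u \<in> D \<Longrightarrow> (\<And>p. u p \<noteq> 0) \<Longrightarrow> (\<lambda>p. inverse (u p)) \<in> D"
  unfolding D_iff by (intro ballI allI Ck_on_inverse Om_open) auto

definition bump :: "('m, 'n) chart \<Rightarrow> real^'n \<Rightarrow> real^'n \<Rightarrow> 'm \<Rightarrow> real" where
  "bump c a b p = (if p \<in> U c then box_bump a b (X c p) else 0)"

lemma bump_range: "0 \<le> bump c a b p" "bump c a b p \<le> 1"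
  using box_bump_range[of a b] by (auto simp: bump_def)

lemma bump_pos_iff: "0 < bump c a b p \<longleftrightarrow> p \<in> U c \<and> X c p \<in> box a b"
  using box_bump_pos_iff[of a b "X c p"] by (auto simp: bump_def)

lemma compact_preimage:
  assumes c: "c \<in> A" and K: "K \<subseteq> Om c" "compact K"
  shows "compact (Y c ` K)" "Y c ` K \<subseteq> U c"
  using K Y_in[OF c] by (auto intro!: compact_continuous_image continuous_on_subset[OF Y_cont[OF c]])

lemma bump_support: "c \<in> A \<Longrightarrow> p \<notin> Y c ` cbox a b \<Longrightarrow> bump c a b p = 0"
proof (rule ccontr)
  assume c: "c \<in> A" and p: "p \<notin> Y c ` cbox a b" and "bump c a b p \<noteq> 0"
  hence "0 < bump c a b p" using bump_range(1)[of c a b p] by linarith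
  hence "p \<in> U c" "X c p \<in> cbox a b" using bump_pos_iff box_subset_cbox by blast+
  thus False using p YX[OF c] by (metis imageI)
qed

text \<open>In another chart the bump is a smooth function of the transition map on the overlap and vanishes off
  the compact image of the box. These two regions are open and cover the chart; that the second is open
  uses that compact sets in a Hausdorff space are closed.\<close>

lemma bump_smooth:
  assumes c: "c \<in> A" and ab: "cbox a b \<subseteq> Om c"
  shows "bump c a b \<in> D"
  unfolding D_iff
proof (intro ballI allI)
  fix d k assume d: "d \<in> A"
  let ?K = "Y c ` cbox a b"
  have K: "closed ?K" "?K \<subseteq> U c" using compact_preimage[OF c ab] by (auto intro: compact_imp_closed)
  let ?S = "X d ` (U d \<inter> U c)" and ?T = "X d ` (U d \<inter> - ?K)"
  have S: "open ?S" by (rule X_open[OF d U_open[OF c]])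
  have T: "open ?T" by (rule X_open[OF d]) (use K in auto)
  have "Ck_on k ?S (\<lambda>z. box_bump a b ((X c \<circ> Y d) z))"
    by (rule Ck_on_box_bump[OF S transition_smooth[OF d c]])
  hence 1: "Ck_on k ?S (\<lambda>z. bump c a b (Y d z))"
    by (subst Ck_on_cong[OF S]) (auto simp: bump_def X_image[OF d])
  have 2: "Ck_on k ?T (\<lambda>z. bump c a b (Y d z))"
    using Ck_on_const[OF T, of k 0]
    by (subst Ck_on_cong[OF T, of _ "\<lambda>_. 0"]) (auto simp: X_image[OF d] bump_support[OF c])
  have "?S \<union> ?T = Om d" using K(2) by blast
  thus "Ck_on k (Om d) (\<lambda>z. bump c a b (Y d z))" using Ck_on_Un[OF S T 1 2] by simp
qed

lemma bump_in_neighbourhood: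
  assumes c: "c \<in> A" and N: "open N" "p \<in> N" and p: "p \<in> U c"
  obtains a b where "cbox a b \<subseteq> Om c" "Y c ` cbox a b \<subseteq> N" "X c p \<in> box a b"
proof -
  have "open (X c ` (U c \<inter> N))" "X c p \<in> X c ` (U c \<inter> N)" using X_open[OF c N(1)] N p by auto
  then obtain a b where ab: "X c p \<in> box a b" "cbox a b \<subseteq> X c ` (U c \<inter> N)"
    using open_contains_cbox[of "X c ` (U c \<inter> N)" "X c p"] by metis
  show ?thesis
  proof (rule that[OF _ _ ab(1)])
    show "cbox a b \<subseteq> Om c" "Y c ` cbox a b \<subseteq> N" using ab(2) unfolding X_image[OF c] by auto
  qed
qed

text \<open>Finitely many bumps are positive somewhere at each point, and dividing by their sum is a smooth
  operation.\<close>

lemma partition_of_unity: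
  obtains P :: "'m set" and \<eta> :: "'m \<Rightarrow> 'm \<Rightarrow> real" and C :: "'m \<Rightarrow> ('m, 'n) chart" and K :: "'m \<Rightarrow> 'm set"
  where "finite P" "\<And>p. C p \<in> A" "\<And>p. p \<in> P \<Longrightarrow> \<eta> p \<in> D" "\<And>p. compact (K p)" "\<And>p. K p \<subseteq> U (C p)"
    "\<And>p q. p \<in> P \<Longrightarrow> 0 \<le> \<eta> p q" "\<And>p q. q \<notin> K p \<Longrightarrow> \<eta> p q = 0" "\<And>q. (\<Sum>p\<in>P. \<eta> p q) = 1"
proof -
  have "\<forall>p. \<exists>c a b. c \<in> A \<and> cbox a b \<subseteq> Om c \<and> p \<in> U c \<and> X c p \<in> box a b"
    using cover bump_in_neighbourhood[OF _ open_UNIV UNIV_I] by metis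
  then obtain C a b where C: "\<And>p. C p \<in> A" "\<And>p. cbox (a p) (b p) \<subseteq> Om (C p)" "\<And>p. p \<in> U (C p)" "\<And>p. X (C p) p \<in> box (a p) (b p)"
    by metis
  define \<beta> where "\<beta> p = bump (C p) (a p) (b p)" for p
  have \<beta>D: "\<beta> p \<in> D" for p unfolding \<beta>_def by (rule bump_smooth[OF C(1,2)])
  have \<beta>0: "0 \<le> \<beta> p q" for p q unfolding \<beta>_def by (rule bump_range)
  have \<beta>p: "0 < \<beta> p p" for p unfolding \<beta>_def bump_pos_iff using C by auto
  have "open {q. 0 < \<beta> p q}" for p
    by (intro open_Collect_less continuous_on_const D_continuous \<beta>D)
  moreover have "UNIV \<subseteq> (\<Union>p\<in>UNIV. {q. 0 < \<beta> p q})" using \<beta>p by auto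
  ultimately obtain P where P: "finite P" "UNIV \<subseteq> (\<Union>p\<in>P. {q. 0 < \<beta> p q})"
    using compactE_image[OF compact_M, of UNIV "\<lambda>p. {q. 0 < \<beta> p q}"] by metis
  define s where "s q = (\<Sum>p\<in>P. \<beta> p q)" for q
  have s: "0 < s q" for q
  proof -
    obtain p where "p \<in> P" "0 < \<beta> p q" using P(2) by auto
    thus ?thesis unfolding s_def using P(1) \<beta>0 by (intro sum_pos2[of _ p]) auto
  qed
  have sD: "s \<in> D" unfolding s_def using \<beta>D by (rule D_sum)
  define \<eta> where "\<eta> p q = \<beta> p q * inverse (s q)" for p q
  have s0: "s q \<noteq> 0" for q using s[of q] by simp
  show ?thesis
  proof (rule that[of P C \<eta> "\<lambda>p. Y (C p) ` cbox (a p) (b p)"])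
    show "\<eta> p \<in> D" for p unfolding \<eta>_def by (intro D_mult \<beta>D D_inverse sD s0)
    show "0 \<le> \<eta> p q" for p q unfolding \<eta>_def using \<beta>0 s by (simp add: less_imp_le)
    show "compact (Y (C p) ` cbox (a p) (b p))" "Y (C p) ` cbox (a p) (b p) \<subseteq> U (C p)" for p
      using compact_preimage[OF C(1,2)] by auto
    show "\<eta> p q = 0" if "q \<notin> Y (C p) ` cbox (a p) (b p)" for p q
      unfolding \<eta>_def \<beta>_def using bump_support[OF C(1) that] by simp
    show "(\<Sum>p\<in>P. \<eta> p q) = 1" for q
      unfolding \<eta>_def sum_distrib_right[symmetric] s_def[symmetric] using s0 by simp
  qed (use P C in auto)
qed

text \<open>Finitely many charts cover the manifold and Euclidean space is second countable, so every open
  set is a countable union of sets on which a bump is positive.\<close>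

lemma open_eq_countable_bumps:
  assumes "open S"
  obtains \<beta> :: "nat \<Rightarrow> 'm \<Rightarrow> real" where "\<And>k. \<beta> k \<in> D" "\<And>k p. 0 \<le> \<beta> k p" "\<And>k p. \<beta> k p \<le> 1"
    "S = (\<Union>k. {p. 0 < \<beta> k p})"
proof -
  obtain A0 where A0: "A0 \<subseteq> A" "finite A0" "UNIV \<subseteq> (\<Union>c\<in>A0. U c)"
    using compactE_image[OF compact_M, of A U] U_open cover by (metis UNIV_I UN_iff subsetI)
  define Q where "Q c = {box a b | a b. cbox a b \<subseteq> X c ` (U c \<inter> S)}" for c
  have "\<exists>R. R \<subseteq> Q c \<and> countable R \<and> \<Union>R = X c ` (U c \<inter> S)" if c: "c \<in> A" for c
  proof -
    obtain R where R: "R \<subseteq> Q c" "countable R" "\<Union>R = \<Union>(Q c)"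
      by (rule Lindelof[of "Q c"]) (auto simp: Q_def)
    have "\<Union>(Q c) = X c ` (U c \<inter> S)"
    proof (intro equalityI subsetI)
      fix z assume "z \<in> X c ` (U c \<inter> S)"
      then obtain a b where "z \<in> box a b" "cbox a b \<subseteq> X c ` (U c \<inter> S)"
        using open_contains_cbox[of "X c ` (U c \<inter> S)" z] X_open[OF c assms] by metis
      thus "z \<in> \<Union>(Q c)" unfolding Q_def by blast
    next
      fix z assume "z \<in> \<Union>(Q c)"
      then obtain a b where "z \<in> box a b" "cbox a b \<subseteq> X c ` (U c \<inter> S)" unfolding Q_def by blast
      thus "z \<in> X c ` (U c \<inter> S)" using box_subset_cbox by blast
    qed
    with R show ?thesis by metis
  qed
  then obtain R where R: "\<And>c. c \<in> A \<Longrightarrow> R c \<subseteq> Q c" "\<And>c. c \<in> A \<Longrightarrow> countable (R c)"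
      "\<And>c. c \<in> A \<Longrightarrow> \<Union>(R c) = X c ` (U c \<inter> S)" by metis
  have "\<forall>c\<in>A. \<forall>B\<in>R c. \<exists>ab. B = box (fst ab) (snd ab) \<and> cbox (fst ab) (snd ab) \<subseteq> X c ` (U c \<inter> S)"
    using R(1) unfolding Q_def by fastforce
  then obtain ab where ab: "\<And>c B. c \<in> A \<Longrightarrow> B \<in> R c \<Longrightarrow> B = box (fst (ab c B)) (snd (ab c B))"
      "\<And>c B. c \<in> A \<Longrightarrow> B \<in> R c \<Longrightarrow> cbox (fst (ab c B)) (snd (ab c B)) \<subseteq> X c ` (U c \<inter> S)"
    by metis
  define F where "F = insert (\<lambda>_. 0) (\<Union>c\<in>A0. (\<lambda>B. bump c (fst (ab c B)) (snd (ab c B))) ` R c)"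
  have F: "countable F" "F \<noteq> {}" unfolding F_def using A0 R(2)
    by (auto intro!: countable_UN[OF countable_finite] countable_image)
  have FD: "f \<in> D \<and> (\<forall>p. 0 \<le> f p) \<and> (\<forall>p. f p \<le> 1)" if f: "f \<in> F" for f
  proof (cases "f = (\<lambda>_. 0)")
    case True thus ?thesis using D_const[of 0] by simp
  next
    case False
    then obtain c B where cB: "c \<in> A0" "B \<in> R c" "f = bump c (fst (ab c B)) (snd (ab c B))"
      using f unfolding F_def by blast
    have c: "c \<in> A" using cB A0 by auto
    have "cbox (fst (ab c B)) (snd (ab c B)) \<subseteq> Om c" using ab(2)[OF c cB(2)] by auto
    thus ?thesis unfolding cB(3) using bump_smooth[OF c] bump_range by blast
  qed
  have "S = (\<Union>f\<in>F. {p. 0 < f p})"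
  proof (intro equalityI subsetI)
    fix p assume p: "p \<in> S"
    obtain c where c: "c \<in> A0" "p \<in> U c" using A0(3) by blast
    have cA: "c \<in> A" using c A0 by auto
    have "X c p \<in> \<Union>(R c)" unfolding R(3)[OF cA] using p c by blast
    then obtain B where B: "B \<in> R c" "X c p \<in> B" by blast
    have "0 < bump c (fst (ab c B)) (snd (ab c B)) p"
      unfolding bump_pos_iff using c(2) B(2) ab(1)[OF cA B(1)] by simp
    thus "p \<in> (\<Union>f\<in>F. {p. 0 < f p})" unfolding F_def using c(1) B(1) by blast
  next
    fix p assume "p \<in> (\<Union>f\<in>F. {p. 0 < f p})"
    then obtain c B where cB: "c \<in> A0" "B \<in> R c" "0 < bump c (fst (ab c B)) (snd (ab c B)) p"
      unfolding F_def by auto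
    have c: "c \<in> A" using cB A0 by auto
    have pU: "p \<in> U c" and "X c p \<in> box (fst (ab c B)) (snd (ab c B))" using cB(3) bump_pos_iff by auto
    hence "X c p \<in> X c ` (U c \<inter> S)" using ab(2)[OF c cB(2)] box_subset_cbox by blast
    hence "Y c (X c p) \<in> S" unfolding X_image[OF c] by simp
    thus "p \<in> S" using YX[OF c pU] by simp
  qed
  also have "\<dots> = (\<Union>f\<in>range (from_nat_into F). {p. 0 < f p})"
    by (simp only: range_from_nat_into[OF F(2,1)])
  also have "\<dots> = (\<Union>k. {p. 0 < from_nat_into F k p})" by blast
  finally show ?thesis
    using FD from_nat_into[OF F(2)] by (intro that[of "from_nat_into F"]) auto
qed

end

section \<open>The Riemannian measure\<close>

locale closed_riemannian = closed_atlas A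
  for A :: "('m::t2_space, 'n::finite) chart set" +
  fixes g :: "('m, 'n) chart \<Rightarrow> 'm \<Rightarrow> real^'n^'n" and V \<nu> :: "'m measure"
  assumes metric: "riemannian_metric A g" and volume: "riemannian_volume A g V"
    and \<nu>_def: "\<nu> = normalized_measure V"
begin

abbreviation G :: "('m, 'n) chart \<Rightarrow> real^'n \<Rightarrow> real^'n^'n" where "G c z \<equiv> g c (Y c z)"
abbreviation \<rho> :: "('m, 'n) chart \<Rightarrow> real^'n \<Rightarrow> real" where "\<rho> c z \<equiv> sqrt (det (G c z))"

lemma
  assumes c: "c \<in> A" and p: "p \<in> U c"
  shows g_sym: "transpose (g c p) = g c p" and g_pos: "v \<noteq> 0 \<Longrightarrow> v \<bullet> (g c p *v v) > 0"
  using metric c p by (auto simp: riemannian_metric_def)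

lemma det_g_pos: "c \<in> A \<Longrightarrow> p \<in> U c \<Longrightarrow> det (g c p) > 0"
  by (rule posdef_det_pos[OF g_pos])

lemma \<rho>_pos: "c \<in> A \<Longrightarrow> z \<in> Om c \<Longrightarrow> \<rho> c z > 0"
  using det_g_pos Y_in by simp

lemma G_smooth: "c \<in> A \<Longrightarrow> Ck_on k (Om c) (\<lambda>z. G c z $ i $ j)"
proof -
  assume c: "c \<in> A"
  have "Ck_on k (Om c) (\<lambda>z. G c z)"
    using metric c by (simp add: riemannian_metric_def smooth_on_def o_def)
  thus ?thesis by (intro Ck_on_vec_nth Om_open c)
qed

lemma \<rho>_smooth:
  assumes c: "c \<in> A" shows "Ck_on k (Om c) (\<rho> c)"
  using det_g_pos[OF c] Y_in[OF c] by (intro Ck_on_sqrt Ck_on_det G_smooth Om_open c) auto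

lemma G_inv_smooth:
  assumes c: "c \<in> A" shows "Ck_on k (Om c) (\<lambda>z. matrix_inv (G c z) $ i $ j)"
proof (rule Ck_on_matrix_inv[OF Om_open[OF c] G_smooth[OF c]])
  fix z assume "z \<in> Om c"
  thus "det (G c z) \<noteq> 0" using det_g_pos[OF c] Y_in[OF c] by (metis less_irrefl)
qed

lemma sets_V: "sets V = sets borel" and space_V: "space V = UNIV"
  using volume sets_eq_imp_space_eq[of V borel] by (auto simp: riemannian_volume_def)

lemma emeasure_V:
  assumes c: "c \<in> A" and B: "B \<in> sets borel" "B \<subseteq> U c"
  shows "emeasure V B = (\<integral>\<^sup>+z. ennreal (\<rho> c z) * indicator (X c ` B) z \<partial>lborel)"
  using volume c B by (simp add: riemannian_volume_def)

lemma U_borel: "c \<in> A \<Longrightarrow> U c \<in> sets borel" and Om_borel: "c \<in> A \<Longrightarrow> Om c \<in> sets borel"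
  using U_open Om_open by auto

lemma ext_measurable:
  fixes h :: "real^'n \<Rightarrow> real"
  assumes c: "c \<in> A" and h: "continuous_on (Om c) h"
  shows "(\<lambda>z. if z \<in> Om c then h z else 0) \<in> borel_measurable borel"
  using h Om_borel[OF c] by (intro borel_measurable_continuous_on_if) auto

text \<open>The inverse chart, extended by an arbitrary constant point so that it is Borel measurable on the whole
  Euclidean space.\<close>

definition total_inv :: "('m, 'n) chart \<Rightarrow> real^'n \<Rightarrow> 'm" where
  "total_inv c z = (if z \<in> Om c then Y c z else undefined)"

lemma total_inv_measurable: "c \<in> A \<Longrightarrow> total_inv c \<in> measurable borel borel"
proof (rule borel_measurableI)
  fix S :: "'m set" assume c: "c \<in> A" and S: "open S"
  have "total_inv c -` S \<inter> space borel = (Om c \<inter> Y c -` S) \<union> (if undefined \<in> S then - Om c else {})"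
    by (auto simp: total_inv_def split: if_splits)
  moreover have "Om c \<inter> Y c -` S \<in> sets borel"
    using continuous_open_preimage[OF Y_cont[OF c] Om_open[OF c] S] by simp
  ultimately show "total_inv c -` S \<inter> space borel \<in> sets borel" using Om_borel[OF c] by auto
qed

text \<open>Each point has a neighbourhood on which the density is bounded in coordinates, and finitely many of
  these neighbourhoods cover the manifold.\<close>

lemma emeasure_V_finite: "emeasure V UNIV < \<infinity>"
proof -
  have "\<exists>W. open W \<and> p \<in> W \<and> emeasure V W < \<infinity>" for p
  proof -
    obtain c where c: "c \<in> A" "p \<in> U c" using cover by blast
    obtain a b where ab: "cbox a b \<subseteq> Om c" "X c p \<in> box a b"
      by (rule bump_in_neighbourhood[OF c(1) open_UNIV UNIV_I c(2)])
    define W where "W = {q. 0 < bump c a b q}"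
    have W: "open W" unfolding W_def
      by (intro open_Collect_less continuous_on_const D_continuous bump_smooth c(1) ab(1))
    have XW: "X c ` W \<subseteq> cbox a b" "W \<subseteq> U c"
      unfolding W_def bump_pos_iff using box_subset_cbox by auto
    have "compact (\<rho> c ` cbox a b)"
      by (intro compact_continuous_image continuous_on_subset[OF Ck_on_imp_continuous_on[OF \<rho>_smooth[OF c(1)]] ab(1)]) auto
    from compact_imp_bounded[OF this] obtain B where "\<forall>t\<in>\<rho> c ` cbox a b. norm t \<le> B"
      unfolding bounded_iff by blast
    hence B: "\<rho> c z \<le> B" if "z \<in> cbox a b" for z using that by fastforce
    have "emeasure V W = (\<integral>\<^sup>+z. ennreal (\<rho> c z) * indicator (X c ` W) z \<partial>lborel)"
      using W XW by (intro emeasure_V c) auto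
    also have "\<dots> \<le> (\<integral>\<^sup>+z. ennreal B * indicator (cbox a b) z \<partial>lborel)"
      using XW(1) B by (intro nn_integral_mono) (auto simp: indicator_def intro!: ennreal_leI)
    also have "\<dots> = ennreal B * emeasure lborel (cbox a b)" by (simp add: nn_integral_cmult_indicator)
    also have "\<dots> < \<infinity>" using emeasure_lborel_cbox_finite[of a b] by (simp add: ennreal_mult_less_top)
    finally have "emeasure V W < \<infinity>" .
    moreover have "p \<in> W" unfolding W_def bump_pos_iff using c ab by auto
    ultimately show ?thesis using W by blast
  qed
  then obtain W where W: "\<And>p. open (W p)" "\<And>p. p \<in> W p" "\<And>p. emeasure V (W p) < \<infinity>" by metis
  obtain P where P: "finite P" "UNIV \<subseteq> (\<Union>p\<in>P. W p)"
    using compactE_image[OF compact_M, of UNIV W] W by (metis UNIV_I UN_iff subsetI)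
  have Ws: "W ` P \<subseteq> sets V" using W(1) sets_V by auto
  have "emeasure V UNIV \<le> emeasure V (\<Union>p\<in>P. W p)" using P(2) Ws P(1) by (intro emeasure_mono) auto
  also have "\<dots> \<le> (\<Sum>p\<in>P. emeasure V (W p))" by (rule emeasure_subadditive_finite[OF P(1) Ws])
  also have "\<dots> < \<infinity>" using W(3) P(1) by (simp add: less_top[symmetric])
  finally show ?thesis .
qed

text \<open>The density is positive, so a null set has a Lebesgue null image in every chart, whereas nonempty open
  sets are not null. Two continuous functions that agree almost everywhere are therefore equal.\<close>

lemma emeasure_V_open_pos:
  assumes "open S" "S \<noteq> {}" shows "emeasure V S > 0"
proof -
  obtain p c where p: "p \<in> S" "c \<in> A" "p \<in> U c" using assms cover by blast
  let ?W = "U c \<inter> S"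
  have W: "open ?W" using assms(1) U_open[OF p(2)] by auto
  have XW: "open (X c ` ?W)" "X c p \<in> X c ` ?W" using X_open[OF p(2) assms(1)] p by auto
  have eq: "emeasure V ?W = (\<integral>\<^sup>+z. ennreal (\<rho> c z) * indicator (X c ` ?W) z \<partial>lborel)"
    using W by (intro emeasure_V p) auto
  have m: "(\<lambda>z. ennreal (\<rho> c z) * indicator (X c ` ?W) z) \<in> borel_measurable lborel"
  proof -
    have [measurable]: "X c ` ?W \<in> sets borel" using XW(1) by simp
    have "(\<lambda>z. ennreal (if z \<in> Om c then \<rho> c z else 0) * indicator (X c ` ?W) z) \<in> borel_measurable borel"
      using ext_measurable[OF p(2) Ck_on_imp_continuous_on[OF \<rho>_smooth[OF p(2)]]] XW by measurable
    moreover have "(\<lambda>z. ennreal (if z \<in> Om c then \<rho> c z else 0) * indicator (X c ` ?W) z) = (\<lambda>z. ennreal (\<rho> c z) * indicator (X c ` ?W) z)"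
      by (rule ext) (auto simp: indicator_def)
    ultimately show ?thesis by simp
  qed
  have "emeasure V ?W \<noteq> 0"
  proof
    assume "emeasure V ?W = 0"
    hence "AE z in lborel. ennreal (\<rho> c z) * indicator (X c ` ?W) z = 0"
      unfolding eq by (subst (asm) nn_integral_0_iff_AE[OF m]) auto
    hence "AE z in lborel. z \<notin> X c ` ?W"
    proof eventually_elim
      case (elim z)
      thus ?case using \<rho>_pos[OF p(2), of z] by (auto simp: indicator_def ennreal_eq_0_iff split: if_splits)
    qed
    hence "emeasure lborel (X c ` ?W) = 0"
      using XW(1) AE_iff_measurable[of "X c ` ?W" lborel "\<lambda>z. z \<notin> X c ` ?W"] by auto
    moreover have "emeasure lborel (X c ` ?W) \<noteq> 0"
      using XW open_not_negligible[of "X c ` ?W"] by (auto simp: negligible_iff_emeasure0 emeasure_completion)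
    ultimately show False by simp
  qed
  moreover have "emeasure V ?W \<le> emeasure V S" using W assms(1) sets_V by (intro emeasure_mono) auto
  ultimately show ?thesis by (metis not_gr_zero le_zero_eq)
qed

definition vol :: real where "vol = enn2real (emeasure V UNIV)"

lemma vol: "emeasure V UNIV = ennreal vol" "vol > 0"
proof -
  show "emeasure V UNIV = ennreal vol" using emeasure_V_finite by (simp add: vol_def less_top)
  moreover have "emeasure V UNIV > 0" by (rule emeasure_V_open_pos) auto
  ultimately show "vol > 0" by (metis ennreal_eq_0_iff not_le not_gr_zero)
qed

lemma sets_\<nu> [measurable_cong]: "sets \<nu> = sets borel" and space_\<nu> [simp]: "space \<nu> = UNIV"
  using sets_V space_V by (auto simp: \<nu>_def normalized_measure_def space_scale_measure)

lemma emeasure_\<nu>: "emeasure \<nu> B = ennreal (1 / vol) * emeasure V B"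
proof -
  have "1 / ennreal vol = ennreal (1 / vol)" using vol(2) by (simp add: divide_ennreal[symmetric])
  thus ?thesis by (simp add: \<nu>_def normalized_measure_def space_V vol(1))
qed

lemma \<nu>_finite: "finite_measure \<nu>"
  by (rule finite_measureI) (simp add: emeasure_\<nu> vol(1) ennreal_mult_eq_top_iff)

lemma \<nu>_open_pos: "open S \<Longrightarrow> S \<noteq> {} \<Longrightarrow> emeasure \<nu> S > 0"
  using emeasure_V_open_pos[of S] vol(2) by (simp add: emeasure_\<nu> ennreal_zero_less_mult_iff)

lemma continuous_measurable:
  fixes u :: "'m \<Rightarrow> real"
  shows "continuous_on UNIV u \<Longrightarrow> u \<in> borel_measurable \<nu>"
  using borel_measurable_continuous_onI by (simp add: measurable_cong_sets[OF sets_\<nu> refl])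

lemma continuous_integrable:
  fixes u :: "'m \<Rightarrow> real"
  assumes "continuous_on UNIV u" shows "integrable \<nu> u"
proof -
  obtain B where "\<And>p. \<bar>u p\<bar> \<le> B" using continuous_bounded[OF assms] by blast
  thus ?thesis
    by (intro finite_measure.integrable_const_bound[OF \<nu>_finite, of _ B] continuous_measurable assms) auto
qed

lemma continuous_l2: "continuous_on UNIV u \<Longrightarrow> u \<in> l2_space \<nu>"
  unfolding l2_space_def by (auto intro!: continuous_measurable continuous_integrable continuous_on_power)

lemma D_l2_space: "u \<in> D \<Longrightarrow> u \<in> l2_space \<nu>"
  by (intro continuous_l2 D_continuous)

definition dens :: "('m, 'n) chart \<Rightarrow> real^'n \<Rightarrow> real" where
  "dens c z = (if z \<in> Om c then \<rho> c z / vol else 0)"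

lemma dens_nonneg: "c \<in> A \<Longrightarrow> 0 \<le> dens c z"
  using \<rho>_pos[of c z] vol(2) by (auto simp: dens_def)

lemma dens_measurable: "c \<in> A \<Longrightarrow> dens c \<in> borel_measurable borel"
proof -
  assume c: "c \<in> A"
  have "(\<lambda>z. (if z \<in> Om c then \<rho> c z else 0) / vol) \<in> borel_measurable borel"
    using ext_measurable[OF c Ck_on_imp_continuous_on[OF \<rho>_smooth[OF c]]] by measurable
  moreover have "(\<lambda>z. (if z \<in> Om c then \<rho> c z else 0) / vol) = dens c" by (auto simp: dens_def)
  ultimately show ?thesis by simp
qed

text \<open>The Riemannian volume is given by its values on Borel subsets of charts. Stated as an identity of
  image measures, this transfers integrals of arbitrary functions to coordinates.\<close>

lemma chart_measure:
  assumes c: "c \<in> A"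
  shows "density \<nu> (indicator (U c)) = distr (density lborel (\<lambda>z. ennreal (dens c z))) borel (total_inv c)"
proof (rule measure_eqI)
  fix B assume "B \<in> sets (density \<nu> (indicator (U c)))"
  hence B: "B \<in> sets borel" using sets_\<nu> by simp
  note [measurable] = dens_measurable[OF c] total_inv_measurable[OF c]
  have BU: "B \<inter> U c \<in> sets borel" using B U_borel[OF c] by auto
  have img: "X c ` (B \<inter> U c) = Om c \<inter> total_inv c -` B"
    using X_image[OF c, of B] by (auto simp: total_inv_def Int_commute)
  have "emeasure (density \<nu> (indicator (U c))) B = (\<integral>\<^sup>+p. indicator (U c) p * indicator B p \<partial>\<nu>)"
    using B U_borel[OF c] by (subst emeasure_density) (auto simp: measurable_cong_sets[OF sets_\<nu> refl])
  also have "\<dots> = (\<integral>\<^sup>+p. indicator (B \<inter> U c) p \<partial>\<nu>)"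
    by (intro nn_integral_cong) (auto simp: indicator_def)
  also have "\<dots> = ennreal (1 / vol) * emeasure V (B \<inter> U c)" using BU sets_\<nu> by (simp add: emeasure_\<nu>)
  also have "emeasure V (B \<inter> U c) = (\<integral>\<^sup>+z. ennreal (\<rho> c z) * indicator (X c ` (B \<inter> U c)) z \<partial>lborel)"
    using BU by (intro emeasure_V c) auto
  also have "\<dots> = (\<integral>\<^sup>+z. ennreal (if z \<in> Om c then \<rho> c z else 0) * indicator (total_inv c -` B) z \<partial>lborel)"
    unfolding img by (intro nn_integral_cong) (auto simp: indicator_def)
  also have "ennreal (1 / vol) * \<dots> = (\<integral>\<^sup>+z. ennreal (1 / vol) * (ennreal (if z \<in> Om c then \<rho> c z else 0) * indicator (total_inv c -` B) z) \<partial>lborel)"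
  proof (rule nn_integral_cmult[symmetric])
    have "total_inv c -` B \<in> sets borel" using measurable_sets[OF total_inv_measurable[OF c] B] by simp
    thus "(\<lambda>z. ennreal (if z \<in> Om c then \<rho> c z else 0) * indicator (total_inv c -` B) z) \<in> borel_measurable lborel"
      using ext_measurable[OF c Ck_on_imp_continuous_on[OF \<rho>_smooth[OF c]]] by measurable
  qed
  also have "\<dots> = (\<integral>\<^sup>+z. ennreal (dens c z) * indicator (total_inv c -` B) z \<partial>lborel)"
    using vol(2) by (intro nn_integral_cong) (auto simp: dens_def indicator_def ennreal_mult'[symmetric])
  also have "\<dots> = emeasure (density lborel (\<lambda>z. ennreal (dens c z))) (total_inv c -` B)"
    using measurable_sets[OF total_inv_measurable[OF c] B] by (subst emeasure_density) auto
  also have "\<dots> = emeasure (distr (density lborel (\<lambda>z. ennreal (dens c z))) borel (total_inv c)) B"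
    using B by (subst emeasure_distr) auto
  finally show "emeasure (density \<nu> (indicator (U c))) B = \<dots>" .
qed (use sets_\<nu> in simp)

lemma chart_integral:
  fixes h :: "'m \<Rightarrow> real"
  assumes c: "c \<in> A" and h: "h \<in> borel_measurable borel" "\<And>p. p \<notin> U c \<Longrightarrow> h p = 0"
  shows "(LINT p|\<nu>. h p) = (LINT z|lborel. (if z \<in> Om c then \<rho> c z * h (Y c z) else 0)) / vol"
proof -
  note [measurable] = dens_measurable[OF c] total_inv_measurable[OF c] U_borel[OF c] h(1)
  have "(LINT p|\<nu>. h p) = (LINT p|\<nu>. indicator (U c) p *\<^sub>R h p)"
    using h(2) by (intro Bochner_Integration.integral_cong) (auto simp: indicator_def)
  also have "\<dots> = (LINT p|density \<nu> (indicator (U c)). h p)"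
    using integral_density[of h \<nu> "indicator (U c)"] U_borel[OF c] h(1)
    by (simp add: measurable_cong_sets[OF sets_\<nu> refl] ennreal_indicator)
  also have "\<dots> = (LINT z|density lborel (\<lambda>z. ennreal (dens c z)). h (total_inv c z))"
    unfolding chart_measure[OF c] by (rule integral_distr) auto
  also have "\<dots> = (LINT z|lborel. dens c z *\<^sub>R h (total_inv c z))"
    by (rule integral_density) (auto simp: dens_nonneg[OF c])
  also have "\<dots> = (LINT z|lborel. (if z \<in> Om c then \<rho> c z * h (Y c z) else 0) / vol)"
    by (intro Bochner_Integration.integral_cong) (auto simp: dens_def total_inv_def)
  finally show ?thesis by simp
qed

end

section \<open>The Dirichlet form and Green's formula\<close>

lemma partial_deriv_cong:
  assumes "open S" "x \<in> S" "f differentiable (at x)" "\<And>y. y \<in> S \<Longrightarrow> f y = g y"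
  shows "partial_deriv i f x = partial_deriv i g x"
proof -
  have "(g has_derivative frechet_derivative f (at x)) (at x)"
    by (rule has_derivative_transform_within_open[of f]) (use assms frechet_derivative_works in auto)
  from frechet_derivative_at[OF this] show ?thesis unfolding partial_deriv_def by (simp only:)
qed

lemma partial_deriv_zero:
  assumes "open S" "x \<in> S" "\<And>y. y \<in> S \<Longrightarrow> f y = 0"
  shows "partial_deriv i f x = 0"
proof -
  have "partial_deriv i (\<lambda>_. 0) x = partial_deriv i f x"
    by (rule partial_deriv_cong[OF assms(1,2)]) (use assms(3) in auto)
  thus ?thesis by (simp add: partial_deriv_def frechet_derivative_const)
qed

lemma partial_deriv_mult:
  assumes "f differentiable (at x)" "h differentiable (at x)"
  shows "partial_deriv i (\<lambda>y. f y * h y) x = f x * partial_deriv i h x + partial_deriv i f x * h x"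
proof -
  have "((\<lambda>y. f y * h y) has_derivative (\<lambda>v. f x * frechet_derivative h (at x) v + frechet_derivative f (at x) v * h x)) (at x)"
    by (rule has_derivative_mult) (use assms frechet_derivative_works in auto)
  from frechet_derivative_at[OF this] show ?thesis unfolding partial_deriv_def by metis
qed

lemma partial_deriv_lin:
  assumes "f differentiable (at x)" "h differentiable (at x)"
  shows "partial_deriv i (\<lambda>y. a * f y + b * h y) x = a * partial_deriv i f x + b * partial_deriv i h x"
proof -
  have "((\<lambda>y. a * f y + b * h y) has_derivative (\<lambda>v. a * frechet_derivative f (at x) v + b * frechet_derivative h (at x) v)) (at x)"
    by (intro has_derivative_add has_derivative_mult_right) (use assms frechet_derivative_works in auto)
  from frechet_derivative_at[OF this] show ?thesis unfolding partial_deriv_def by metis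
qed

lemma Ck_on_differentiable: "Ck_on (Suc k) S f \<Longrightarrow> x \<in> S \<Longrightarrow> f differentiable (at x)"
  by simp

context closed_riemannian begin

definition grad :: "('m, 'n) chart \<Rightarrow> ('m \<Rightarrow> real) \<Rightarrow> real^'n \<Rightarrow> real^'n" where
  "grad c u z = (\<chi> i. partial_deriv i (\<lambda>y. u (Y c y)) z)"

text \<open>The Riemannian inner product of the gradients of \<open>u\<close> and \<open>v\<close>, in coordinates.\<close>

definition Gam :: "('m, 'n) chart \<Rightarrow> ('m \<Rightarrow> real) \<Rightarrow> ('m \<Rightarrow> real) \<Rightarrow> real^'n \<Rightarrow> real" where
  "Gam c u v z = grad c u z \<bullet> (matrix_inv (G c z) *v grad c v z)"

text \<open>The \<open>i\<close>-th component of the Riemannian gradient of \<open>u\<close>, times the volume density.\<close>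

definition flux :: "('m, 'n) chart \<Rightarrow> ('m \<Rightarrow> real) \<Rightarrow> 'n \<Rightarrow> real^'n \<Rightarrow> real" where
  "flux c u i z = \<rho> c z * (\<Sum>j\<in>UNIV. matrix_inv (G c z) $ i $ j * partial_deriv j (\<lambda>y. u (Y c y)) z)"

definition divflux :: "('m, 'n) chart \<Rightarrow> ('m \<Rightarrow> real) \<Rightarrow> real^'n \<Rightarrow> real" where
  "divflux c u z = (\<Sum>i\<in>UNIV. partial_deriv i (flux c u i) z)"

definition lap :: "('m, 'n) chart \<Rightarrow> ('m \<Rightarrow> real) \<Rightarrow> real^'n \<Rightarrow> real" where
  "lap c u z = inverse (\<rho> c z) * divflux c u z"

lemma chart_laplacian_eq: "chart_laplacian g c u p = lap c u (X c p)"
  by (simp add: chart_laplacian_def Let_def lap_def divflux_def flux_def[abs_def] o_def inverse_eq_divide)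

lemma Gam_flux: "\<rho> c z * (grad c v z \<bullet> (matrix_inv (G c z) *v grad c u z)) = (\<Sum>i\<in>UNIV. flux c u i z * partial_deriv i (\<lambda>y. v (Y c y)) z)"
  by (simp add: grad_def flux_def inner_vec_def matrix_vector_mult_def sum_distrib_left mult_ac)

context
  fixes c assumes c: "c \<in> A"
begin

lemma Gam_sym: "z \<in> Om c \<Longrightarrow> Gam c u v z = Gam c v u z"
  unfolding Gam_def using g_sym[OF c] g_pos[OF c] Y_in[OF c] by (intro posdef_inv_sym) auto

lemma Gam_nonneg: "z \<in> Om c \<Longrightarrow> 0 \<le> Gam c u u z"
  unfolding Gam_def using g_sym[OF c] g_pos[OF c] Y_in[OF c] by (intro posdef_inv_nonneg) auto

lemma partial_smooth: "u \<in> D \<Longrightarrow> Ck_on k (Om c) (partial_deriv i (\<lambda>y. u (Y c y)))"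
  by (intro Ck_on_partial_deriv D_Ck c)

lemma D_differentiable: "u \<in> D \<Longrightarrow> z \<in> Om c \<Longrightarrow> (\<lambda>y. u (Y c y)) differentiable (at z)"
  by (rule Ck_on_differentiable[OF D_Ck[OF _ c, of _ 1, unfolded One_nat_def]])

lemma flux_smooth: "u \<in> D \<Longrightarrow> Ck_on k (Om c) (flux c u i)"
  unfolding flux_def[abs_def]
  by (intro Ck_on_mult Ck_on_sum Om_open c \<rho>_smooth G_inv_smooth partial_smooth)

lemma flux_differentiable: "u \<in> D \<Longrightarrow> z \<in> Om c \<Longrightarrow> flux c u i differentiable (at z)"
  by (rule Ck_on_differentiable[OF flux_smooth[of _ 1, unfolded One_nat_def]])

lemma divflux_smooth: "u \<in> D \<Longrightarrow> Ck_on k (Om c) (divflux c u)"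
  unfolding divflux_def[abs_def] by (intro Ck_on_sum Om_open c Ck_on_partial_deriv flux_smooth)

lemma lap_smooth: "u \<in> D \<Longrightarrow> Ck_on k (Om c) (lap c u)"
  unfolding lap_def[abs_def] using \<rho>_pos[OF c]
  by (intro Ck_on_mult Ck_on_inverse Om_open c \<rho>_smooth divflux_smooth) (metis less_irrefl)

lemma Gam_smooth: "u \<in> D \<Longrightarrow> v \<in> D \<Longrightarrow> Ck_on k (Om c) (Gam c u v)"
proof -
  assume u: "u \<in> D" and v: "v \<in> D"
  have "Ck_on k (Om c) (\<lambda>z. \<Sum>i\<in>UNIV. partial_deriv i (\<lambda>y. u (Y c y)) z * (\<Sum>j\<in>UNIV. matrix_inv (G c z) $ i $ j * partial_deriv j (\<lambda>y. v (Y c y)) z))"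
    by (intro Ck_on_mult Ck_on_sum Om_open c G_inv_smooth partial_smooth u v)
  moreover have "(\<lambda>z. \<Sum>i\<in>UNIV. partial_deriv i (\<lambda>y. u (Y c y)) z * (\<Sum>j\<in>UNIV. matrix_inv (G c z) $ i $ j * partial_deriv j (\<lambda>y. v (Y c y)) z)) = Gam c u v"
    by (rule ext) (simp add: Gam_def grad_def inner_vec_def matrix_vector_mult_def)
  ultimately show ?thesis by simp
qed

lemma grad_lin: "u \<in> D \<Longrightarrow> v \<in> D \<Longrightarrow> z \<in> Om c \<Longrightarrow> grad c (\<lambda>p. a * u p + b * v p) z = a *\<^sub>R grad c u z + b *\<^sub>R grad c v z"
  by (simp add: grad_def vec_eq_iff partial_deriv_lin D_differentiable)

lemma grad_zero:
  assumes K: "compact K" "K \<subseteq> U c" and v: "\<And>p. p \<notin> K \<Longrightarrow> v p = 0" and z: "z \<in> Om c" "Y c z \<notin> K"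
  shows "partial_deriv i (\<lambda>y. v (Y c y)) z = 0" "grad c v z = 0"
proof -
  have "open (- K)" using compact_imp_closed[OF K(1)] by (rule open_Compl)
  hence "open (Om c \<inter> Y c -` (- K))" by (rule continuous_open_preimage[OF Y_cont[OF c] Om_open[OF c]])
  hence *: "partial_deriv i (\<lambda>y. v (Y c y)) z = 0" for i
    by (rule partial_deriv_zero) (use v z in auto)
  show "partial_deriv i (\<lambda>y. v (Y c y)) z = 0" "grad c v z = 0" by (simp_all add: grad_def vec_eq_iff *)
qed

lemma image_compact: "compact K \<Longrightarrow> K \<subseteq> U c \<Longrightarrow> compact (X c ` K)"
  using X_cont[OF c] by (intro compact_continuous_image) (auto intro: continuous_on_subset)

lemma in_image_iff: "K \<subseteq> U c \<Longrightarrow> z \<in> Om c \<Longrightarrow> z \<in> X c ` K \<longleftrightarrow> Y c z \<in> K"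
proof
  assume K: "K \<subseteq> U c" and z: "z \<in> Om c"
  assume "z \<in> X c ` K" thus "Y c z \<in> K" using K YX[OF c] by auto
next
  assume z: "z \<in> Om c" and "Y c z \<in> K"
  hence "X c (Y c z) \<in> X c ` K" by (intro imageI)
  thus "z \<in> X c ` K" using XY[OF c z] by simp
qed

text \<open>The field \<open>v\<close> times the flux of \<open>u\<close> is supported in \<open>K\<close>, so its extension by zero to the whole
  Euclidean space is of class \<open>C\<^sup>1\<close> and its divergence has integral zero. The density \<open>\<rho>\<close> of the volume
  cancels the factor \<open>1 / \<rho>\<close> in the Laplacian.\<close>

lemma integration_by_parts_coordinates:
  assumes K: "compact K" "K \<subseteq> U c" and v: "v \<in> D" "\<And>p. p \<notin> K \<Longrightarrow> v p = 0" and u: "u \<in> D"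
  shows "(LINT z|lborel. (if z \<in> Om c then \<rho> c z * (lap c u z * v (Y c z)) else 0)) =
     - (LINT z|lborel. (if z \<in> Om c then \<rho> c z * Gam c u v z else 0))"
proof -
  let ?K = "X c ` K"
  have K': "compact ?K" "closed ?K" "?K \<subseteq> Om c"
    using image_compact[OF K] K(2) by (auto intro: compact_imp_closed)
  have vK: "v (Y c z) = 0" if "z \<in> Om c" "z \<notin> ?K" for z
    using that v(2) in_image_iff[OF K(2)] by auto
  have gK: "partial_deriv i (\<lambda>y. v (Y c y)) z = 0" "grad c v z = 0" if "z \<in> Om c" "z \<notin> ?K" for z i
    using grad_zero[OF K v(2) that(1)] that in_image_iff[OF K(2)] by auto
  define e where "e h z = (if z \<in> Om c then h z else 0)" for h :: "real^'n \<Rightarrow> real" and z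
  have ext: "Ck_on k UNIV (e h)" if "Ck_on k (Om c) h" "\<And>z. z \<in> Om c \<Longrightarrow> z \<notin> ?K \<Longrightarrow> h z = 0" for k h
    unfolding e_def[abs_def] by (rule Ck_on_zero_extension[OF Om_open[OF c] K'(2,3) that])
  have ext0: "e h z = 0" if "z \<notin> ?K" "\<And>z. z \<in> Om c \<Longrightarrow> z \<notin> ?K \<Longrightarrow> h z = 0" for h z
    using that by (simp add: e_def)
  have int: "integrable lborel (e h)" if h: "Ck_on 0 (Om c) h" "\<And>z. z \<in> Om c \<Longrightarrow> z \<notin> ?K \<Longrightarrow> h z = 0" for h
  proof (rule continuous_compact_support_integrable[OF _ K'(1)])
    show "continuous_on UNIV (e h)" using ext[OF h] by simp
    show "e h z = 0" if "z \<notin> ?K" for z by (rule ext0[OF that h(2)])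
  qed
  define f where "f i = e (\<lambda>z. flux c u i z * v (Y c z))" for i
  have f: "C1_supported ?K (f i)" for i
    unfolding C1_supported_def f_def using vK K'(1)
    by (auto simp del: Ck_on.simps intro!: ext ext0 Ck_on_mult Om_open c flux_smooth u D_Ck v)
  have df: "partial_deriv i (f i) z = e (\<lambda>z. partial_deriv i (flux c u i) z * v (Y c z)) z
      + e (\<lambda>z. flux c u i z * partial_deriv i (\<lambda>y. v (Y c y)) z) z" for i z
  proof (cases "z \<in> Om c")
    case True
    have diff: "(\<lambda>z. flux c u i z * v (Y c z)) differentiable (at z)"
      by (intro differentiable_mult flux_differentiable D_differentiable u v True)
    have "partial_deriv i (\<lambda>z. flux c u i z * v (Y c z)) z = partial_deriv i (f i) z"
      by (rule partial_deriv_cong[OF Om_open[OF c] True diff]) (simp add: f_def e_def)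
    thus ?thesis using True
      by (simp add: e_def partial_deriv_mult flux_differentiable D_differentiable u v)
  next
    case False
    hence "z \<notin> ?K" using K'(3) by auto
    thus ?thesis using C1_derivative_zero[OF f] False by (simp add: partial_deriv_def e_def)
  qed
  have s1: "e (\<lambda>z. divflux c u z * v (Y c z)) z = (\<Sum>i\<in>UNIV. e (\<lambda>z. partial_deriv i (flux c u i) z * v (Y c z)) z)" for z
    by (simp add: e_def divflux_def sum_distrib_right)
  have s2: "e (\<lambda>z. \<rho> c z * Gam c u v z) z = (\<Sum>i\<in>UNIV. e (\<lambda>z. flux c u i z * partial_deriv i (\<lambda>y. v (Y c y)) z) z)" for z
    using Gam_sym[of z u v] Gam_flux[of c z v u] by (simp add: e_def Gam_def)
  have "0 = (\<Sum>i\<in>UNIV. LINT z|lborel. partial_deriv i (f i) z)"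
    unfolding partial_deriv_def using integral_derivative_zero[OF f] by simp
  also have "\<dots> = (LINT z|lborel. (\<Sum>i\<in>UNIV. partial_deriv i (f i) z))"
    unfolding partial_deriv_def by (rule Bochner_Integration.integral_sum[symmetric]) (rule C1_derivative_integrable[OF f])
  also have "\<dots> = (LINT z|lborel. e (\<lambda>z. divflux c u z * v (Y c z)) z + e (\<lambda>z. \<rho> c z * Gam c u v z) z)"
    unfolding df s1 s2 by (simp add: sum.distrib)
  also have "\<dots> = (LINT z|lborel. e (\<lambda>z. divflux c u z * v (Y c z)) z) + (LINT z|lborel. e (\<lambda>z. \<rho> c z * Gam c u v z) z)"
  proof (rule Bochner_Integration.integral_add)
    show "integrable lborel (e (\<lambda>z. divflux c u z * v (Y c z)))"
      by (rule int) (use vK in \<open>auto simp del: Ck_on.simps intro!: Ck_on_mult Om_open c divflux_smooth u D_Ck v\<close>)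
    have "Gam c u v z = 0" if "z \<in> Om c" "z \<notin> ?K" for z
      using gK(2)[OF that] by (simp add: Gam_def)
    thus "integrable lborel (e (\<lambda>z. \<rho> c z * Gam c u v z))"
      by (intro int Ck_on_mult Om_open c \<rho>_smooth Gam_smooth u v) simp
  qed
  also have "(\<lambda>z. e (\<lambda>z. divflux c u z * v (Y c z)) z) = (\<lambda>z. if z \<in> Om c then \<rho> c z * (lap c u z * v (Y c z)) else 0)"
  proof (rule HOL.ext)
    fix z
    have cancel: "r * (inverse r * a * b) = a * b" if "r > 0" for r a b :: real
      using that by simp
    show "e (\<lambda>z. divflux c u z * v (Y c z)) z = (if z \<in> Om c then \<rho> c z * (lap c u z * v (Y c z)) else 0)"
    proof (cases "z \<in> Om c")
      case True
      thus ?thesis by (simp only: e_def lap_def True if_True cancel[OF \<rho>_pos[OF c True]])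
    qed (simp only: e_def if_False)
  qed
  also have "(\<lambda>z. e (\<lambda>z. \<rho> c z * Gam c u v z) z) = (\<lambda>z. if z \<in> Om c then \<rho> c z * Gam c u v z else 0)"
    by (auto simp: e_def)
  finally show ?thesis by linarith
qed

lemma chart_integral_coordinates:
  assumes h: "continuous_on (Om c) h"
  shows "(LINT p|\<nu>. (if p \<in> U c then h (X c p) else 0)) = (LINT z|lborel. (if z \<in> Om c then \<rho> c z * h z else 0)) / vol"
proof -
  have "(LINT p|\<nu>. (if p \<in> U c then h (X c p) else 0))
    = (LINT z|lborel. (if z \<in> Om c then \<rho> c z * (if Y c z \<in> U c then h (X c (Y c z)) else 0) else 0)) / vol"
  proof (rule chart_integral[OF c])
    show "(\<lambda>p. if p \<in> U c then h (X c p) else 0) \<in> borel_measurable borel"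
      using U_borel[OF c] by (intro borel_measurable_continuous_on_if continuous_on_compose2[OF h X_cont[OF c]]) auto
  qed simp
  also have "(\<lambda>z. if z \<in> Om c then \<rho> c z * (if Y c z \<in> U c then h (X c (Y c z)) else 0) else 0) = (\<lambda>z. if z \<in> Om c then \<rho> c z * h z else 0)"
    using Y_in[OF c] XY[OF c] by (auto simp: fun_eq_iff)
  finally show ?thesis .
qed

lemma integration_by_parts:
  assumes K: "compact K" "K \<subseteq> U c" and v: "v \<in> D" "\<And>p. p \<notin> K \<Longrightarrow> v p = 0" and u: "u \<in> D"
  shows "(LINT p|\<nu>. (if p \<in> U c then lap c u (X c p) * v p else 0)) = - (LINT p|\<nu>. (if p \<in> U c then Gam c u v (X c p) else 0))"
proof -
  have "(\<lambda>p. if p \<in> U c then lap c u (X c p) * v p else 0) = (\<lambda>p. if p \<in> U c then lap c u (X c p) * v (Y c (X c p)) else 0)"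
    using YX[OF c] by (auto simp: fun_eq_iff)
  hence "(LINT p|\<nu>. (if p \<in> U c then lap c u (X c p) * v p else 0))
      = (LINT z|lborel. (if z \<in> Om c then \<rho> c z * (lap c u z * v (Y c z)) else 0)) / vol"
    using chart_integral_coordinates[of "\<lambda>z. lap c u z * v (Y c z)"]
      Ck_on_imp_continuous_on[OF lap_smooth[OF u]] Ck_on_imp_continuous_on[OF D_Ck[OF v(1) c]]
    by (simp add: continuous_on_mult)
  also have "\<dots> = - ((LINT z|lborel. (if z \<in> Om c then \<rho> c z * Gam c u v z else 0)) / vol)"
    using integration_by_parts_coordinates[OF K v u] by simp
  also have "(LINT z|lborel. (if z \<in> Om c then \<rho> c z * Gam c u v z else 0)) / vol = (LINT p|\<nu>. (if p \<in> U c then Gam c u v (X c p) else 0))"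
    by (rule chart_integral_coordinates[symmetric]) (rule Ck_on_imp_continuous_on[OF Gam_smooth[OF u v(1)]])
  finally show ?thesis .
qed

text \<open>The function is continuous on the chart domain and, being zero, on the complement of \<open>K\<close>. This
  complement is open because compact subsets of a Hausdorff space are closed.\<close>

lemma zero_extension_continuous:
  assumes K: "compact K" "K \<subseteq> U c" and h: "continuous_on (Om c) h" "\<And>p. p \<in> U c \<Longrightarrow> p \<notin> K \<Longrightarrow> h (X c p) = 0"
  shows "continuous_on UNIV (\<lambda>p. if p \<in> U c then h (X c p) else 0)"
proof -
  let ?e = "\<lambda>p. if p \<in> U c then h (X c p) else 0"
  have "open (- K)" using compact_imp_closed[OF K(1)] by (rule open_Compl)
  moreover have "continuous_on (U c) ?e"
    by (rule continuous_on_eq[OF continuous_on_compose2[OF h(1) X_cont[OF c]]]) auto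
  moreover have "continuous_on (- K) ?e"
    by (rule continuous_on_eq[OF continuous_on_const[of _ 0]]) (use h(2) in auto)
  ultimately have "continuous_on (U c \<union> - K) ?e" using U_open[OF c] by (intro continuous_on_open_Un)
  moreover have "U c \<union> - K = UNIV" using K(2) by auto
  ultimately show ?thesis by simp
qed

end

text \<open>With \<open>J\<close> the Jacobian of a transition map, \<open>grad\<^sub>c u = J\<^sup>T grad\<^sub>d u\<close> and \<open>G\<^sub>c = J\<^sup>T G\<^sub>d J\<close>. If
  \<open>G\<^sub>c w = grad\<^sub>c v\<close>, then \<open>G\<^sub>d (J w) = grad\<^sub>d v\<close>, whence both charts give the same product.\<close>

lemma Gam_chart_independent:
  assumes c: "c \<in> A" and d: "d \<in> A" and p: "p \<in> U c" "p \<in> U d" and u: "u \<in> D" and v: "v \<in> D"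
  shows "Gam c u v (X c p) = Gam d u v (X d p)"
proof -
  let ?z = "X c p" and ?y = "X d p"
  define \<tau> where "\<tau> = X d \<circ> Y c"
  define J where "J = matrix (frechet_derivative \<tau> (at ?z))"
  let ?S = "X c ` (U c \<inter> U d)"
  have S: "open ?S" "?z \<in> ?S" using X_open[OF c U_open[OF d]] p by auto
  have "Ck_on (Suc 0) ?S \<tau>" unfolding \<tau>_def by (rule transition_smooth[OF c d])
  hence d\<tau>: "(\<tau> has_derivative frechet_derivative \<tau> (at ?z)) (at ?z)" using S(2) by (rule Ck_on_Suc_derivative)
  have \<tau>z: "\<tau> ?z = ?y" by (simp add: \<tau>_def YX[OF c p(1)])
  have grad: "grad c w ?z = transpose J *v grad d w ?y" if w: "w \<in> D" for w
  proof -
    have diff: "(\<lambda>y. w (Y d y)) differentiable (at ?y)" by (rule D_differentiable[OF d w]) (use p in auto)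
    hence "((\<lambda>y. w (Y d y)) has_derivative frechet_derivative (\<lambda>y. w (Y d y)) (at ?y)) (at (\<tau> ?z))"
      unfolding \<tau>z by (simp add: frechet_derivative_works)
    from has_derivative_compose[OF d\<tau> this]
    have "((\<lambda>z. w (Y d (\<tau> z))) has_derivative (\<lambda>h. frechet_derivative (\<lambda>y. w (Y d y)) (at ?y) (frechet_derivative \<tau> (at ?z) h))) (at ?z)" .
    moreover have "w (Y d (\<tau> z)) = w (Y c z)" if "z \<in> ?S" for z
      using that YX[OF d] YX[OF c] by (auto simp: \<tau>_def)
    ultimately have "((\<lambda>z. w (Y c z)) has_derivative (\<lambda>h. frechet_derivative (\<lambda>y. w (Y d y)) (at ?y) (frechet_derivative \<tau> (at ?z) h))) (at ?z)"
      by (rule has_derivative_transform_within_open[OF _ S])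
    from frechet_derivative_at[OF this]
    have "partial_deriv i (\<lambda>z. w (Y c z)) ?z = frechet_derivative (\<lambda>y. w (Y d y)) (at ?y) (frechet_derivative \<tau> (at ?z) (axis i 1))" for i
      unfolding partial_deriv_def by metis
    thus ?thesis
      by (simp add: vec_eq_iff grad_def derivative_eq_sum_partial[OF diff] J_def matrix_def matrix_vector_mult_def transpose_def)
  qed
  have law: "g c p = transpose J ** g d p ** J"
  proof -
    have "let J = matrix (frechet_derivative (X d \<circ> Y c) (at ?z)) in g c p = transpose J ** g d p ** J"
      using metric c d p unfolding riemannian_metric_def by blast
    thus ?thesis unfolding Let_def J_def \<tau>_def .
  qed
  have "det (g c p) = det J * det (g d p) * det J" unfolding law by (simp add: det_mul)
  hence "det J \<noteq> 0" using det_g_pos[OF c p(1)] by auto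
  hence inj: "transpose J *v a = transpose J *v b \<Longrightarrow> a = b" for a b
  proof -
    assume eq: "transpose J *v a = transpose J *v b"
    have "invertible (transpose J)" using \<open>det J \<noteq> 0\<close> by (simp add: invertible_det_nz del: transpose_matrix_vector)
    thus "a = b" using eq by (metis inj_matrix_vector_mult injD)
  qed
  let ?a = "grad d u ?y" and ?b = "grad d v ?y"
  define w where "w = matrix_inv (g c p) *v (transpose J *v ?b)"
  have "g c p *v w = transpose J *v ?b"
    unfolding w_def by (rule posdef_inv_right[OF g_sym[OF c p(1)] g_pos[OF c p(1)]])
  hence "transpose J *v (g d p *v (J *v w)) = transpose J *v ?b"
    unfolding law by (simp add: matrix_vector_mul_assoc matrix_mul_assoc del: transpose_matrix_vector)
  hence "g d p *v (J *v w) = ?b" by (rule inj)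
  hence "J *v w = matrix_inv (g d p) *v ?b"
    using matrix_inv_mult(2)[of "g d p"] det_g_pos[OF d p(2)] by (metis less_irrefl matrix_vector_mul_assoc matrix_vector_mul_lid)
  moreover have "(transpose J *v ?a) \<bullet> w = ?a \<bullet> (J *v w)" by (simp add: dot_lmul_matrix)
  ultimately show ?thesis
    unfolding Gam_def grad[OF u] grad[OF v] YX[OF c p(1)] YX[OF d p(2)] w_def by (simp del: transpose_matrix_vector)
qed

definition some_chart :: "'m \<Rightarrow> ('m, 'n) chart" where
  "some_chart p = (SOME c. c \<in> A \<and> p \<in> U c)"

lemma some_chart: "some_chart p \<in> A" "p \<in> U (some_chart p)"
proof -
  have "\<exists>c. c \<in> A \<and> p \<in> U c" using cover by blast
  hence "some_chart p \<in> A \<and> p \<in> U (some_chart p)" unfolding some_chart_def by (rule someI_ex)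
  thus "some_chart p \<in> A" "p \<in> U (some_chart p)" by auto
qed

definition \<Gamma> :: "('m \<Rightarrow> real) \<Rightarrow> ('m \<Rightarrow> real) \<Rightarrow> 'm \<Rightarrow> real" where
  "\<Gamma> u v p = Gam (some_chart p) u v (X (some_chart p) p)"

lemma \<Gamma>_eq: "c \<in> A \<Longrightarrow> p \<in> U c \<Longrightarrow> u \<in> D \<Longrightarrow> v \<in> D \<Longrightarrow> \<Gamma> u v p = Gam c u v (X c p)"
  unfolding \<Gamma>_def by (rule Gam_chart_independent) (auto simp: some_chart)

lemma \<Gamma>_continuous: "u \<in> D \<Longrightarrow> v \<in> D \<Longrightarrow> continuous_on UNIV (\<Gamma> u v)"
proof (rule continuous_on_chartwise)
  fix c assume u: "u \<in> D" and v: "v \<in> D" and c: "c \<in> A"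
  show "continuous_on (Om c) (\<lambda>z. \<Gamma> u v (Y c z))"
    by (rule continuous_on_eq[OF Ck_on_imp_continuous_on[OF Gam_smooth[OF c u v]]])
      (simp only: \<Gamma>_eq[OF c Y_in[OF c] u v] XY[OF c])
qed

lemma \<Gamma>_integrable: "u \<in> D \<Longrightarrow> v \<in> D \<Longrightarrow> integrable \<nu> (\<Gamma> u v)"
  by (intro continuous_integrable \<Gamma>_continuous)

lemma \<Gamma>_sym: "u \<in> D \<Longrightarrow> v \<in> D \<Longrightarrow> \<Gamma> u v p = \<Gamma> v u p"
  unfolding \<Gamma>_def by (rule Gam_sym) (auto simp: some_chart)

lemma \<Gamma>_nonneg: "0 \<le> \<Gamma> u u p"
  unfolding \<Gamma>_def by (rule Gam_nonneg) (auto simp: some_chart)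

lemma \<Gamma>_add_right:
  assumes "u \<in> D" "v \<in> D" "w \<in> D"
  shows "\<Gamma> u (\<lambda>p. v p + w p) p = \<Gamma> u v p + \<Gamma> u w p"
  using grad_lin[OF some_chart(1), of v w "X (some_chart p) p" p 1 1] assms some_chart
  by (simp add: \<Gamma>_def Gam_def matrix_vector_right_distrib inner_add_right)

lemma \<Gamma>_zero_right: "u \<in> D \<Longrightarrow> \<Gamma> u (\<lambda>_. 0) p = 0"
  using \<Gamma>_add_right[of u "\<lambda>_. 0" "\<lambda>_. 0" p] D_const[of 0] by simp

lemma \<Gamma>_sum_right:
  assumes u: "u \<in> D" and "finite I" "\<And>i. i \<in> I \<Longrightarrow> v i \<in> D"
  shows "\<Gamma> u (\<lambda>p. \<Sum>i\<in>I. v i p) p = (\<Sum>i\<in>I. \<Gamma> u (v i) p)"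
  using assms(2,3)
proof (induction I rule: finite_induct)
  case (insert i I)
  thus ?case using \<Gamma>_add_right[OF u, of "v i" "\<lambda>p. \<Sum>i\<in>I. v i p" p] D_sum[of I v] by simp
qed (simp add: \<Gamma>_zero_right[OF u])

lemma integration_by_parts_\<Gamma>:
  assumes c: "c \<in> A" and K: "compact K" "K \<subseteq> U c" and v: "v \<in> D" "\<And>p. p \<notin> K \<Longrightarrow> v p = 0" and u: "u \<in> D"
  shows "(LINT p|\<nu>. (if p \<in> U c then lap c u (X c p) * v p else 0)) = - (LINT p|\<nu>. \<Gamma> u v p)"
proof -
  have "(if p \<in> U c then Gam c u v (X c p) else 0) = \<Gamma> u v p" for p
  proof (cases "p \<in> U c")
    case True thus ?thesis by (simp add: \<Gamma>_eq[OF c True u v(1)])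
  next
    case False
    let ?d = "some_chart p"
    have "open (- K)" using compact_imp_closed[OF K(1)] by (rule open_Compl)
    hence "open (Om ?d \<inter> Y ?d -` (- K))"
      by (rule continuous_open_preimage[OF Y_cont[OF some_chart(1)] Om_open[OF some_chart(1)]])
    hence "grad ?d v (X ?d p) = 0"
      unfolding grad_def vec_eq_iff using False K(2) v(2) some_chart[of p] YX[OF some_chart, of p]
      by (auto intro!: partial_deriv_zero[of "Om ?d \<inter> Y ?d -` (- K)"])
    thus ?thesis using False by (simp add: \<Gamma>_def Gam_def)
  qed
  thus ?thesis using integration_by_parts[OF c K v u] by simp
qed

text \<open>The Laplacian at each point is computed in an arbitrary chart around it, so its chart independence
  is what makes it a continuous function. By integration by parts both chart expressions have the same
  integral against every bump supported in the overlap; if they differed at a point, continuity would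
  contradict this for a bump near that point.\<close>

lemma lap_chart_independent:
  assumes c: "c \<in> A" and d: "d \<in> A" and p: "p \<in> U c" "p \<in> U d" and u: "u \<in> D"
  shows "lap c u (X c p) = lap d u (X d p)"
proof (rule ccontr)
  define h where "h q = lap c u (X c q) - lap d u (X d q)" for q
  assume "lap c u (X c p) \<noteq> lap d u (X d p)"
  hence hp: "h p \<noteq> 0" by (simp add: h_def)
  let ?O = "U c \<inter> U d"
  have O: "open ?O" by (intro open_Int U_open c d)
  have lc: "continuous_on (Om c) (lap c u)" and ld: "continuous_on (Om d) (lap d u)"
    by (rule Ck_on_imp_continuous_on[OF lap_smooth[OF c u]], rule Ck_on_imp_continuous_on[OF lap_smooth[OF d u]])
  have hcont: "continuous_on ?O (\<lambda>q. h p * h q)"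
    unfolding h_def
    by (intro continuous_intros continuous_on_compose2[OF lc continuous_on_subset[OF X_cont[OF c]]]
        continuous_on_compose2[OF ld continuous_on_subset[OF X_cont[OF d]]]) auto
  define N where "N = ?O \<inter> (\<lambda>q. h p * h q) -` {0<..}"
  have N: "open N" unfolding N_def by (rule continuous_open_preimage[OF hcont O]) simp
  have pN: "p \<in> N" using p hp by (auto simp: N_def zero_less_mult_iff linorder_neq_iff)
  obtain a b where ab: "cbox a b \<subseteq> Om c" "Y c ` cbox a b \<subseteq> N" "X c p \<in> box a b"
    by (rule bump_in_neighbourhood[OF c N pN p(1)])
  define v where "v = bump c a b"
  define K where "K = Y c ` cbox a b"
  have v: "v \<in> D" "\<And>q. q \<notin> K \<Longrightarrow> v q = 0" unfolding v_def K_def using bump_smooth[OF c ab(1)] bump_support[OF c] by auto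
  have K: "compact K" "K \<subseteq> N" unfolding K_def using compact_preimage[OF c ab(1)] ab(2) by auto
  have KU: "K \<subseteq> U c" "K \<subseteq> U d" using K(2) by (auto simp: N_def)
  define I where "I e q = (if q \<in> U e then lap e u (X e q) * v q else 0)" for e q
  have Icont: "continuous_on UNIV (I e)" if e: "e \<in> A" "K \<subseteq> U e" for e
  proof -
    have "continuous_on UNIV (\<lambda>q. if q \<in> U e then (\<lambda>z. lap e u z * v (Y e z)) (X e q) else 0)"
      by (rule zero_extension_continuous[OF e(1) K(1) e(2)])
        (use v(2) YX[OF e(1)] Ck_on_imp_continuous_on[OF lap_smooth[OF e(1) u]] Ck_on_imp_continuous_on[OF D_Ck[OF v(1) e(1)]]
         in \<open>auto intro: continuous_on_mult\<close>)
    moreover have "(\<lambda>q. if q \<in> U e then (\<lambda>z. lap e u z * v (Y e z)) (X e q) else 0) = I e"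
      using YX[OF e(1)] by (auto simp: I_def fun_eq_iff)
    ultimately show ?thesis by (simp only:)
  qed
  have "(LINT q|\<nu>. I c q) = (LINT q|\<nu>. I d q)"
    using integration_by_parts_\<Gamma>[OF c K(1) KU(1) v u] integration_by_parts_\<Gamma>[OF d K(1) KU(2) v u]
    unfolding I_def by linarith
  moreover note ci = continuous_integrable[OF Icont[OF c KU(1)]] continuous_integrable[OF Icont[OF d KU(2)]]
  ultimately have int0: "(LINT q|\<nu>. h p * (I c q - I d q)) = 0" by simp
  have pos: "0 \<le> h p * (I c q - I d q)" for q
  proof (cases "q \<in> K")
    case True
    hence q: "q \<in> N" using K(2) by auto
    hence "h p * (I c q - I d q) = (h p * h q) * v q" by (simp add: I_def h_def N_def algebra_simps)
    also have "\<dots> \<ge> 0"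
      by (rule mult_nonneg_nonneg) (use q bump_range(1)[of c a b q] in \<open>auto simp: v_def N_def\<close>)
    finally show ?thesis .
  qed (simp add: I_def v(2))
  have kcont: "continuous_on UNIV (\<lambda>q. h p * (I c q - I d q))"
    by (intro continuous_intros Icont c d KU)
  have "AE q in \<nu>. h p * (I c q - I d q) = 0"
    using int0 integral_nonneg_eq_0_iff_AE[OF continuous_integrable[OF kcont]] pos by simp
  moreover define S where "S = {q. 0 < h p * (I c q - I d q)}"
  have S: "open S" unfolding S_def by (intro open_Collect_less continuous_on_const kcont)
  ultimately have "AE q in \<nu>. q \<notin> S" by (auto simp: S_def elim!: eventually_mono)
  hence "emeasure \<nu> S = 0"
    using S AE_iff_measurable[of S \<nu> "\<lambda>q. q \<notin> S"] sets_\<nu> by auto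
  moreover have "p \<in> S"
  proof -
    have "h p * (I c p - I d p) = (h p * h p) * v p" using p by (simp add: I_def h_def algebra_simps)
    moreover have "v p > 0" unfolding v_def bump_pos_iff using p ab(3) by simp
    moreover have "h p * h p > 0" using hp by (metis not_real_square_gt_zero)
    ultimately show ?thesis unfolding S_def mem_Collect_eq by (simp only: mult_pos_pos)
  qed
  ultimately show False using \<nu>_open_pos[OF S] by force
qed

definition T :: "('m \<Rightarrow> real) \<Rightarrow> 'm \<Rightarrow> real" where
  "T u p = - laplacian A g u p"

lemma T_eq: "c \<in> A \<Longrightarrow> p \<in> U c \<Longrightarrow> u \<in> D \<Longrightarrow> T u p = - lap c u (X c p)"
  unfolding T_def laplacian_def some_chart_def[symmetric] chart_laplacian_eq
  using lap_chart_independent[OF some_chart(1)[of p] _ some_chart(2)[of p], of c u] by simp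

lemma T_continuous: "u \<in> D \<Longrightarrow> continuous_on UNIV (T u)"
proof (rule continuous_on_chartwise)
  fix c assume u: "u \<in> D" and c: "c \<in> A"
  show "continuous_on (Om c) (\<lambda>z. T u (Y c z))"
    by (rule continuous_on_eq[OF continuous_on_minus[OF Ck_on_imp_continuous_on[OF lap_smooth[OF c u]]]])
      (simp only: T_eq[OF c Y_in[OF c] u] XY[OF c])
qed

lemma T_l2: "u \<in> D \<Longrightarrow> T u \<in> l2_space \<nu>"
  by (intro continuous_l2 T_continuous)

lemma lap_linear:
  assumes c: "c \<in> A" and u: "u \<in> D" and v: "v \<in> D" and z: "z \<in> Om c"
  shows "lap c (\<lambda>p. a * u p + b * v p) z = a * lap c u z + b * lap c v z"
proof -
  let ?w = "\<lambda>p. a * u p + b * v p"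
  have w: "?w \<in> D" by (rule D_lin[OF u v])
  have flux: "flux c ?w i y = a * flux c u i y + b * flux c v i y" if "y \<in> Om c" for i y
    using that by (simp add: flux_def partial_deriv_lin D_differentiable[OF c] u v distrib_left sum.distrib sum_distrib_left mult_ac)
  have "partial_deriv i (flux c ?w i) z = a * partial_deriv i (flux c u i) z + b * partial_deriv i (flux c v i) z" for i
  proof -
    have "partial_deriv i (flux c ?w i) z = partial_deriv i (\<lambda>y. a * flux c u i y + b * flux c v i y) z"
      by (rule partial_deriv_cong[OF Om_open[OF c] z flux_differentiable[OF c w z] flux])
    thus ?thesis by (simp add: partial_deriv_lin flux_differentiable[OF c] u v z)
  qed
  thus ?thesis by (simp add: lap_def divflux_def sum.distrib sum_distrib_left distrib_left mult_ac)
qed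

lemma T_linear:
  assumes "u \<in> D" "v \<in> D"
  shows "T (\<lambda>p. a * u p + b * v p) = (\<lambda>p. a * T u p + b * T v p)"
proof
  fix p
  show "T (\<lambda>p. a * u p + b * v p) p = a * T u p + b * T v p"
    using some_chart[of p] assms
    by (simp add: T_eq[OF some_chart, of _ p] D_lin lap_linear[OF some_chart(1)])
qed

text \<open>A partition of unity decomposes \<open>v\<close> into functions supported in charts, where integration by parts
  applies; both sides are linear in \<open>v\<close> and independent of the charts. The symmetry and nonnegativity of
  the Laplacian follow at once.\<close>

theorem green:
  assumes u: "u \<in> D" and v: "v \<in> D"
  shows "l2_inner \<nu> (T u) v = (LINT p|\<nu>. \<Gamma> u v p)"
proof -
  obtain P :: "'m set" and \<eta> C K where P: "finite P" and C: "\<And>p. C p \<in> A" and \<eta>: "\<And>p. p \<in> P \<Longrightarrow> \<eta> p \<in> D"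
    and K: "\<And>p. compact (K p)" "\<And>p. K p \<subseteq> U (C p)" and supp: "\<And>p q. q \<notin> K p \<Longrightarrow> \<eta> p q = 0"
    and one: "\<And>q. (\<Sum>p\<in>P. \<eta> p q) = 1"
    using partition_of_unity by metis
  have \<eta>v: "(\<lambda>q. \<eta> p q * v q) \<in> D" if "p \<in> P" for p by (intro D_mult \<eta> that v)
  have sum_v: "(\<Sum>p\<in>P. \<eta> p q * v q) = v q" for q
    by (simp add: sum_distrib_right[symmetric] one)
  have "l2_inner \<nu> (T u) v = (LINT q|\<nu>. T u q * (\<Sum>p\<in>P. \<eta> p q * v q))"
    by (simp add: l2_inner_def sum_v)
  also have "\<dots> = (\<Sum>p\<in>P. LINT q|\<nu>. T u q * (\<eta> p q * v q))"
    unfolding sum_distrib_left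
    by (rule Bochner_Integration.integral_sum)
      (intro continuous_integrable continuous_on_mult T_continuous u D_continuous \<eta> v)
  also have "\<dots> = (\<Sum>p\<in>P. LINT q|\<nu>. \<Gamma> u (\<lambda>q. \<eta> p q * v q) q)"
  proof (rule sum.cong[OF refl])
    fix p assume p: "p \<in> P"
    have "T u q * (\<eta> p q * v q) = - (if q \<in> U (C p) then lap (C p) u (X (C p) q) * (\<eta> p q * v q) else 0)" for q
      using supp[of q p] K(2)[of p] T_eq[OF C _ u, of q p] by (cases "q \<in> U (C p)") auto
    hence "(LINT q|\<nu>. T u q * (\<eta> p q * v q)) = - (LINT q|\<nu>. (if q \<in> U (C p) then lap (C p) u (X (C p) q) * (\<eta> p q * v q) else 0))"
      by (simp only: Bochner_Integration.integral_minus)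
    also have "\<dots> = (LINT q|\<nu>. \<Gamma> u (\<lambda>q. \<eta> p q * v q) q)"
      using integration_by_parts_\<Gamma>[OF C K \<eta>v[OF p] _ u, of p] supp by simp
    finally show "(LINT q|\<nu>. T u q * (\<eta> p q * v q)) = (LINT q|\<nu>. \<Gamma> u (\<lambda>q. \<eta> p q * v q) q)" .
  qed
  also have "\<dots> = (LINT q|\<nu>. (\<Sum>p\<in>P. \<Gamma> u (\<lambda>q. \<eta> p q * v q) q))"
    by (rule Bochner_Integration.integral_sum[symmetric]) (intro \<Gamma>_integrable u \<eta>v)
  also have "\<dots> = (LINT q|\<nu>. \<Gamma> u v q)"
  proof -
    have "\<Gamma> u (\<lambda>q. \<Sum>p\<in>P. \<eta> p q * v q) q = (\<Sum>p\<in>P. \<Gamma> u (\<lambda>q. \<eta> p q * v q) q)" for q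
      by (rule \<Gamma>_sum_right[OF u P]) (rule \<eta>v)
    thus ?thesis by (simp add: sum_v)
  qed
  finally show ?thesis .
qed

section \<open>Density of the smooth functions\<close>

lemma l2_integrable: "f \<in> l2_space \<nu> \<Longrightarrow> integrable \<nu> f"
  using l2_space_integrable_mult[OF _ D_l2_space[OF D_const[of 1]], of f] by simp

text \<open>The indicator of an open set is a bounded pointwise limit of smooth functions.\<close>

lemma integral_open_zero:
  assumes f: "f \<in> l2_space \<nu>" and orth: "\<And>\<phi>. \<phi> \<in> D \<Longrightarrow> l2_inner \<nu> f \<phi> = 0" and S: "open S"
  shows "(LINT p|\<nu>. f p * indicator S p) = 0"
proof -
  obtain \<beta> :: "nat \<Rightarrow> 'm \<Rightarrow> real" where \<beta>: "\<And>k. \<beta> k \<in> D" "\<And>k p. 0 \<le> \<beta> k p" "\<And>k p. \<beta> k p \<le> 1"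
    and S_eq: "S = (\<Union>k. {p. 0 < \<beta> k p})"
    using open_eq_countable_bumps[OF S] by metis
  \<comment> \<open>Powers of \<open>1 - \<beta> k\<close> tend to 0 where \<open>\<beta> k\<close> is positive and stay 1 where it vanishes. Taking the product
    over \<open>k < n\<close> of the \<open>n\<close>-th powers handles all \<open>k\<close> at once.\<close>
  define \<psi> where "\<psi> n p = (\<Prod>k<n. \<Prod>i<n. 1 + (-1) * \<beta> k p)" for n :: nat and p
  have \<psi>D: "\<psi> n \<in> D" for n unfolding \<psi>_def by (intro D_prod D_add D_const D_cmult \<beta>)
  define \<phi> where "\<phi> n p = 1 + (-1) * \<psi> n p" for n p
  have \<phi>D: "\<phi> n \<in> D" for n unfolding \<phi>_def by (intro D_add D_const D_cmult \<psi>D)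
  have \<psi>01: "0 \<le> \<psi> n p" "\<psi> n p \<le> 1" for n p
    unfolding \<psi>_def using \<beta> by (auto intro!: prod_nonneg prod_le_1 power_le_one)
  have lim: "(\<lambda>n. \<phi> n p) \<longlonglongrightarrow> indicator S p" for p
  proof (cases "p \<in> S")
    case True
    then obtain k where k: "0 < \<beta> k p" using S_eq by auto
    have le: "\<psi> n p \<le> (1 - \<beta> k p) ^ n" if "n > k" for n
    proof -
      have "\<psi> n p = (\<Prod>i<n. 1 + (-1) * \<beta> k p) * (\<Prod>k\<in>{..<n} - {k}. \<Prod>i<n. 1 + (-1) * \<beta> k p)"
        unfolding \<psi>_def using that by (subst prod.remove[of _ k]) auto
      also have "\<dots> \<le> (\<Prod>i<n. 1 + (-1) * \<beta> k p) * 1"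
        using \<beta> by (intro mult_left_mono prod_le_1 prod_nonneg) (auto intro!: prod_nonneg prod_le_1 power_le_one)
      finally show ?thesis by simp
    qed
    have "(\<lambda>n. (1 - \<beta> k p) ^ n) \<longlonglongrightarrow> 0"
      using k \<beta>(3)[of k p] by (intro LIMSEQ_realpow_zero) auto
    moreover have "\<forall>\<^sub>F n in sequentially. norm (\<psi> n p) \<le> (1 - \<beta> k p) ^ n"
      using eventually_gt_at_top[of k] by eventually_elim (use le \<psi>01 in auto)
    ultimately have "(\<lambda>n. \<psi> n p) \<longlonglongrightarrow> 0" by (rule Lim_null_comparison[rotated])
    hence "(\<lambda>n. 1 + (-1) * \<psi> n p) \<longlonglongrightarrow> 1 + (-1) * 0" by (intro tendsto_intros)
    thus ?thesis using True by (simp add: \<phi>_def)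
  next
    case False
    hence "\<beta> k p = 0" for k using \<beta>(2)[of k p] S_eq by (auto simp: not_less intro: antisym)
    thus ?thesis using False by (simp add: \<phi>_def \<psi>_def)
  qed
  have fi: "integrable \<nu> f" by (rule l2_integrable[OF f])
  have "(\<lambda>n. LINT p|\<nu>. f p * \<phi> n p) \<longlonglongrightarrow> (LINT p|\<nu>. f p * indicator S p)"
  proof (rule integral_dominated_convergence[where w="\<lambda>p. \<bar>f p\<bar>"])
    show "(\<lambda>p. f p * indicator S p) \<in> borel_measurable \<nu>"
      using f S by (intro borel_measurable_times borel_measurable_indicator) (auto simp: l2_space_def)
    show "(\<lambda>p. f p * \<phi> n p) \<in> borel_measurable \<nu>" for n
      by (rule borel_measurable_times[OF l2_space_measurable[OF f] continuous_measurable[OF D_continuous[OF \<phi>D]]])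
    show "AE p in \<nu>. (\<lambda>n. f p * \<phi> n p) \<longlonglongrightarrow> f p * indicator S p"
      by (intro AE_I2 tendsto_mult tendsto_const lim)
    have "\<bar>\<phi> n p\<bar> \<le> 1" for n p using \<psi>01[of n p] by (simp add: \<phi>_def)
    thus "AE p in \<nu>. norm (f p * \<phi> n p) \<le> \<bar>f p\<bar>" for n
      by (intro AE_I2) (simp add: abs_mult mult_left_le)
  qed (use fi in simp)
  moreover have "(LINT p|\<nu>. f p * \<phi> n p) = 0" for n using orth[OF \<phi>D] by (simp add: l2_inner_def)
  ultimately show ?thesis by (simp add: LIMSEQ_const_iff)
qed

text \<open>The measures with densities the positive and the negative part of \<open>f\<close> agree on open sets. These form a
  generating system closed under intersection, so the measures are equal and \<open>f\<close> vanishes.\<close>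

theorem D_dense:
  assumes f: "f \<in> l2_space \<nu>" and orth: "\<And>\<phi>. \<phi> \<in> D \<Longrightarrow> l2_inner \<nu> f \<phi> = 0"
  shows "AE p in \<nu>. f p = 0"
proof -
  have fi: "integrable \<nu> f" by (rule l2_integrable[OF f])
  have fm [measurable]: "f \<in> borel_measurable \<nu>" using f by (simp add: l2_space_def)
  let ?P = "\<lambda>p. ennreal (f p)" and ?N = "\<lambda>p. ennreal (- f p)"
  have fin: "(\<integral>\<^sup>+p. ?P p \<partial>\<nu>) \<noteq> \<infinity>" "(\<integral>\<^sup>+p. ?N p \<partial>\<nu>) \<noteq> \<infinity>"
    using fi by (auto simp: real_integrable_def)
  have "density \<nu> ?P = density \<nu> ?N"
  proof (rule measure_eqI_generator_eq[where E="{S. open S}" and \<Omega>=UNIV and A="\<lambda>_. UNIV"])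
    fix S :: "'m set" assume "S \<in> {S. open S}"
    hence S: "open S" by simp
    hence Sm: "S \<in> sets \<nu>" using sets_\<nu> by auto
    have int: "integrable \<nu> (\<lambda>p. f p * indicator S p)"
      using integrable_mult_indicator[OF Sm fi] by (simp add: mult.commute)
    have eq: "ennreal (f p * indicator S p) = ?P p * indicator S p" "ennreal (- (f p * indicator S p)) = ?N p * indicator S p" for p
      by (auto simp: indicator_def)
    have "enn2real (\<integral>\<^sup>+p. ?P p * indicator S p \<partial>\<nu>) = enn2real (\<integral>\<^sup>+p. ?N p * indicator S p \<partial>\<nu>)"
      using real_lebesgue_integral_def[OF int] integral_open_zero[OF f orth S] unfolding eq by simp
    moreover have "(\<integral>\<^sup>+p. ?P p * indicator S p \<partial>\<nu>) < top" "(\<integral>\<^sup>+p. ?N p * indicator S p \<partial>\<nu>) < top"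
      using int unfolding real_integrable_def eq by (auto simp: less_top)
    ultimately have "(\<integral>\<^sup>+p. ?P p * indicator S p \<partial>\<nu>) = (\<integral>\<^sup>+p. ?N p * indicator S p \<partial>\<nu>)"
      by (metis ennreal_enn2real)
    thus "emeasure (density \<nu> ?P) S = emeasure (density \<nu> ?N) S"
      using Sm by (simp add: emeasure_density)
  next
    show "emeasure (density \<nu> ?P) UNIV \<noteq> \<infinity>"
      using fin(1) sets_\<nu> by (subst emeasure_density) auto
    show "sets (density \<nu> ?P) = sigma_sets UNIV {S. open S}" "sets (density \<nu> ?N) = sigma_sets UNIV {S. open S}"
      using sets_\<nu> by (auto simp: borel_def)
  qed (auto simp: Int_stable_def)
  hence "AE p in \<nu>. ?P p = ?N p"
    using fin by (subst (asm) finite_density_unique) auto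
  thus ?thesis
  proof eventually_elim
    case (elim p)
    thus ?case by (cases "f p \<ge> 0") (auto simp: ennreal_neg ennreal_eq_0_iff)
  qed
qed

section \<open>The Rellich inequality on the manifold\<close>

lemma chart_integrable:
  fixes h :: "'m \<Rightarrow> real"
  assumes c: "c \<in> A" and h: "h \<in> borel_measurable borel" "integrable \<nu> h"
  shows "integrable lborel (\<lambda>z. if z \<in> Om c then \<rho> c z * h (Y c z) else 0)"
proof -
  note [measurable] = dens_measurable[OF c] total_inv_measurable[OF c] U_borel[OF c] h(1)
  have Us: "U c \<in> sets \<nu>" using U_borel[OF c] sets_\<nu> by simp
  have "integrable \<nu> (\<lambda>p. indicator (U c) p *\<^sub>R h p)"
    by (rule integrable_mult_indicator[OF Us h(2)])
  hence "integrable (density \<nu> (indicator (U c))) h"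
    using integrable_density[of h \<nu> "indicator (U c)"] h(1) Us
    by (simp add: measurable_cong_sets[OF sets_\<nu> refl] ennreal_indicator)
  hence "integrable (density lborel (\<lambda>z. ennreal (dens c z))) (\<lambda>z. h (total_inv c z))"
    unfolding chart_measure[OF c] by (subst (asm) integrable_distr_eq) auto
  hence "integrable lborel (\<lambda>z. dens c z *\<^sub>R h (total_inv c z))"
    by (subst (asm) integrable_density) (auto simp: dens_nonneg[OF c])
  hence "integrable lborel (\<lambda>z. vol * (dens c z *\<^sub>R h (total_inv c z)))" by (rule integrable_mult_right)
  moreover have "(\<lambda>z. vol * (dens c z *\<^sub>R h (total_inv c z))) = (\<lambda>z. if z \<in> Om c then \<rho> c z * h (Y c z) else 0)"
    using vol(2) by (auto simp: dens_def total_inv_def fun_eq_iff)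
  ultimately show ?thesis by (simp only:)
qed

lemma continuous_borel: "continuous_on UNIV (u :: 'm \<Rightarrow> real) \<Longrightarrow> u \<in> borel_measurable borel"
  by (rule borel_measurable_continuous_onI)

definition energy :: "('m \<Rightarrow> real) \<Rightarrow> real" where
  "energy u = l2_inner \<nu> u u + l2_inner \<nu> (T u) u"

lemma energy_eq: "u \<in> D \<Longrightarrow> energy u = (LINT p|\<nu>. (u p)\<^sup>2 + \<Gamma> u u p)"
proof -
  assume u: "u \<in> D"
  have "integrable \<nu> (\<lambda>p. (u p)\<^sup>2)" by (intro continuous_integrable continuous_on_power D_continuous u)
  hence "(LINT p|\<nu>. (u p)\<^sup>2 + \<Gamma> u u p) = (LINT p|\<nu>. (u p)\<^sup>2) + (LINT p|\<nu>. \<Gamma> u u p)"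
    using \<Gamma>_integrable[OF u u] by (rule Bochner_Integration.integral_add)
  thus ?thesis unfolding energy_def green[OF u u] by (simp add: l2_inner_def power2_eq_square)
qed

lemma energy_nonneg: "u \<in> D \<Longrightarrow> 0 \<le> energy u"
  unfolding energy_eq by (intro Bochner_Integration.integral_nonneg) (simp add: \<Gamma>_nonneg)

lemma compact_bound:
  fixes h :: "real^'n \<Rightarrow> real"
  assumes "compact K" "continuous_on K h"
  shows "\<exists>B\<ge>0. \<forall>z\<in>K. \<bar>h z\<bar> \<le> B"
proof -
  have "bounded (h ` K)" by (intro compact_imp_bounded compact_continuous_image assms)
  then obtain B where "\<forall>t\<in>h ` K. norm t \<le> B" unfolding bounded_iff by blast
  hence "\<bar>h z\<bar> \<le> max B 0" if "z \<in> K" for z using that by force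
  thus ?thesis by (intro exI[of _ "max B 0"]) auto
qed

text \<open>In the chart, \<open>\<eta> u\<close> is a \<open>C\<^sup>1\<close> function with support in a fixed compact set, to which the Euclidean
  inequality applies. On that set the density, its inverse, the metric and \<open>\<eta>\<close> with its gradient are
  bounded, so Euclidean and Riemannian quantities are comparable. The averages against tents become
  inner products of \<open>u\<close> with fixed functions on the manifold.\<close>

lemma rellich_in_chart:
  assumes c: "c \<in> A" and K: "compact K" "K \<subseteq> U c" and \<eta>: "\<eta> \<in> D" "\<And>p. p \<notin> K \<Longrightarrow> \<eta> p = 0" and \<epsilon>: "\<epsilon> > 0"
  shows "\<exists>Q C. finite Q \<and> Q \<subseteq> l2_space \<nu> \<and> C \<ge> 0 \<and>
    (\<forall>u\<in>D. (LINT p|\<nu>. (\<eta> p * u p)\<^sup>2) \<le> \<epsilon> * energy u + C * (\<Sum>q\<in>Q. (l2_inner \<nu> q u)\<^sup>2))"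
proof -
  let ?K = "X c ` K"
  have K': "compact ?K" "closed ?K" "?K \<subseteq> Om c"
    using image_compact[OF c K] K(2) by (auto intro: compact_imp_closed)
  have \<eta>K: "\<eta> (Y c z) = 0" if "z \<in> Om c" "z \<notin> ?K" for z
    using that \<eta>(2) in_image_iff[OF c K(2)] by auto
  have contK: "continuous_on ?K h" if "Ck_on 0 (Om c) h" for h :: "real^'n \<Rightarrow> real"
    using Ck_on_imp_continuous_on[OF that] K'(3) by (rule continuous_on_subset)
  let ?e = "\<lambda>z. \<eta> (Y c z)"
  have \<rho>0: "\<rho> c z \<noteq> 0" if "z \<in> Om c" for z using \<rho>_pos[OF c that] by linarith
  obtain B1 where B1: "B1 \<ge> 0" "\<And>z. z \<in> ?K \<Longrightarrow> \<bar>\<rho> c z\<bar> \<le> B1"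
    using compact_bound[OF K'(1) contK[OF \<rho>_smooth[OF c]]] by blast
  have inv_smooth: "Ck_on k (Om c) (\<lambda>z. inverse (\<rho> c z))" for k
    by (intro Ck_on_inverse Om_open c \<rho>_smooth \<rho>0)
  obtain B2 where B2: "B2 \<ge> 0" "\<And>z. z \<in> ?K \<Longrightarrow> \<bar>inverse (\<rho> c z)\<bar> \<le> B2"
    using compact_bound[OF K'(1) contK[OF inv_smooth]] by blast
  obtain B3 where B3: "B3 \<ge> 0" "\<And>z. z \<in> ?K \<Longrightarrow> \<bar>?e z\<bar> \<le> B3"
    using compact_bound[OF K'(1) contK[OF D_Ck[OF \<eta>(1) c]]] by blast
  have "Ck_on 0 (Om c) (\<lambda>z. \<Sum>i\<in>UNIV. partial_deriv i ?e z * partial_deriv i ?e z)"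
    by (intro Ck_on_sum Ck_on_mult Om_open c partial_smooth \<eta>(1))
  from compact_bound[OF K'(1) contK[OF this]] obtain B4 where B4: "B4 \<ge> 0"
    "\<And>z. z \<in> ?K \<Longrightarrow> \<bar>\<Sum>i\<in>UNIV. partial_deriv i ?e z * partial_deriv i ?e z\<bar> \<le> B4" by blast
  have "Ck_on 0 (Om c) (\<lambda>z. \<Sum>i\<in>UNIV. \<Sum>j\<in>UNIV. G c z $ i $ j * G c z $ i $ j)"
    by (intro Ck_on_sum Ck_on_mult Om_open c G_smooth)
  from compact_bound[OF K'(1) contK[OF this]] obtain B5 where B5: "B5 \<ge> 0"
    "\<And>z. z \<in> ?K \<Longrightarrow> \<bar>\<Sum>i\<in>UNIV. \<Sum>j\<in>UNIV. G c z $ i $ j * G c z $ i $ j\<bar> \<le> B5" by blast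
  have G_le: "\<bar>G c z $ i $ j\<bar> \<le> sqrt B5" if "z \<in> ?K" for z i j
  proof -
    have "(G c z $ i $ j)\<^sup>2 \<le> (\<Sum>j\<in>UNIV. (G c z $ i $ j)\<^sup>2)" by (rule member_le_sum) auto
    also have "\<dots> \<le> (\<Sum>i\<in>UNIV. \<Sum>j\<in>UNIV. (G c z $ i $ j)\<^sup>2)"
      by (rule member_le_sum[where f="\<lambda>i. \<Sum>j\<in>UNIV. (G c z $ i $ j)\<^sup>2"]) (auto intro: sum_nonneg)
    also have "\<dots> \<le> B5" using B5(2)[OF that] by (simp add: power2_eq_square)
    finally show ?thesis using real_le_rsqrt real_sqrt_abs real_sqrt_le_mono by (metis real_sqrt_le_iff)
  qed
  define L where "L = (real CARD('n))\<^sup>2 * sqrt B5"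
  have L: "L \<ge> 0" using B5(1) by (simp add: L_def)
  \<comment> \<open>The squared coordinate gradient of \<open>\<eta> u\<close> integrates to at most \<open>B\<close> times the energy of \<open>u\<close>: \<open>B4\<close> comes from the
    gradient of \<open>\<eta>\<close>, and \<open>L\<close> from comparing the coordinate gradient of \<open>u\<close> with the Riemannian one.\<close>
  define B where "B = B2 * (2 * B4 + 2 * B3\<^sup>2 * L) * vol"
  have B: "B \<ge> 0" unfolding B_def using B2 B4 L vol(2) by (intro mult_nonneg_nonneg add_nonneg_nonneg) auto
  \<comment> \<open>Returning to the manifold costs the factor \<open>B1 / vol\<close> and the energy bound the factor \<open>B\<close>; adding 1 to
    each avoids division by zero.\<close>
  define \<delta> where "\<delta> = \<epsilon> * vol / ((B1 + 1) * (B + 1))"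
  have \<delta>: "\<delta> > 0" unfolding \<delta>_def using \<epsilon> vol(2) B1 B by (intro divide_pos_pos mult_pos_pos) auto
  obtain Z r C0 where Z: "finite Z" and r: "r > 0" and C0: "C0 \<ge> 0"
    and rell: "\<And>f. C1_supported ?K f \<Longrightarrow> (LINT x|lborel. (f x)\<^sup>2) \<le>
        \<delta> * (LINT x|lborel. (\<Sum>i\<in>UNIV. (partial_deriv i f x)\<^sup>2)) + C0 * (\<Sum>z\<in>Z. (LINT y|lborel. f y * tent r (y - z))\<^sup>2)"
    by (rule rellich_inequality[OF K'(1) \<delta>]) (rule that, assumption+)
  \<comment> \<open>Represents the average at \<open>z\<close> by an inner product on the manifold: the factor \<open>vol / \<rho>\<close> undoes the
    density of the measure.\<close>
  define \<theta> where "\<theta> z p = (if p \<in> U c then (\<lambda>y. ?e y * tent r (y - z) * inverse (\<rho> c y) * vol) (X c p) else 0)" for z p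
  have \<theta>_cont: "continuous_on UNIV (\<theta> z)" for z
    unfolding \<theta>_def
  proof (rule zero_extension_continuous[OF c K])
    show "continuous_on (Om c) (\<lambda>y. ?e y * tent r (y - z) * inverse (\<rho> c y) * vol)"
      by (intro continuous_on_mult continuous_on_const Ck_on_imp_continuous_on[OF D_Ck[OF \<eta>(1) c]]
          Ck_on_imp_continuous_on[OF inv_smooth] continuous_on_compose2[OF tent_continuous] continuous_intros) auto
  qed (simp add: YX[OF c] \<eta>(2))
  have \<theta>l2: "\<theta> z \<in> l2_space \<nu>" for z by (intro continuous_l2 \<theta>_cont)
  define Q where "Q = \<theta> ` Z"
  have Q: "finite Q" "Q \<subseteq> l2_space \<nu>" using Z \<theta>l2 by (auto simp: Q_def)
  \<comment> \<open>The cardinality of \<open>Z\<close> appears because different net points may give the same function.\<close>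
  define C where "C = (B1 / vol) * (C0 * real (card Z))"
  have C: "C \<ge> 0" unfolding C_def using B1 vol(2) C0 by simp
  have "(LINT p|\<nu>. (\<eta> p * u p)\<^sup>2) \<le> \<epsilon> * energy u + C * (\<Sum>q\<in>Q. (l2_inner \<nu> q u)\<^sup>2)" if u: "u \<in> D" for u
  proof -
    let ?u = "\<lambda>z. u (Y c z)"
    define f where "f z = (if z \<in> Om c then ?e z * ?u z else 0)" for z
    have f: "C1_supported ?K f"
      unfolding C1_supported_def f_def[abs_def]
    proof (intro conjI allI impI K'(1))
      show "Ck_on (Suc 0) UNIV (\<lambda>z. if z \<in> Om c then ?e z * ?u z else 0)"
        by (rule Ck_on_zero_extension[OF Om_open[OF c] K'(2,3)])
          (intro Ck_on_mult Om_open c D_Ck \<eta>(1) u, simp add: \<eta>K)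
    qed (use \<eta>K in auto)
    have df: "(\<Sum>i\<in>UNIV. (partial_deriv i f z)\<^sup>2) \<le> (B / vol) * (if z \<in> Om c then \<rho> c z * ((u (Y c z))\<^sup>2 + \<Gamma> u u (Y c z)) else 0)" for z
    proof (cases "z \<in> ?K")
      case True
      hence z: "z \<in> Om c" using K'(3) by auto
      have diff: "?e differentiable (at z)" "?u differentiable (at z)"
        using D_differentiable[OF c _ z] \<eta>(1) u by auto
      have "partial_deriv i (\<lambda>z. ?e z * ?u z) z = partial_deriv i f z" for i
        by (rule partial_deriv_cong[OF Om_open[OF c] z]) (auto simp: f_def diff)
      hence pf: "partial_deriv i f z = ?e z * partial_deriv i ?u z + partial_deriv i ?e z * ?u z" for i
        using partial_deriv_mult[OF diff] by simp
      have \<Gamma>z: "\<Gamma> u u (Y c z) = Gam c u u z" using \<Gamma>_eq[OF c Y_in[OF c z] u u] XY[OF c z] by simp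
      have "(\<Sum>i\<in>UNIV. (partial_deriv i f z)\<^sup>2)
        \<le> (\<Sum>i\<in>UNIV. 2 * (?u z)\<^sup>2 * (partial_deriv i ?e z * partial_deriv i ?e z) + 2 * (?e z)\<^sup>2 * (partial_deriv i ?u z)\<^sup>2)"
      proof (rule sum_mono)
        fix i
        show "(partial_deriv i f z)\<^sup>2 \<le> 2 * (?u z)\<^sup>2 * (partial_deriv i ?e z * partial_deriv i ?e z) + 2 * (?e z)\<^sup>2 * (partial_deriv i ?u z)\<^sup>2"
          using zero_le_power2[of "?e z * partial_deriv i ?u z - partial_deriv i ?e z * ?u z"]
          unfolding pf by (simp add: power2_eq_square algebra_simps)
      qed
      also have "\<dots> = 2 * (?u z)\<^sup>2 * (\<Sum>i\<in>UNIV. partial_deriv i ?e z * partial_deriv i ?e z) + 2 * (?e z)\<^sup>2 * (grad c u z \<bullet> grad c u z)"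
        by (simp add: sum.distrib sum_distrib_left inner_vec_def grad_def power2_eq_square)
      also have "\<dots> \<le> 2 * (?u z)\<^sup>2 * B4 + 2 * B3\<^sup>2 * (L * Gam c u u z)"
      proof (rule add_mono)
        have "(\<Sum>i\<in>UNIV. partial_deriv i ?e z * partial_deriv i ?e z) \<le> B4" using B4(2)[OF True] by linarith
        thus "2 * (?u z)\<^sup>2 * (\<Sum>i\<in>UNIV. partial_deriv i ?e z * partial_deriv i ?e z) \<le> 2 * (?u z)\<^sup>2 * B4"
          by (rule mult_left_mono) simp
        have "(?e z)\<^sup>2 \<le> B3\<^sup>2" using B3(2)[OF True] B3(1) by (simp add: abs_le_square_iff[symmetric])
        moreover have "grad c u z \<bullet> grad c u z \<le> L * Gam c u u z"
          unfolding L_def Gam_def using Y_in[OF c z] G_le[OF True]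
          by (intro norm_square_le_posdef_inv g_sym[OF c] g_pos[OF c]) auto
        ultimately show "2 * (?e z)\<^sup>2 * (grad c u z \<bullet> grad c u z) \<le> 2 * B3\<^sup>2 * (L * Gam c u u z)"
          by (intro mult_mono) auto
      qed
      also have "\<dots> \<le> (2 * B4 + 2 * B3\<^sup>2 * L) * ((?u z)\<^sup>2 + Gam c u u z)"
      proof -
        have "0 \<le> 2 * B4 * Gam c u u z" "0 \<le> 2 * B3\<^sup>2 * L * (?u z)\<^sup>2"
          using B4(1) L Gam_nonneg[OF c z] by auto
        thus ?thesis by (simp add: algebra_simps)
      qed
      also have "\<dots> \<le> (B2 * \<rho> c z) * ((2 * B4 + 2 * B3\<^sup>2 * L) * ((?u z)\<^sup>2 + Gam c u u z))"
      proof -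
        have "1 = inverse (\<rho> c z) * \<rho> c z" using \<rho>0[OF z] by simp
        also have "\<dots> \<le> B2 * \<rho> c z" using B2(2)[OF True] \<rho>_pos[OF c z] by (intro mult_right_mono) linarith+
        finally have "1 \<le> B2 * \<rho> c z" .
        moreover have "0 \<le> (2 * B4 + 2 * B3\<^sup>2 * L) * ((?u z)\<^sup>2 + Gam c u u z)"
          using B4(1) L Gam_nonneg[OF c z] by (intro mult_nonneg_nonneg add_nonneg_nonneg) auto
        ultimately show ?thesis using mult_right_mono by fastforce
      qed
      also have "\<dots> = (B / vol) * (\<rho> c z * ((u (Y c z))\<^sup>2 + \<Gamma> u u (Y c z)))"
        unfolding \<Gamma>z B_def using vol(2) by simp
      finally show ?thesis using z by simp
    next
      case False
      have "(\<Sum>i\<in>UNIV. (partial_deriv i f z)\<^sup>2) = 0" using C1_derivative_zero[OF f False] by (simp add: partial_deriv_def)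
      also have "0 \<le> (B / vol) * (if z \<in> Om c then \<rho> c z * ((u (Y c z))\<^sup>2 + \<Gamma> u u (Y c z)) else 0)"
      proof (rule mult_nonneg_nonneg)
        show "0 \<le> (if z \<in> Om c then \<rho> c z * ((u (Y c z))\<^sup>2 + \<Gamma> u u (Y c z)) else 0)"
        proof (cases "z \<in> Om c")
          case True
          have "0 \<le> \<rho> c z * ((u (Y c z))\<^sup>2 + \<Gamma> u u (Y c z))"
            using \<rho>_pos[OF c True] \<Gamma>_nonneg[of u "Y c z"]
            by (intro mult_nonneg_nonneg add_nonneg_nonneg) (auto simp: less_imp_le)
          thus ?thesis using True by (simp only: if_True)
        qed (simp only: if_False order_refl)
      qed (use B vol(2) in simp)
      finally show ?thesis .
    qed
    define h where "h p = (u p)\<^sup>2 + \<Gamma> u u p" for p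
    have h_cont: "continuous_on UNIV h" unfolding h_def
      by (intro continuous_on_add continuous_on_power D_continuous \<Gamma>_continuous u)
    have h0: "0 \<le> h p" for p unfolding h_def using \<Gamma>_nonneg by simp
    have hm: "h \<in> borel_measurable borel" by (rule continuous_borel[OF h_cont])
    have grad_le: "(LINT z|lborel. (\<Sum>i\<in>UNIV. (partial_deriv i f z)\<^sup>2)) \<le> B * energy u"
    proof -
      have "(LINT z|lborel. (\<Sum>i\<in>UNIV. (partial_deriv i f z)\<^sup>2)) \<le> (LINT z|lborel. (B / vol) * (if z \<in> Om c then \<rho> c z * h (Y c z) else 0))"
        unfolding h_def using chart_integrable[OF c hm continuous_integrable[OF h_cont], unfolded h_def]
        by (intro integral_mono gradient_integrable[OF f] integrable_mult_right df)
      also have "\<dots> = B * ((LINT z|lborel. (if z \<in> Om c then \<rho> c z * h (Y c z) else 0)) / vol)" by simp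
      also have "(LINT z|lborel. (if z \<in> Om c then \<rho> c z * h (Y c z) else 0)) = (LINT z|lborel. (if z \<in> Om c then \<rho> c z * (indicator (U c) (Y c z) * h (Y c z)) else 0))"
        by (intro Bochner_Integration.integral_cong) (auto simp: indicator_def Y_in[OF c])
      also have "\<dots> / vol = (LINT p|\<nu>. indicator (U c) p * h p)"
        by (rule chart_integral[OF c, symmetric]) (use hm U_borel[OF c] in auto)
      also have "B * \<dots> \<le> B * (LINT p|\<nu>. h p)"
      proof (rule mult_left_mono[OF integral_mono B])
        show "integrable \<nu> h" by (rule continuous_integrable[OF h_cont])
        show "integrable \<nu> (\<lambda>p. indicator (U c) p * h p)"
          using integrable_mult_indicator[OF _ continuous_integrable[OF h_cont], of "U c"] U_borel[OF c] sets_\<nu> by simp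
      qed (use h0 in \<open>auto simp: indicator_def\<close>)
      finally show ?thesis unfolding h_def energy_eq[OF u] .
    qed
    have "(LINT p|\<nu>. (\<eta> p * u p)\<^sup>2) = (LINT z|lborel. (if z \<in> Om c then \<rho> c z * (\<eta> (Y c z) * u (Y c z))\<^sup>2 else 0)) / vol"
    proof (rule chart_integral[OF c])
      show "(\<lambda>p. (\<eta> p * u p)\<^sup>2) \<in> borel_measurable borel"
        by (intro continuous_borel continuous_on_power continuous_on_mult D_continuous \<eta>(1) u)
    qed (use \<eta>(2) K(2) in auto)
    also have "\<dots> \<le> (LINT z|lborel. B1 * (f z)\<^sup>2) / vol"
    proof (intro divide_right_mono integral_mono)
      show "integrable lborel (\<lambda>z. if z \<in> Om c then \<rho> c z * (\<eta> (Y c z) * u (Y c z))\<^sup>2 else 0)"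
        by (rule chart_integrable[OF c, of "\<lambda>p. (\<eta> p * u p)\<^sup>2"])
          (intro continuous_borel continuous_integrable continuous_on_power continuous_on_mult D_continuous \<eta>(1) u)+
      show "integrable lborel (\<lambda>z. B1 * (f z)\<^sup>2)"
        using C1_l2[OF f] by (intro integrable_mult_right l2_space_integrable_square)
      fix z
      show "(if z \<in> Om c then \<rho> c z * (\<eta> (Y c z) * u (Y c z))\<^sup>2 else 0) \<le> B1 * (f z)\<^sup>2"
      proof (cases "z \<in> ?K")
        case True
        have "\<rho> c z \<le> B1" using B1(2)[OF True] by linarith
        thus ?thesis using True K'(3) unfolding f_def by (auto intro!: mult_right_mono)
      next
        case False
        thus ?thesis using \<eta>K[of z] B1(1) by auto
      qed
    qed (use vol(2) in simp)
    also have "\<dots> = (B1 / vol) * (LINT z|lborel. (f z)\<^sup>2)" by simp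
    also have "\<dots> \<le> (B1 / vol) * (\<delta> * (B * energy u) + C0 * (real (card Z) * (\<Sum>q\<in>Q. (l2_inner \<nu> q u)\<^sup>2)))"
    proof (rule mult_left_mono)
      have tz: "(LINT y|lborel. f y * tent r (y - z)) = l2_inner \<nu> (\<theta> z) u" for z
      proof -
        have "l2_inner \<nu> (\<theta> z) u = (LINT y|lborel. (if y \<in> Om c then \<rho> c y * (\<theta> z (Y c y) * u (Y c y)) else 0)) / vol"
          unfolding l2_inner_def
        proof (rule chart_integral[OF c])
          show "(\<lambda>p. \<theta> z p * u p) \<in> borel_measurable borel"
            by (rule borel_measurable_times[OF continuous_borel[OF \<theta>_cont] continuous_borel[OF D_continuous[OF u]]])
        qed (simp add: \<theta>_def)
        also have "(LINT y|lborel. (if y \<in> Om c then \<rho> c y * (\<theta> z (Y c y) * u (Y c y)) else 0)) = (LINT y|lborel. vol * (f y * tent r (y - z)))"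
        proof (intro Bochner_Integration.integral_cong refl)
          fix y
          have cancel: "s * ((a * t * inverse s * v) * b) = v * (a * b * t)" if "s \<noteq> 0" for s a t v b :: real
            using that by (simp add: field_simps)
          show "(if y \<in> Om c then \<rho> c y * (\<theta> z (Y c y) * u (Y c y)) else 0) = vol * (f y * tent r (y - z))"
          proof (cases "y \<in> Om c")
            case True
            thus ?thesis using cancel[OF \<rho>0[OF True]]
              by (simp only: True if_True f_def \<theta>_def Y_in[OF c True] XY[OF c True])
          qed (simp add: f_def)
        qed
        finally show ?thesis using vol(2) by simp
      qed
      have "(\<Sum>z\<in>Z. (l2_inner \<nu> (\<theta> z) u)\<^sup>2) \<le> (\<Sum>z\<in>Z. (\<Sum>q\<in>Q. (l2_inner \<nu> q u)\<^sup>2))"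
        using Q(1) by (intro sum_mono member_le_sum[of "\<theta> _" Q "\<lambda>q. (l2_inner \<nu> q u)\<^sup>2"]) (auto simp: Q_def)
      hence "(\<Sum>z\<in>Z. (l2_inner \<nu> (\<theta> z) u)\<^sup>2) \<le> real (card Z) * (\<Sum>q\<in>Q. (l2_inner \<nu> q u)\<^sup>2)" by simp
      hence "C0 * (\<Sum>z\<in>Z. (l2_inner \<nu> (\<theta> z) u)\<^sup>2) \<le> C0 * (real (card Z) * (\<Sum>q\<in>Q. (l2_inner \<nu> q u)\<^sup>2))"
        using C0 by (rule mult_left_mono)
      moreover have "\<delta> * (LINT z|lborel. (\<Sum>i\<in>UNIV. (partial_deriv i f z)\<^sup>2)) \<le> \<delta> * (B * energy u)"
        using grad_le \<delta> by (intro mult_left_mono) auto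
      ultimately show "(LINT z|lborel. (f z)\<^sup>2) \<le> \<delta> * (B * energy u) + C0 * (real (card Z) * (\<Sum>q\<in>Q. (l2_inner \<nu> q u)\<^sup>2))"
        using rell[OF f] unfolding tz by linarith
    qed (use B1 vol(2) in simp)
    also have "\<dots> = (B1 / vol * \<delta> * B) * energy u + C * (\<Sum>q\<in>Q. (l2_inner \<nu> q u)\<^sup>2)"
      by (simp add: C_def algebra_simps)
    also have "(B1 / vol * \<delta> * B) * energy u \<le> \<epsilon> * energy u"
    proof (rule mult_right_mono[OF _ energy_nonneg[OF u]])
      have "B1 / vol * \<delta> * B = \<epsilon> * ((B1 / (B1 + 1)) * (B / (B + 1)))"
        using vol(2) by (simp add: \<delta>_def)
      also have "\<dots> \<le> \<epsilon> * (1 * 1)"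
        using \<epsilon> B1(1) B by (intro mult_left_mono mult_mono) auto
      finally show "B1 / vol * \<delta> * B \<le> \<epsilon>" by simp
    qed
    finally show ?thesis by simp
  qed
  with Q C show ?thesis by blast
qed

text \<open>Gluing with a partition of unity: \<open>u\<close> is a sum of \<open>N\<close> functions \<open>\<eta> u\<close> supported in charts, and the
  square of a sum of \<open>N\<close> terms is at most \<open>N\<close> times the sum of their squares.\<close>

theorem rellich_manifold:
  assumes \<epsilon>: "\<epsilon> > 0"
  shows "\<exists>Q C. finite Q \<and> Q \<subseteq> l2_space \<nu> \<and>
    (\<forall>u\<in>D. l2_inner \<nu> u u \<le> \<epsilon> * (l2_inner \<nu> u u + l2_inner \<nu> (T u) u) + C * (\<Sum>q\<in>Q. (l2_inner \<nu> q u)\<^sup>2))"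
proof -
  obtain P :: "'m set" and \<eta> c K where P: "finite P" and c: "\<And>p. c p \<in> A" and \<eta>: "\<And>p. p \<in> P \<Longrightarrow> \<eta> p \<in> D"
    and K: "\<And>p. compact (K p)" "\<And>p. K p \<subseteq> U (c p)" and supp: "\<And>p q. q \<notin> K p \<Longrightarrow> \<eta> p q = 0"
    and one: "\<And>q. (\<Sum>p\<in>P. \<eta> p q) = 1"
    using partition_of_unity by metis
  define N where "N = real (card P)"
  define \<delta> where "\<delta> = \<epsilon> / (N + 1)\<^sup>2"
  have N: "N \<ge> 0" by (simp add: N_def)
  have \<delta>: "\<delta> > 0" using \<epsilon> N by (simp add: \<delta>_def)
  have "\<forall>p\<in>P. \<exists>Q C. finite Q \<and> Q \<subseteq> l2_space \<nu> \<and> C \<ge> 0 \<and>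
    (\<forall>u\<in>D. (LINT q|\<nu>. (\<eta> p q * u q)\<^sup>2) \<le> \<delta> * energy u + C * (\<Sum>q\<in>Q. (l2_inner \<nu> q u)\<^sup>2))"
    using rellich_in_chart[OF c K \<eta> supp \<delta>] by blast
  from bchoice[OF this] obtain Q where "\<forall>p\<in>P. \<exists>C. finite (Q p) \<and> Q p \<subseteq> l2_space \<nu> \<and> C \<ge> 0 \<and>
    (\<forall>u\<in>D. (LINT q|\<nu>. (\<eta> p q * u q)\<^sup>2) \<le> \<delta> * energy u + C * (\<Sum>q\<in>Q p. (l2_inner \<nu> q u)\<^sup>2))" ..
  from bchoice[OF this] obtain C where QC: "\<forall>p\<in>P. finite (Q p) \<and> Q p \<subseteq> l2_space \<nu> \<and> C p \<ge> 0 \<and>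
    (\<forall>u\<in>D. (LINT q|\<nu>. (\<eta> p q * u q)\<^sup>2) \<le> \<delta> * energy u + C p * (\<Sum>q\<in>Q p. (l2_inner \<nu> q u)\<^sup>2))" ..
  have Q: "\<And>p. p \<in> P \<Longrightarrow> finite (Q p)" "\<And>p. p \<in> P \<Longrightarrow> Q p \<subseteq> l2_space \<nu>" and C: "\<And>p. p \<in> P \<Longrightarrow> C p \<ge> 0"
    and le: "\<And>p u. p \<in> P \<Longrightarrow> u \<in> D \<Longrightarrow> (LINT q|\<nu>. (\<eta> p q * u q)\<^sup>2) \<le> \<delta> * energy u + C p * (\<Sum>q\<in>Q p. (l2_inner \<nu> q u)\<^sup>2)"
    using QC by blast+
  define Q' where "Q' = (\<Union>p\<in>P. Q p)"
  have Q': "finite Q'" "Q' \<subseteq> l2_space \<nu>" using P Q by (auto simp: Q'_def)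
  have "l2_inner \<nu> u u \<le> \<epsilon> * energy u + (N * (\<Sum>p\<in>P. C p)) * (\<Sum>q\<in>Q'. (l2_inner \<nu> q u)\<^sup>2)" if u: "u \<in> D" for u
  proof -
    have sum_u: "(\<Sum>p\<in>P. \<eta> p q * u q) = u q" for q by (simp add: sum_distrib_right[symmetric] one)
    have int: "integrable \<nu> (\<lambda>q. (\<eta> p q * u q)\<^sup>2)" if "p \<in> P" for p
      by (intro continuous_integrable continuous_on_power continuous_on_mult D_continuous \<eta> that u)
    have "l2_inner \<nu> u u = (LINT q|\<nu>. (u q)\<^sup>2)" by (simp add: l2_inner_def power2_eq_square)
    also have "\<dots> \<le> (LINT q|\<nu>. (\<Sum>p\<in>P. (\<eta> p q * u q)\<^sup>2) * N)"
    proof (rule integral_mono)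
      show "integrable \<nu> (\<lambda>q. (u q)\<^sup>2)" by (intro continuous_integrable continuous_on_power D_continuous u)
      show "integrable \<nu> (\<lambda>q. (\<Sum>p\<in>P. (\<eta> p q * u q)\<^sup>2) * N)"
        by (intro integrable_mult_left Bochner_Integration.integrable_sum int)
      fix q
      show "(u q)\<^sup>2 \<le> (\<Sum>p\<in>P. (\<eta> p q * u q)\<^sup>2) * N"
        using sum_squared_le_sum_of_squares[of "\<lambda>p. \<eta> p q * u q" P] by (simp only: sum_u N_def)
    qed
    also have "\<dots> = N * (\<Sum>p\<in>P. LINT q|\<nu>. (\<eta> p q * u q)\<^sup>2)"
      using int by (simp add: Bochner_Integration.integral_sum)
    also have "\<dots> \<le> N * (\<Sum>p\<in>P. \<delta> * energy u + C p * (\<Sum>q\<in>Q'. (l2_inner \<nu> q u)\<^sup>2))"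
    proof (intro mult_left_mono sum_mono N)
      fix p assume p: "p \<in> P"
      have "(\<Sum>q\<in>Q p. (l2_inner \<nu> q u)\<^sup>2) \<le> (\<Sum>q\<in>Q'. (l2_inner \<nu> q u)\<^sup>2)"
        using Q'(1) p by (intro sum_mono2) (auto simp: Q'_def)
      hence "C p * (\<Sum>q\<in>Q p. (l2_inner \<nu> q u)\<^sup>2) \<le> C p * (\<Sum>q\<in>Q'. (l2_inner \<nu> q u)\<^sup>2)"
        using C[OF p] by (rule mult_left_mono)
      thus "(LINT q|\<nu>. (\<eta> p q * u q)\<^sup>2) \<le> \<delta> * energy u + C p * (\<Sum>q\<in>Q'. (l2_inner \<nu> q u)\<^sup>2)"
        using le[OF p u] by linarith
    qed
    also have "\<dots> = (N * N * \<delta>) * energy u + (N * (\<Sum>p\<in>P. C p)) * (\<Sum>q\<in>Q'. (l2_inner \<nu> q u)\<^sup>2)"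
      by (simp add: sum.distrib sum_distrib_right[symmetric] N_def distrib_left mult_ac)
    also have "(N * N * \<delta>) * energy u \<le> \<epsilon> * energy u"
    proof (rule mult_right_mono[OF _ energy_nonneg[OF u]])
      have "N * N \<le> (N + 1)\<^sup>2" using N by (simp add: power2_eq_square algebra_simps)
      hence "N * N * \<delta> \<le> (N + 1)\<^sup>2 * \<delta>" using \<delta> by (intro mult_right_mono) auto
      also have "\<dots> = \<epsilon>" using N by (simp add: \<delta>_def)
      finally show "N * N * \<delta> \<le> \<epsilon>" .
    qed
    finally show ?thesis by simp
  qed
  with Q' show ?thesis unfolding energy_def by blast
qed

sublocale form: compact_form \<nu> D T
proof
  show "l2_subspace \<nu> D" unfolding l2_subspace_def using D_l2_space D_const[of 0] D_lin by blast
  show "T \<phi> \<in> l2_space \<nu>" if "\<phi> \<in> D" for \<phi> using that by (rule T_l2)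
  show "T (\<lambda>x. a * \<phi> x + b * \<psi> x) = (\<lambda>x. a * T \<phi> x + b * T \<psi> x)" if "\<phi> \<in> D" "\<psi> \<in> D" for \<phi> \<psi> a b
    using that by (rule T_linear)
  show "l2_inner \<nu> (T \<phi>) \<psi> = l2_inner \<nu> \<phi> (T \<psi>)" if "\<phi> \<in> D" "\<psi> \<in> D" for \<phi> \<psi>
    using that by (simp add: l2_inner_commute[of \<nu> \<phi>] green \<Gamma>_sym[of \<phi> \<psi>])
  show "0 \<le> l2_inner \<nu> (T \<phi>) \<phi>" if "\<phi> \<in> D" for \<phi>
    unfolding green[OF that that] by (intro Bochner_Integration.integral_nonneg \<Gamma>_nonneg)
  show "AE x in \<nu>. f x = 0" if "f \<in> l2_space \<nu>" "\<And>\<phi>. \<phi> \<in> D \<Longrightarrow> l2_inner \<nu> f \<phi> = 0" for f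
    using that by (rule D_dense)
  show "\<exists>G C. finite G \<and> G \<subseteq> l2_space \<nu> \<and> (\<forall>\<phi>\<in>D. l2_inner \<nu> \<phi> \<phi> \<le>
      \<epsilon> * (l2_inner \<nu> \<phi> \<phi> + l2_inner \<nu> (T \<phi>) \<phi>) + C * (\<Sum>g\<in>G. (l2_inner \<nu> g \<phi>)\<^sup>2))" if "\<epsilon> > 0" for \<epsilon>
    using that by (rule rellich_manifold)
qed

lemma eigenspace_eq: "eigenspace A g \<nu> \<kappa> = form.eig \<kappa>"
proof -
  have "(\<lambda>u x. - laplacian A g u x) = T" by (auto simp: T_def fun_eq_iff)
  thus ?thesis by (simp add: eigenspace_def form.eig_def laplace_beltrami_def)
qed

end

section \<open>The spectral variation space of a closed manifold\<close>

theorem proposition2p4: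
  fixes A :: "('m::t2_space, 'n::finite) chart set"
    and g :: "('m, 'n) chart \<Rightarrow> 'm \<Rightarrow> real^'n^'n"
    and V \<nu> :: "'m measure"
    and \<mu> :: "nat \<Rightarrow> real"
    and E :: "nat \<Rightarrow> ('m \<Rightarrow> real) set"
    and s :: real
  assumes "closed_riemannian_manifold A g"
    and "riemannian_volume A g V"
    and "\<nu> = normalized_measure V"
    and "\<mu> 0 = 0" and "strict_mono \<mu>" and "range \<mu> = eigenvalues A g \<nu>"
    and "\<And>j. E j = eigenspace A g \<nu> (\<mu> j)"
    and "s \<ge> 0"
  shows "{f \<in> spec_space \<nu> \<mu> E s. spec_norm \<nu> \<mu> E s f \<le> 1} =
           l2_closure \<nu> (absolutely_convex_hull (spec_atoms \<nu> \<mu> E s)) \<and>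
         (\<forall>f\<in>l2_space \<nu>.
           (\<exists>B\<in>eigenbases \<nu> E. spec_norm \<nu> \<mu> E s f = sb_norm \<nu> \<mu> E s B f) \<and>
           (\<forall>B\<in>eigenbases \<nu> E. spec_norm \<nu> \<mu> E s f \<le> sb_norm \<nu> \<mu> E s B f))"
proof -
  interpret M: closed_riemannian A g V \<nu>
    using assms by unfold_locales (auto simp: closed_riemannian_manifold_def)
  have E: "E j = M.form.eig (\<mu> j)" for j using assms(7) M.eigenspace_eq by simp
  interpret S: spectral_variation \<nu> E \<mu> s
  proof
    show "l2_finite_dim \<nu> (E j)" for j unfolding E by (rule M.form.eig_finite_dim)
    show "l2_inner \<nu> u v = 0" if "u \<in> E j" "v \<in> E k" "j \<noteq> k" for u v j k
      using that M.form.eig_orthogonal strict_mono_eq[OF assms(5)] unfolding E by blast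
    show "0 \<le> \<mu> j" for j using assms(4,5) strict_mono_mono[THEN monoD, of \<mu> 0 j] by simp
    show "AE x in \<nu>. f x = 0" if f: "f \<in> l2_space \<nu>" and orth: "\<And>j u. u \<in> E j \<Longrightarrow> l2_inner \<nu> f u = 0" for f
    proof (rule M.form.eigenfunctions_complete[OF f])
      fix \<kappa> v assume v: "v \<in> M.form.eig \<kappa>"
      note vL = l2_subspaceD(1)[OF M.form.eig_subspace v]
      \<comment> \<open>Numbers outside the range of \<open>\<mu>\<close> have only null eigenvectors.\<close>
      show "l2_inner \<nu> f v = 0"
      proof (cases "AE x in \<nu>. v x = 0")
        case True
        hence "l2_norm \<nu> v = 0" using l2_norm_eq_0_iff[OF vL] by simp
        thus ?thesis using l2_cauchy_schwarz[OF f vL] by simp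
      next
        case False
        hence "\<kappa> \<in> eigenvalues A g \<nu>" using v unfolding eigenvalues_def M.eigenspace_eq by blast
        then obtain j where "\<kappa> = \<mu> j" using assms(6) by blast
        thus ?thesis using orth v E by blast
      qed
    qed
  qed
  show ?thesis
    using S.unit_ball_eq_closure S.spec_norm_attained S.spec_norm_le_sb_norm by blast
qed

end
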